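(* Let $f_C(\tau)=(C-\tau)g_2^2-18(C\eta_1-\eta_2)g_3$ for $C\in\mathbb R$. Then: (1) $f_C$ has no zeros in $F$ for any $C\in(0,1)$; (2) for any $C\in(1,+\infty)$ (resp. $C\in(-\infty,0)$), $f_C$ has a unique zero in $F$, namely $\tau_<(C)$ (resp. $\tau_>(C)$), and it satisfies $\tau_<(C)\in\mathring F\cap F_0^<$ (resp. $\tau_>(C)\in\mathring F\cap F_0^>$); (3) $\tau_0=\frac1{1-\tau_\infty}$ is the unique zero of $f_0$ in $F$, and $|\tau_0-1|=1$; (4) $\tau_1=\frac{\tau_\infty-1}{\tau_\infty}$ is the unique zero of $f_1$ in $F$, and $|\tau_1|=1$.
   Context: For $\tau\in\mathbb H$: $g_2(\tau)=60\sum_{(m,n)\ne(0,0)}(m\tau+n)^{-4}$, $g_3(\tau)=140\sum_{(m,n)\ne(0,0)}(m\tau+n)^{-6}$; $\eta_1(\tau)=2\zeta(\frac12;\tau)$, $\eta_2(\tau)=2\zeta(\frac\tau2;\tau)$ with $\zeta$ the Weierstrass zeta function of $\mathbb Z+\mathbb Z\tau$. $F_0=\{\tau\in\mathbb H:0\le\operatorname{Re}\tau\le1,|\tau-\frac12|\ge\frac12\}$, $\mathring F_0$ its interior, $F_0^<=\{\tau\in\mathring F_0:\operatorname{Re}\tau<\frac12\}$, $F_0^>=\{\tau\in\mathring F_0:\operatorname{Re}\tau>\frac12\}$. $F=\{\tau\in\mathbb H:0\le\operatorname{Re}\tau\le1,|\tau|\ge1,|\tau-1|\ge1\}$, $\mathring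 F$ its interior. $\tau_\infty$ is the unique zero of $g_3'$ in $F_0$. For $C\in\mathbb R\setminus\{0,1\}$, $\tau_<(C)$ (resp. $\tau_>(C)$) denotes the unique zero of $f_C$ in $F_0^<$ (resp. $F_0^>$). *)

theory Defs
  imports "HOL-Complex_Analysis.Complex_Analysis"
begin

definition upper_half_plane :: "complex set" where
  "upper_half_plane = {\<tau>. Im \<tau> > 0}"

text \<open>All lattice sums below converge absolutely for \<open>\<tau>\<close> in the upper half-plane, so the
  unordered sum \<^const>\<open>infsum\<close> is the intended value. The index \<open>(m, n)\<close> stands for the
  lattice point \<open>m\<tau> + n\<close>.\<close>

definition g2 :: "complex \<Rightarrow> complex" where
  "g2 \<tau> = 60 * (\<Sum>\<^sub>\<infinity>(m::int, n::int)\<in>UNIV - {(0, 0)}. 1 / (of_int m * \<tau> + of_int n) ^ 4)"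

definition g3 :: "complex \<Rightarrow> complex" where
  "g3 \<tau> = 140 * (\<Sum>\<^sub>\<infinity>(m::int, n::int)\<in>UNIV - {(0, 0)}. 1 / (of_int m * \<tau> + of_int n) ^ 6)"

definition weierstrass_zeta :: "complex \<Rightarrow> complex \<Rightarrow> complex" where
  "weierstrass_zeta z \<tau> = 1 / z +
     (\<Sum>\<^sub>\<infinity>(m::int, n::int)\<in>UNIV - {(0, 0)}.
        let \<omega> = of_int m * \<tau> + of_int n in 1 / (z - \<omega>) + 1 / \<omega> + z / \<omega> ^ 2)"

definition eta1 :: "complex \<Rightarrow> complex" where
  "eta1 \<tau> = 2 * weierstrass_zeta (1 / 2) \<tau>"

definition eta2 :: "complex \<Rightarrow> complex" where
  "eta2 \<tau> = 2 * weierstrass_zeta (\<tau> / 2) \<tau>"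

definition f :: "real \<Rightarrow> complex \<Rightarrow> complex" where
  "f C \<tau> = (of_real C - \<tau>) * (g2 \<tau>) ^ 2 - 18 * (of_real C * eta1 \<tau> - eta2 \<tau>) * g3 \<tau>"

definition F0 :: "complex set" where
  "F0 = {\<tau> \<in> upper_half_plane. 0 \<le> Re \<tau> \<and> Re \<tau> \<le> 1 \<and> cmod (\<tau> - 1 / 2) \<ge> 1 / 2}"

definition F0_less :: "complex set" where
  "F0_less = {\<tau> \<in> interior F0. Re \<tau> < 1 / 2}"

definition F0_greater :: "complex set" where
  "F0_greater = {\<tau> \<in> interior F0. Re \<tau> > 1 / 2}"

definition F :: "complex set" where
  "F = {\<tau> \<in> upper_half_plane. 0 \<le> Re \<tau> \<and> Re \<tau> \<le> 1 \<and> cmod \<tau> \<ge> 1 \<and> cmod (\<tau> - 1) \<ge> 1}"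

definition tau_inf :: complex where
  "tau_inf = (THE \<tau>. \<tau> \<in> F0 \<and> deriv g3 \<tau> = 0)"

text \<open>The next two are meant for \<open>C\<close> different from 0 and 1 only.\<close>

definition tau_less :: "real \<Rightarrow> complex" where
  "tau_less C = (THE \<tau>. \<tau> \<in> F0_less \<and> f C \<tau> = 0)"

definition tau_greater :: "real \<Rightarrow> complex" where
  "tau_greater C = (THE \<tau>. \<tau> \<in> F0_greater \<and> f C \<tau> = 0)"

end

theory Submission
  imports Defs "HOL-Real_Asymp.Real_Asymp"
begin

text \<open>
  By Ramanujan's formula for the derivative of \<open>E\<^sub>6\<close> and Legendre's relation,
  \<open>f C \<tau> = 6 \<pi> i ((C - \<tau>) g\<^sub>3' - 6 g\<^sub>3)\<close>, so that the zeros of \<open>f C\<close> are the points where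
  \<open>h \<tau> = \<tau> + 6 g\<^sub>3 / g\<^sub>3'\<close> takes the value \<open>C\<close>. The map \<open>h\<close> commutes with the modular group and
  with the reflection in the line \<open>Re \<tau> = 1/2\<close>. In the half strip \<open>0 < Re \<tau> < 1/2\<close>,
  \<open>Im \<tau> \<ge> sqrt 3 / 2\<close> one has \<open>Im h' < 0\<close>; hence \<open>h\<close> is injective there, its real locus is a graph over
  the imaginary part, and \<open>h\<close> increases along it to infinity. Since \<open>\<bar>h\<bar> = 1\<close> on the unit circle, the
  locus crosses the circle exactly once, where \<open>h = 1\<close>, so that \<open>h\<close> takes on the left half of \<open>F\<close>
  precisely the real values \<open>C \<ge> 1\<close>, each of them once. The rest of \<open>F0\<close> is reached through
  \<open>\<tau> \<mapsto> 1 - 1/\<tau>\<close>, which permutes the intervals \<open>(1, \<infinity>)\<close>, \<open>(0, 1)\<close> and \<open>(- \<infinity>, 0)\<close>.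
\<close>

section \<open>The reflection formula for the digamma function\<close>

text \<open>The definitions are unordered lattice sums, so the analytic input has to be derived from
  them: the Fourier expansions of \<open>g2\<close>, \<open>g3\<close> and \<open>eta1\<close>, the
  values zeta(4) and zeta(6), and Legendre's relation come out of cotangent series summed along the
  rows of the lattice. The bound |q| <= 1/230 for the nome q shapes the estimates. It holds for Im
  \<tau> >= sqrt 3 / 2, since exp(pi sqrt 3) slightly exceeds 230. This half strip contains the left
  half of \<open>F\<close> and, unlike it, is convex, which turns the sign of Im h' into
  injectivity. At that height the corrections in g3' are still near 30 percent, so leading terms
  alone do not decide the sign of Im h'. Points in the left half of \<open>F0\<close> below the unit
  circle are never estimated: the rotation of order three sends them into \<open>F\<close>, with a
  value of C that is already settled. The value -1, which |h| = 1 on the circle would also permit,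
  is excluded by the separate bound Re h > -1.\<close>

lemma sin_pi_nonzero_complex:
  fixes z :: complex
  assumes "z \<notin> \<int>"
  shows "sin (of_real pi * z) \<noteq> 0"
proof
  assume "sin (of_real pi * z) = 0"
  then obtain k :: int where "of_real pi * z = of_real (of_int k * pi)"
    by (auto simp: sin_eq_0)
  then have "z = of_int k" by simp
  with assms show False by auto
qed

text \<open>Logarithmic derivative of Gamma(z) Gamma(1 - z) = pi / sin(pi z). It is the source of
  the cotangent series below.\<close>

lemma Digamma_reflection:
  fixes z :: complex
  assumes "z \<notin> \<int>"
  shows "Digamma (1 - z) - Digamma z = of_real pi * cot (of_real pi * z)"
proof -
  have z: "z \<notin> \<int>\<^sub>\<le>\<^sub>0" "1 - z \<notin> \<int>\<^sub>\<le>\<^sub>0"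
    using assms nonpos_Ints_Int[of z] nonpos_Ints_Int[of "1 - z"] Ints_diff[of 1 "1 - z"] by auto
  have s0: "sin (of_real pi * z) \<noteq> 0"
    using assms by (rule sin_pi_nonzero_complex)
  have d1: "((\<lambda>w. Gamma w * Gamma (1 - w)) has_field_derivative
      Gamma z * Gamma (1 - z) * (Digamma z - Digamma (1 - z))) (at z)"
    using z by (auto intro!: derivative_eq_intros simp: algebra_simps)
  have d2: "((\<lambda>w. Gamma w * Gamma (1 - w)) has_field_derivative
      - (of_real pi * (cos (of_real pi * z) * of_real pi)) / (sin (of_real pi * z)) ^ 2) (at z)"
    unfolding Gamma_reflection_complex using s0
    by (auto intro!: derivative_eq_intros simp: power2_eq_square)
  have "Gamma z * Gamma (1 - z) * (Digamma z - Digamma (1 - z)) =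
      - (of_real pi * (cos (of_real pi * z) * of_real pi)) / (sin (of_real pi * z)) ^ 2"
    by (rule DERIV_unique [OF d1 d2])
  then have eq: "of_real pi / sin (of_real pi * z) * (Digamma z - Digamma (1 - z)) =
      - (of_real pi * (cos (of_real pi * z) * of_real pi)) / (sin (of_real pi * z)) ^ 2"
    unfolding Gamma_reflection_complex .
  have "Digamma z - Digamma (1 - z) = sin (of_real pi * z) / of_real pi *
      (of_real pi / sin (of_real pi * z) * (Digamma z - Digamma (1 - z)))"
    using s0 by simp
  also have "\<dots> = - (of_real pi * cot (of_real pi * z))"
    unfolding eq using s0 by (simp add: cot_def field_simps power2_eq_square)
  finally show ?thesis by (simp add: algebra_simps)
qed

text \<open>The negative half is indexed by -1 - n because z + (-1 - n) = -(1 - z + n): it becomes a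
  digamma or polygamma series at 1 - z.\<close>

lemma has_sum_int_split:
  fixes g :: "int \<Rightarrow> 'a :: {comm_monoid_add, topological_comm_monoid_add}"
  assumes "((\<lambda>n. g (int n)) has_sum a) UNIV" "((\<lambda>n. g (- 1 - int n)) has_sum b) UNIV"
  shows "(g has_sum (a + b)) UNIV"
proof -
  have 1: "(g has_sum a) {0..}"
    using assms(1) by (subst (asm) has_sum_reindex_bij_betw[of int UNIV "{0..}" g])
      (auto simp: bij_betw_def inj_on_def image_iff intro: nonneg_int_cases)
  have 2: "(g has_sum b) {..< 0}"
  proof -
    have "bij_betw (\<lambda>n. - 1 - int n) UNIV {..<0}"
      by (rule bij_betw_byWitness[where f' = "\<lambda>m. nat (- 1 - m)"]) auto
    from has_sum_reindex_bij_betw[OF this, of g b] assms(2) show ?thesis by simp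
  qed
  have "(g has_sum (a + b)) ({0..} \<union> {..<0})"
    by (rule has_sum_Un_disjoint[OF 1 2]) auto
  also have "{0..} \<union> {..<0::int} = UNIV" by auto
  finally show ?thesis .
qed

lemma summable_on_int_split:
  fixes g :: "int \<Rightarrow> 'a :: {comm_monoid_add, topological_comm_monoid_add, t2_space}"
  assumes "(\<lambda>n. g (int n)) summable_on UNIV" "(\<lambda>n. g (- 1 - int n)) summable_on UNIV"
  shows "g summable_on UNIV"
  using has_sum_int_split[of g] assms unfolding summable_on_def by blast

lemma summable_norm_shifted_power:
  fixes z :: complex
  assumes "k \<ge> 2"
  shows "summable (\<lambda>n. norm (1 / (z + of_nat n) ^ k))"
proof (rule summable_comparison_test_ev)
  show "summable (\<lambda>n. 2 ^ k * inverse (real n ^ k))"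
    using inverse_power_summable[OF assms, where 'a = real] by (intro summable_mult) simp
  show "eventually (\<lambda>n. norm (norm (1 / (z + of_nat n) ^ k)) \<le> 2 ^ k * inverse (real n ^ k)) sequentially"
    using eventually_ge_at_top[of "nat \<lceil>2 * norm z\<rceil> + 1"]
  proof eventually_elim
    case (elim n)
    have n: "real n > 0" "real n \<ge> 2 * norm z" using elim by linarith+
    have "real n = norm (z + of_nat n - z)" by simp
    also have "\<dots> \<le> norm (z + of_nat n) + norm z" by (rule norm_triangle_ineq4)
    finally have "real n / 2 \<le> norm (z + of_nat n)" using n by simp
    then have "(real n / 2) ^ k \<le> norm (z + of_nat n) ^ k"
      using n by (intro power_mono) auto
    then have "1 / norm (z + of_nat n) ^ k \<le> 1 / (real n / 2) ^ k"
      using n by (intro frac_le) (auto intro!: zero_less_power)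
    then show ?case by (simp add: norm_divide norm_power power_divide field_simps)
  qed
qed

text \<open>The terms 1 / (u + n) alone are not absolutely summable, so an unordered sum exists only
  for the difference of two such series. Each half is a difference of digamma values, and the
  reflection formula joins the halves.\<close>

lemma has_sum_cot_diff:
  fixes u v :: complex
  assumes "u \<notin> \<int>" "v \<notin> \<int>"
  shows "((\<lambda>n::int. 1 / (u + of_int n) - 1 / (v + of_int n)) has_sum
           (of_real pi * cot (of_real pi * u) - of_real pi * cot (of_real pi * v))) UNIV"
proof -
  have nz: "z + of_nat n \<noteq> 0" if "z \<notin> \<int>" for z :: complex and n
  proof
    assume "z + of_nat n = 0"
    then have "z = - of_nat n" by (simp add: eq_neg_iff_add_eq_0)
    then have "z \<in> \<int>" by simp
    with that show False by simp
  qed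
  have *: "((\<lambda>n. 1 / (x + of_nat n) - 1 / (y + of_nat n)) has_sum (Digamma y - Digamma x)) UNIV"
    if xy: "x \<notin> \<int>" "y \<notin> \<int>" for x y :: complex
  proof (rule norm_summable_imp_has_sum)
    show "summable (\<lambda>n. norm (1 / (x + of_nat n) - 1 / (y + of_nat n)))"
    proof (rule summable_comparison_test)
      show "summable (\<lambda>n. norm (y - x) * (norm (1 / (x + of_nat n) ^ 2) + norm (1 / (y + of_nat n) ^ 2)))"
        by (intro summable_mult summable_add summable_norm_shifted_power) auto
      have "norm (1 / (x + of_nat n) - 1 / (y + of_nat n))
          \<le> norm (y - x) * (norm (1 / (x + of_nat n) ^ 2) + norm (1 / (y + of_nat n) ^ 2))" for n
      proof -
        define p where "p = norm (1 / (x + of_nat n))"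
        define r where "r = norm (1 / (y + of_nat n))"
        have "1 / (x + of_nat n) - 1 / (y + of_nat n) =
            (y - x) * (1 / (x + of_nat n) * (1 / (y + of_nat n)))"
          using nz[OF xy(1), of n] nz[OF xy(2), of n] by (simp add: field_simps)
        then have "norm (1 / (x + of_nat n) - 1 / (y + of_nat n)) = norm (y - x) * (p * r)"
          by (simp only: norm_mult p_def r_def)
        also have "p * r \<le> p ^ 2 + r ^ 2"
        proof -
          have "0 \<le> p * r" by (simp add: p_def r_def)
          with sum_squares_bound[of p r] show ?thesis by linarith
        qed
        finally show ?thesis
          by (simp add: p_def r_def norm_divide norm_power power_divide mult_left_mono)
      qed
      then show "\<exists>N. \<forall>n\<ge>N. norm (norm (1 / (x + of_nat n) - 1 / (y + of_nat n)))
          \<le> norm (y - x) * (norm (1 / (x + of_nat n) ^ 2) + norm (1 / (y + of_nat n) ^ 2))"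
        by simp
    qed
    have "x \<noteq> 0" "y \<noteq> 0" using xy by auto
    then have "(\<lambda>n. (inverse (of_nat (Suc n)) - inverse (y + of_nat n)) -
        (inverse (of_nat (Suc n)) - inverse (x + of_nat n))) sums
        ((\<Sum>n. inverse (of_nat (Suc n)) - inverse (y + of_nat n)) -
         (\<Sum>n. inverse (of_nat (Suc n)) - inverse (x + of_nat n)))"
      by (intro sums_diff summable_sums summable_Digamma)
    then show "(\<lambda>n. 1 / (x + of_nat n) - 1 / (y + of_nat n)) sums (Digamma y - Digamma x)"
      by (simp add: Digamma_def inverse_eq_divide)
  qed
  have I: "1 - u \<notin> \<int>" "1 - v \<notin> \<int>"
    using assms Ints_diff[of 1 "1 - u"] Ints_diff[of 1 "1 - v"] by auto
  have "((\<lambda>n::int. 1 / (u + of_int n) - 1 / (v + of_int n)) has_sum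
      ((Digamma v - Digamma u) + (Digamma (1 - u) - Digamma (1 - v)))) UNIV"
  proof (rule has_sum_int_split)
    show "((\<lambda>n. 1 / (u + of_int (int n)) - 1 / (v + of_int (int n))) has_sum
        (Digamma v - Digamma u)) UNIV"
      using *[OF assms] by simp
    have "1 / (u + of_int (- 1 - int n)) - 1 / (v + of_int (- 1 - int n)) =
        1 / (1 - v + of_nat n) - 1 / (1 - u + of_nat n)" for n
    proof -
      have "u + of_int (- 1 - int n) = - (1 - u + of_nat n)"
           "v + of_int (- 1 - int n) = - (1 - v + of_nat n)" by simp_all
      then show ?thesis by (simp only: divide_minus_right) simp
    qed
    then show "((\<lambda>n. 1 / (u + of_int (- 1 - int n)) - 1 / (v + of_int (- 1 - int n))) has_sum
        (Digamma (1 - u) - Digamma (1 - v))) UNIV"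
      using *[OF I(2) I(1)] by presburger
  qed
  also have "(Digamma v - Digamma u) + (Digamma (1 - u) - Digamma (1 - v)) =
      of_real pi * cot (of_real pi * u) - of_real pi * cot (of_real pi * v)"
    using Digamma_reflection[OF assms(1)] Digamma_reflection[OF assms(2)] by (simp add: algebra_simps)
  finally show ?thesis .
qed

text \<open>For odd j the exponent is even, so reflecting the negative half to 1 - z costs no
  sign.\<close>

lemma has_sum_int_power_Polygamma:
  fixes z :: complex
  assumes "odd j"
  shows "((\<lambda>n::int. 1 / (z + of_int n) ^ (j + 1)) has_sum
           ((Polygamma j (1 - z) + Polygamma j z) / fact j)) UNIV"
proof -
  have j: "j > 0" "j + 1 \<ge> 2" using assms by (auto elim!: oddE)
  have *: "((\<lambda>n. 1 / (x + of_nat n) ^ (j + 1)) has_sum (Polygamma j x / fact j)) UNIV" for x :: complex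
  proof (rule norm_summable_imp_has_sum)
    show "summable (\<lambda>n. norm (1 / (x + of_nat n) ^ (j + 1)))"
      by (rule summable_norm_shifted_power[OF j(2)])
    then have "(\<lambda>n. 1 / (x + of_nat n) ^ (j + 1)) sums (\<Sum>n. 1 / (x + of_nat n) ^ (j + 1))"
      by (intro summable_sums) (rule summable_norm_cancel)
    then show "(\<lambda>n. 1 / (x + of_nat n) ^ (j + 1)) sums (Polygamma j x / fact j)"
      using j assms by (simp add: Polygamma_def inverse_eq_divide)
  qed
  have "((\<lambda>n::int. 1 / (z + of_int n) ^ (j + 1)) has_sum
           (Polygamma j z / fact j + Polygamma j (1 - z) / fact j)) UNIV"
  proof (rule has_sum_int_split)
    show "((\<lambda>n. 1 / (z + of_int (int n)) ^ (j + 1)) has_sum Polygamma j z / fact j) UNIV"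
      using *[of z] by simp
    have "1 / (z + of_int (- 1 - int n)) ^ (j + 1) = 1 / (1 - z + of_nat n) ^ (j + 1)" for n
    proof -
      have "z + of_int (- 1 - int n) = - (1 - z + of_nat n)" by simp
      moreover have "even (j + 1)" using assms by simp
      ultimately show ?thesis by (simp only: power_minus_even)
    qed
    then show "((\<lambda>n. 1 / (z + of_int (- 1 - int n)) ^ (j + 1)) has_sum Polygamma j (1 - z) / fact j) UNIV"
      using *[of "1 - z"] by presburger
  qed
  then show ?thesis by (simp add: add_divide_distrib add.commute)
qed

section \<open>Lipschitz formula and zeta values\<close>

definition powser :: "(nat \<Rightarrow> complex) \<Rightarrow> complex \<Rightarrow> complex" where
  "powser c x = (\<Sum>n. c n * x ^ n)"

definition converges_on_disk :: "(nat \<Rightarrow> complex) \<Rightarrow> bool" where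
  "converges_on_disk c \<longleftrightarrow> (\<forall>x. norm x < 1 \<longrightarrow> summable (\<lambda>n. c n * x ^ n))"

lemma DERIV_powser:
  assumes "converges_on_disk c" "norm x < 1"
  shows "(powser c has_field_derivative (\<Sum>n. diffs c n * x ^ n)) (at x)"
proof -
  define K where "K = (1 + norm x) / 2"
  have K: "norm x < K" "K < 1" using assms(2) by (auto simp: K_def)
  then have "0 < K" using norm_ge_zero[of x] by linarith
  have "summable (\<lambda>n. c n * complex_of_real K ^ n)"
    using assms(1) K \<open>0 < K\<close> by (auto simp: converges_on_disk_def)
  then show ?thesis
    unfolding powser_def using K \<open>0 < K\<close> by (intro termdiffs_strong) auto
qed

lemma converges_on_disk_diffs:
  assumes "converges_on_disk c"
  shows "converges_on_disk (diffs c)"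
  unfolding converges_on_disk_def
proof (intro allI impI)
  fix x :: complex assume x: "norm x < 1"
  show "summable (\<lambda>n. diffs c n * x ^ n)"
    by (rule termdiff_converges[OF x]) (use assms in \<open>auto simp: converges_on_disk_def\<close>)
qed

lemma
  assumes "converges_on_disk c"
  shows converges_on_disk_times_n: "converges_on_disk (\<lambda>n. of_nat n * c n)" (is ?A)
    and powser_times_n: "norm x < 1 \<Longrightarrow> powser (\<lambda>n. of_nat n * c n) x = x * (\<Sum>n. diffs c n * x ^ n)"
proof -
  have *: "(\<lambda>n. of_nat n * c n * x ^ n) sums (x * (\<Sum>n. diffs c n * x ^ n))" if x: "norm x < 1" for x
  proof -
    have "summable (\<lambda>n. diffs c n * x ^ n)"
      using converges_on_disk_diffs[OF assms] x by (auto simp: converges_on_disk_def)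
    then have "(\<lambda>n. x * (diffs c n * x ^ n)) sums (x * (\<Sum>n. diffs c n * x ^ n))"
      by (intro sums_mult summable_sums)
    then have "(\<lambda>n. of_nat (Suc n) * c (Suc n) * x ^ Suc n) sums (x * (\<Sum>n. diffs c n * x ^ n))"
      by (simp add: diffs_def algebra_simps)
    from sums_Suc[OF this] show ?thesis by simp
  qed
  show ?A
    using * by (auto simp: converges_on_disk_def sums_iff)
  show "powser (\<lambda>n. of_nat n * c n) x = x * (\<Sum>n. diffs c n * x ^ n)" if "norm x < 1"
    using *[OF that] by (simp add: powser_def sums_iff)
qed

lemma converges_on_disk_const [simp]: "converges_on_disk (\<lambda>n. a)"
  by (auto simp: converges_on_disk_def intro!: summable_mult summable_geometric)

lemma converges_on_disk_power: "converges_on_disk (\<lambda>n. of_nat n ^ k)"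
proof (induction k)
  case (Suc k)
  from converges_on_disk_times_n[OF this] show ?case by simp
qed simp

lemma converges_on_disk_comparison:
  assumes "converges_on_disk (\<lambda>n. of_nat (b n))" "\<And>n. norm (c n) \<le> real (b n)"
  shows "converges_on_disk c"
  unfolding converges_on_disk_def
proof (intro allI impI)
  fix x :: complex assume x: "norm x < 1"
  have "summable (\<lambda>n. of_nat (b n) * complex_of_real (norm x) ^ n)"
    using assms(1) x by (auto simp: converges_on_disk_def)
  also have "(\<lambda>n. of_nat (b n) * complex_of_real (norm x) ^ n) = (\<lambda>n. of_real (b n * norm x ^ n))"
    by auto
  finally have "summable (\<lambda>n. b n * norm x ^ n)"
    by (subst (asm) summable_of_real_iff)
  then show "summable (\<lambda>n. c n * x ^ n)"
    by (rule summable_comparison_test'[where N = 0])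
      (auto simp: norm_mult norm_power intro!: mult_right_mono assms(2))
qed

lemma powser_sums:
  assumes "converges_on_disk c" "norm x < 1"
  shows "(\<lambda>n. c n * x ^ n) sums powser c x"
  using assms by (auto simp: converges_on_disk_def powser_def summable_sums)

lemma holomorphic_powser:
  assumes "converges_on_disk c"
  shows "powser c holomorphic_on ball 0 1"
  unfolding holomorphic_on_open[OF open_ball]
proof
  fix x :: complex assume "x \<in> ball 0 1"
  with DERIV_powser[OF assms, of x] show "\<exists>f'. (powser c has_field_derivative f') (at x)"
    by auto
qed

definition nome :: "complex \<Rightarrow> complex" where
  "nome z = exp (2 * of_real pi * \<i> * z)"

lemma norm_nome: "norm (nome z) = exp (- (2 * pi * Im z))"
  by (simp add: nome_def)

lemma norm_nome_less_1: "Im z > 0 \<Longrightarrow> norm (nome z) < 1"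
  by (simp add: norm_nome)

lemma nome_nonzero [simp]: "nome z \<noteq> 0"
  by (simp add: nome_def)

text \<open>Differentiation in the upper half-plane is 2 pi i q d/dq and multiplies the n-th
  coefficient by n, so derivatives stay within power series in the nome.\<close>

lemma DERIV_powser_nome:
  assumes "converges_on_disk c" "Im z > 0"
  shows "((\<lambda>z. powser c (nome z)) has_field_derivative
           2 * of_real pi * \<i> * powser (\<lambda>n. of_nat n * c n) (nome z)) (at z)"
proof -
  have n: "(nome has_field_derivative 2 * of_real pi * \<i> * nome z) (at z)"
    unfolding nome_def by (auto intro!: derivative_eq_intros)
  have "((\<lambda>z. powser c (nome z)) has_field_derivative
      (\<Sum>n. diffs c n * nome z ^ n) * (2 * of_real pi * \<i> * nome z)) (at z)"
    by (rule DERIV_chain2[OF DERIV_powser[OF assms(1)] n]) (rule norm_nome_less_1[OF assms(2)])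
  also have "(\<Sum>n. diffs c n * nome z ^ n) * (2 * of_real pi * \<i> * nome z) =
      2 * of_real pi * \<i> * powser (\<lambda>n. of_nat n * c n) (nome z)"
    by (subst powser_times_n[OF assms(1) norm_nome_less_1[OF assms(2)]]) simp
  finally show ?thesis .
qed

lemma DERIV_unique_open:
  assumes "open S" "z \<in> S" "\<And>w. w \<in> S \<Longrightarrow> g w = h w"
    "(g has_field_derivative a) (at z)" "(h has_field_derivative b) (at z)"
  shows "a = b"
proof -
  have "(h has_field_derivative a) (at z)"
    using has_field_derivative_transform_within_open[OF assms(4,1,2,3)] .
  then show ?thesis using assms(5) by (rule DERIV_unique)
qed

lemma open_upper_half_plane: "open {z. Im z > 0}"
  by (simp add: open_halfspace_Im_gt)

lemma pi_cot_conv_nome: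
  assumes "Im z > 0"
  shows "of_real pi * cot (of_real pi * z) = of_real pi * \<i> - 2 * of_real pi * \<i> / (1 - nome z)"
proof -
  define E where "E = exp (\<i> * (of_real pi * z))"
  have E: "nome z = E ^ 2" "E \<noteq> 0"
    by (simp_all add: nome_def E_def flip: exp_double) (simp add: algebra_simps)
  have "norm (nome z) \<noteq> 1" using norm_nome_less_1[OF assms] by simp
  then have E1: "E ^ 2 \<noteq> 1" unfolding E by auto
  then have E2: "1 - E ^ 2 \<noteq> 0" "E ^ 2 - 1 \<noteq> 0" by auto
  have c: "cos (of_real pi * z) = (E + 1 / E) / 2" "sin (of_real pi * z) = (E - 1 / E) / (2 * \<i>)"
    by (simp_all add: cos_exp_eq sin_exp_eq E_def exp_minus inverse_eq_divide)
  have "cot (of_real pi * z) = \<i> * (E ^ 2 + 1) / (E ^ 2 - 1)"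
    unfolding cot_def c using E2 \<open>E \<noteq> 0\<close> by (simp add: field_simps power2_eq_square)
  also have "\<dots> = \<i> - 2 * \<i> / (1 - E ^ 2)"
    using E2 by (simp add: field_simps)
  finally show ?thesis by (simp add: E right_diff_distrib)
qed

lemma not_Int_if_Im: "Im z \<noteq> 0 \<Longrightarrow> z \<notin> \<int>"
  by (auto elim!: Ints_cases)

text \<open>The cotangent of the base case is pi i minus 2 pi i times a geometric series in the
  nome. Each differentiation multiplies the d-th coefficient by 2 pi i d and flips the sign of the
  term at 1 - z; the constant pi i disappears after the first one.\<close>

lemma Polygamma_reflection_nome:
  assumes "Im z > 0"
  shows "(- 1) ^ j * Polygamma j (1 - z) - Polygamma j z =
    (if j = 0 then of_real pi * \<i> else 0)
    - (2 * of_real pi * \<i>) ^ (j + 1) * powser (\<lambda>d. of_nat d ^ j) (nome z)"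
  using assms
proof (induction j arbitrary: z)
  case 0
  \<comment> \<open>Here \<open>0 ^ 0 = 1\<close>, so the term d = 0 is present and the geometric
    series is complete.\<close>
  have "powser (\<lambda>d. of_nat d ^ 0) (nome z) = 1 / (1 - nome z)"
    using norm_nome_less_1[OF 0] by (simp add: powser_def suminf_geometric)
  then show ?case
    using Digamma_reflection[of z] not_Int_if_Im[of z] 0 by (simp add: pi_cot_conv_nome)
next
  case (Suc j)
  have I: "w \<notin> \<int>\<^sub>\<le>\<^sub>0" "1 - w \<notin> \<int>\<^sub>\<le>\<^sub>0" if "Im w > 0" for w
    using not_Int_if_Im[of w] not_Int_if_Im[of "1 - w"] that nonpos_Ints_Int by force+
  have 1: "((\<lambda>z. (- 1) ^ j * Polygamma j (1 - z) - Polygamma j z) has_field_derivative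
      (- 1) ^ Suc j * Polygamma (Suc j) (1 - z) - Polygamma (Suc j) z) (at z)"
    using I[OF Suc.prems] by (auto intro!: derivative_eq_intros)
  have 2: "((\<lambda>z. (if j = 0 then of_real pi * \<i> else 0)
      - (2 * of_real pi * \<i>) ^ (j + 1) * powser (\<lambda>d. of_nat d ^ j) (nome z)) has_field_derivative
      0 - (2 * of_real pi * \<i>) ^ (j + 1) *
        (2 * of_real pi * \<i> * powser (\<lambda>n. of_nat n * of_nat n ^ j) (nome z))) (at z)"
    by (intro DERIV_diff DERIV_const DERIV_cmult DERIV_powser_nome converges_on_disk_power Suc.prems)
  have "(- 1) ^ Suc j * Polygamma (Suc j) (1 - z) - Polygamma (Suc j) z =
      0 - (2 * of_real pi * \<i>) ^ (j + 1) *
        (2 * of_real pi * \<i> * powser (\<lambda>n. of_nat n * of_nat n ^ j) (nome z))"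
    by (rule DERIV_unique_open[OF open_upper_half_plane _ _ 1 2]) (use Suc in auto)
  then show ?case by (simp add: mult_ac)
qed

lemma Lipschitz_formula:
  assumes "Im z > 0" "odd j"
  shows "((\<lambda>n::int. 1 / (z + of_int n) ^ (j + 1)) has_sum
           ((2 * of_real pi * \<i>) ^ (j + 1) / fact j * powser (\<lambda>d. of_nat d ^ j) (nome z))) UNIV"
proof -
  have "j \<noteq> 0" using assms by (auto elim: oddE)
  then have eq: "Polygamma j (1 - z) + Polygamma j z =
      (2 * of_real pi * \<i>) ^ (j + 1) * powser (\<lambda>d. of_nat d ^ j) (nome z)"
    using Polygamma_reflection_nome[OF assms(1), of j] assms(2) by (simp add: algebra_simps)
  show ?thesis
    using has_sum_int_power_Polygamma[OF assms(2), of z] unfolding eq by simp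
qed

section \<open>The values of the zeta function at 4 and 6\<close>

lemma Polygamma_reflection_cot:
  fixes z :: complex
  assumes "z \<notin> \<int>"
  defines "c \<equiv> cot (of_real pi * z)"
  shows "Polygamma 3 (1 - z) + Polygamma 3 z = of_real pi ^ 4 * ((6 * c ^ 2 + 2) * (c ^ 2 + 1))" (is ?A)
    and "Polygamma 5 (1 - z) + Polygamma 5 z =
           of_real pi ^ 6 * ((120 * c ^ 4 + 120 * c ^ 2 + 16) * (c ^ 2 + 1))" (is ?B)
proof -
  define ct where "ct = (\<lambda>z::complex. cot (of_real pi * z))"
  have op: "open (- \<int> :: complex set)" by auto
  have I: "w \<notin> \<int>\<^sub>\<le>\<^sub>0" "1 - w \<notin> \<int>\<^sub>\<le>\<^sub>0" if "w \<in> - \<int>" for w :: complex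
    using that nonpos_Ints_Int[of w] nonpos_Ints_Int[of "1 - w"] Ints_diff[of 1 "1 - w"] by auto
  have ct: "(ct has_field_derivative - of_real pi * (ct w ^ 2 + 1)) (at w within A)" if "w \<in> - \<int>" for w A
  proof -
    have s: "sin (of_real pi * w) \<noteq> 0" using sin_pi_nonzero_complex[of w] that by simp
    have "inverse (sin (of_real pi * w) ^ 2) = ct w ^ 2 + 1"
      using s sin_cos_squared_add[of "of_real pi * w"] by (simp add: ct_def cot_def field_simps)
    moreover have "(ct has_field_derivative - inverse (sin (of_real pi * w) ^ 2) * of_real pi) (at w)"
      unfolding ct_def
      by (rule DERIV_chain2[where f = cot and g = "\<lambda>z. of_real pi * z" and x = w, OF DERIV_cot[OF s]]) (auto intro!: derivative_eq_intros)
    ultimately show ?thesis by (metis has_field_derivative_at_within mult.commute mult_minus_left)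
  qed
  \<comment> \<open>Repeated differentiation of the reflection formula. Since the derivative of
    \<open>ct\<close> is -pi (ct^2 + 1), every order is again a polynomial in
    \<open>ct\<close>.\<close>
  have 0: "Digamma (1 - w) - Digamma w = of_real pi * ct w" if "w \<in> - \<int>" for w
    using Digamma_reflection[of w] that by (simp add: ct_def)
  have 1: "- Polygamma 1 (1 - w) - Polygamma 1 w = - (of_real pi ^ 2 * (ct w ^ 2 + 1))" if "w \<in> - \<int>" for w
    by (rule DERIV_unique_open[OF op that 0]) (use I[OF that] in \<open>auto intro!: derivative_eq_intros ct that simp: power2_eq_square\<close>)
  have 2: "Polygamma 2 (1 - w) - Polygamma 2 w = of_real pi ^ 3 * (2 * ct w * (ct w ^ 2 + 1))" if "w \<in> - \<int>" for w
    by (rule DERIV_unique_open[OF op that 1]) (use I[OF that] in \<open>auto intro!: derivative_eq_intros ct that simp: eval_nat_numeral algebra_simps\<close>)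
  have 3: "- Polygamma 3 (1 - w) - Polygamma 3 w = - (of_real pi ^ 4 * ((6 * ct w ^ 2 + 2) * (ct w ^ 2 + 1)))" if "w \<in> - \<int>" for w
    by (rule DERIV_unique_open[OF op that 2]) (use I[OF that] in \<open>auto intro!: derivative_eq_intros ct that simp: eval_nat_numeral algebra_simps\<close>)
  have 4: "Polygamma 4 (1 - w) - Polygamma 4 w = of_real pi ^ 5 * ((24 * ct w ^ 3 + 16 * ct w) * (ct w ^ 2 + 1))" if "w \<in> - \<int>" for w
    by (rule DERIV_unique_open[OF op that 3]) (use I[OF that] in \<open>auto intro!: derivative_eq_intros ct that simp: eval_nat_numeral algebra_simps\<close>)
  have 5: "- Polygamma 5 (1 - w) - Polygamma 5 w = - (of_real pi ^ 6 * ((120 * ct w ^ 4 + 120 * ct w ^ 2 + 16) * (ct w ^ 2 + 1)))" if "w \<in> - \<int>" for w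
    by (rule DERIV_unique_open[OF op that 4]) (use I[OF that] in \<open>auto intro!: derivative_eq_intros ct that simp: eval_nat_numeral algebra_simps\<close>)
  show ?A using 3[of z] assms(1) by (simp add: ct_def c_def algebra_simps)
  show ?B using 5[of z] assms(1) by (simp add: ct_def c_def algebra_simps)
qed

text \<open>\<open>Polygamma j x\<close> has the pole j! / x^(j + 1) at 0, which passing to
  \<open>x + 1\<close> removes. As x tends to 0 both remaining terms tend to the value at 1, which
  is j! zeta(j + 1).\<close>

lemma zeta_via_cot_limit:
  assumes "((\<lambda>x. pi ^ (j + 1) * P (cot (pi * x)) - fact j / x ^ (j + 1)) \<longlongrightarrow> L) (at_right 0)"
    "odd j" "j \<noteq> 0"
    "\<And>x. 0 < x \<Longrightarrow> x < 1 \<Longrightarrow>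
      Polygamma j (1 - of_real x) + Polygamma j (of_real x) = complex_of_real (pi ^ (j + 1) * P (cot (pi * x)))"
  shows "(\<lambda>n. 1 / real (Suc n) ^ (j + 1)) sums (L / (2 * fact j))"
proof -
  have "((\<lambda>x::real. Polygamma j (1 - x) + Polygamma j (x + 1)) \<longlongrightarrow> Polygamma j (1 - 0) + Polygamma j (0 + 1)) (at_right 0)"
    by (intro tendsto_intros) auto
  moreover have "((\<lambda>x::real. Polygamma j (1 - x) + Polygamma j (x + 1)) \<longlongrightarrow> L) (at_right 0)"
  proof (rule Lim_transform_eventually[OF assms(1)])
    show "eventually (\<lambda>x. pi ^ (j + 1) * P (cot (pi * x)) - fact j / x ^ (j + 1) =
        Polygamma j (1 - x) + Polygamma j (x + 1)) (at_right 0)"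
      using eventually_at_right_real[OF zero_less_one]
    proof eventually_elim
      case (elim x)
      have "complex_of_real (Polygamma j (1 - x) + Polygamma j x) =
          Polygamma j (of_real (1 - x)) + Polygamma j (of_real x)"
        using elim by (subst (1 2) Polygamma_of_real) auto
      also have "\<dots> = of_real (pi ^ (j + 1) * P (cot (pi * x)))"
        using assms(4)[of x] elim by simp
      finally have "Polygamma j (1 - x) + Polygamma j x = pi ^ (j + 1) * P (cot (pi * x))"
        by (subst (asm) of_real_eq_iff)
      moreover have "Polygamma j (x + 1) = Polygamma j x - fact j / x ^ (j + 1)"
        using Polygamma_plus1[of x j] elim assms(2) by simp
      ultimately show ?case by simp
    qed
  qed
  ultimately have "L = 2 * Polygamma j (1::real)"
    using tendsto_unique[OF trivial_limit_at_right_real] by (smt (verit))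
  also have "\<dots> = 2 * (fact j * (\<Sum>k. inverse ((1 + real k) ^ Suc j)))"
    using assms by (simp add: Polygamma_def)
  finally have "L / (2 * fact j) = (\<Sum>k. 1 / real (Suc k) ^ (j + 1))"
    by (simp add: inverse_eq_divide)
  moreover have "summable (\<lambda>k. 1 / real (Suc k) ^ (j + 1))"
    using assms(2,3) inverse_power_summable[of "j + 1", where 'a = real]
    by (subst summable_Suc_iff) (auto simp: inverse_eq_divide elim!: oddE)
  ultimately show ?thesis by (simp add: sums_iff)
qed

lemma of_real_not_Int:
  assumes "0 < x" "x < 1"
  shows "complex_of_real x \<notin> \<int>"
proof
  assume "complex_of_real x \<in> \<int>"
  then obtain k :: int where "complex_of_real x = of_int k" by (auto elim: Ints_cases)
  then have "x = of_int k" by (metis of_real_eq_iff of_real_of_int_eq)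
  with assms show False by auto
qed

lemma zeta_4_sums: "(\<lambda>n. 1 / real (Suc n) ^ 4) sums (pi ^ 4 / 90)"
proof -
  \<comment> \<open>With t = pi x, the constant term of the Laurent expansion is 2/15 = 2 * 3! *
    zeta(4) / pi^4. In the same way 16/63 below is 2 * 5! * zeta(6) / pi^6.\<close>
  have "((\<lambda>t::real. (6 * (cos t / sin t) ^ 2 + 2) * ((cos t / sin t) ^ 2 + 1) - 6 / t ^ 4) \<longlongrightarrow> 2 / 15) (at_right 0)"
    by real_asymp
  then have "((\<lambda>t::real. pi ^ 4 * ((6 * cot t ^ 2 + 2) * (cot t ^ 2 + 1) - 6 / t ^ 4)) \<longlongrightarrow> pi ^ 4 * (2 / 15)) (at_right 0)"
    unfolding cot_def by (intro tendsto_mult tendsto_const)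
  then have "((\<lambda>x::real. pi ^ 4 * ((6 * cot (pi * x) ^ 2 + 2) * (cot (pi * x) ^ 2 + 1) - 6 / (pi * x) ^ 4)) \<longlongrightarrow> pi ^ 4 * (2 / 15)) (at_right 0)"
    by (rule filterlim_compose) real_asymp
  then have "((\<lambda>x. pi ^ (3 + 1) * ((6 * cot (pi * x) ^ 2 + 2) * (cot (pi * x) ^ 2 + 1)) - fact 3 / x ^ (3 + 1)) \<longlongrightarrow> pi ^ 4 * (2 / 15)) (at_right 0)"
    by (simp add: field_simps fact_numeral)
  from zeta_via_cot_limit[OF this] show ?thesis
    using Polygamma_reflection_cot(1)[OF of_real_not_Int]
    by (simp add: fact_numeral cot_of_real)
qed

lemma zeta_6_sums: "(\<lambda>n. 1 / real (Suc n) ^ 6) sums (pi ^ 6 / 945)"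
proof -
  have "((\<lambda>t::real. (120 * (cos t / sin t) ^ 4 + 120 * (cos t / sin t) ^ 2 + 16) * ((cos t / sin t) ^ 2 + 1) - 120 / t ^ 6) \<longlongrightarrow> 16 / 63) (at_right 0)"
    by real_asymp
  then have "((\<lambda>t::real. pi ^ 6 * ((120 * cot t ^ 4 + 120 * cot t ^ 2 + 16) * (cot t ^ 2 + 1) - 120 / t ^ 6)) \<longlongrightarrow> pi ^ 6 * (16 / 63)) (at_right 0)"
    unfolding cot_def by (intro tendsto_mult tendsto_const)
  then have "((\<lambda>x::real. pi ^ 6 * ((120 * cot (pi * x) ^ 4 + 120 * cot (pi * x) ^ 2 + 16) * (cot (pi * x) ^ 2 + 1) - 120 / (pi * x) ^ 6)) \<longlongrightarrow> pi ^ 6 * (16 / 63)) (at_right 0)"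
    by (rule filterlim_compose) real_asymp
  then have "((\<lambda>x. pi ^ (5 + 1) * ((120 * cot (pi * x) ^ 4 + 120 * cot (pi * x) ^ 2 + 16) * (cot (pi * x) ^ 2 + 1)) - fact 5 / x ^ (5 + 1)) \<longlongrightarrow> pi ^ 6 * (16 / 63)) (at_right 0)"
    by (simp add: field_simps fact_numeral)
  from zeta_via_cot_limit[OF this] show ?thesis
    using Polygamma_reflection_cot(2)[OF of_real_not_Int]
    by (simp add: fact_numeral cot_of_real)
qed

section \<open>Lattice sums by rows\<close>

text \<open>At \<open>n = 0\<close> the set of divisors is infinite and the sum is \<open>0\<close>
  by convention, so the divisor series have no constant term.\<close>

definition sigma_sum :: "nat \<Rightarrow> nat \<Rightarrow> nat" where
  "sigma_sum k n = (\<Sum>d | d dvd n. d ^ k)"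

lemma sigma_sum_0 [simp]: "sigma_sum k 0 = 0"
  by (simp add: sigma_sum_def)

lemma sigma_sum_le: "sigma_sum k n \<le> n ^ (k + 1)"
proof (cases "n = 0")
  case False
  have "sigma_sum k n \<le> (\<Sum>d | d dvd n. n ^ k)"
    unfolding sigma_sum_def using False by (intro sum_mono power_mono) (auto dest: dvd_imp_le)
  also have "\<dots> = card {d. d dvd n} * n ^ k" by simp
  also have "card {d. d dvd n} \<le> card {1..n}"
    using False by (intro card_mono) (auto dest: dvd_imp_le intro: Nat.gr0I simp: Suc_le_eq)
  finally show ?thesis by simp
qed simp

lemma converges_on_disk_sigma: "converges_on_disk (\<lambda>n. of_nat (sigma_sum k n))"
proof (rule converges_on_disk_comparison[where b = "\<lambda>n. n ^ (k + 1)"])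
  show "converges_on_disk (\<lambda>n. of_nat (n ^ (k + 1)))"
    using converges_on_disk_power[of "k + 1"] by simp
  show "norm (of_nat (sigma_sum k n) :: complex) \<le> real (n ^ (k + 1))" for n
    unfolding norm_of_nat of_nat_le_iff by (rule sigma_sum_le)
qed

lemma has_sum_atLeast1_iff:
  fixes g :: "nat \<Rightarrow> complex"
  assumes "g 0 = 0"
  shows "(g has_sum S) {1..} \<longleftrightarrow> (g has_sum S) UNIV"
  by (rule has_sum_cong_neutral) (use assms in \<open>auto simp: not_le\<close>)

lemma has_sum_powser:
  assumes "converges_on_disk c" "norm x < 1"
  shows "((\<lambda>n. c n * x ^ n) has_sum powser c x) UNIV"
proof (rule norm_summable_imp_has_sum[OF _ powser_sums[OF assms]])
  define K where "K = (1 + norm x) / 2"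
  have K: "norm x < K" "K < 1" using assms(2) by (auto simp: K_def)
  then have "0 < K" using norm_ge_zero[of x] by linarith
  then show "summable (\<lambda>n. norm (c n * x ^ n))"
    using assms(1) K by (intro powser_insidea[of c "of_real K"]) (auto simp: converges_on_disk_def)
qed

text \<open>Both sides sum d^j x^(m d) over m, d >= 1: the left groups the terms by m, the right by
  n = m d. Absolute summability comes from the right side at |x|.\<close>

lemma sum_Lambert_powser:
  assumes "norm x < 1" "j > 0"
  shows "((\<lambda>m. powser (\<lambda>d. of_nat d ^ j) (x ^ m)) has_sum powser (\<lambda>n. of_nat (sigma_sum j n)) x) {1..}"
proof -
  let ?S = "Sigma {1::nat..} (\<lambda>n. {d. d dvd n})"
  let ?h = "\<lambda>(n, d). of_nat d ^ j * x ^ n"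
  have fin: "finite {d. d dvd n}" if "n \<in> {1..}" for n :: nat
    using that by auto
  have sm: "((\<lambda>n. of_nat (sigma_sum j n) * x ^ n) has_sum powser (\<lambda>n. of_nat (sigma_sum j n)) x) {1..}"
    if "norm x < 1" for x
    using has_sum_powser[OF converges_on_disk_sigma that] by (subst has_sum_atLeast1_iff) auto
  have "(\<lambda>p. norm (?h p)) summable_on ?S"
  proof (rule summable_on_SigmaI)
    show "((\<lambda>d. norm (?h (n, d))) has_sum real (sigma_sum j n) * norm x ^ n) {d. d dvd n}"
      if "n \<in> {1..}" for n
      using fin[OF that] by (intro has_sum_finiteI)
        (auto simp: sigma_sum_def norm_mult norm_power sum_distrib_right)
    have "((\<lambda>n. Re (of_nat (sigma_sum j n) * of_real (norm x) ^ n)) has_sum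
        Re (powser (\<lambda>n. of_nat (sigma_sum j n)) (of_real (norm x)))) {1..}"
      using sm[of "of_real (norm x)"] assms(1) by (intro has_sum_Re) auto
    then show "(\<lambda>n. real (sigma_sum j n) * norm x ^ n) summable_on {1..}"
      by (simp add: summable_on_def flip: of_real_power) blast
  qed auto
  then have "?h summable_on ?S" by (rule abs_summable_summable)
  then obtain T where T: "(?h has_sum T) ?S" by (auto simp: summable_on_def)
  have "((\<lambda>n. of_nat (sigma_sum j n) * x ^ n) has_sum T) {1..}"
    by (rule has_sum_SigmaD[OF T], rule has_sum_finiteI)
      (use fin in \<open>auto simp: sigma_sum_def sum_distrib_right\<close>)
  then have TT: "T = powser (\<lambda>n. of_nat (sigma_sum j n)) x"
    using sm[OF assms(1)] has_sum_unique by blast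
  have "((\<lambda>(m, d). of_nat d ^ j * (x ^ m) ^ d) has_sum T) ({1..} \<times> {1..})"
    using T by (subst has_sum_reindex_bij_witness[where j = "\<lambda>(m, d). (m * d, d)"
          and i = "\<lambda>(n, d). (n div d, d)" and T = ?S and h = ?h and s' = T])
      (auto simp: power_mult dvd_imp_le intro: Nat.gr0I simp: Suc_le_eq div_greater_zero_iff)
  then have "((\<lambda>m. powser (\<lambda>d. of_nat d ^ j) (x ^ m)) has_sum T) {1..}"
  proof (rule has_sum_SigmaD)
    fix m :: nat assume "m \<in> {1..}"
    then have "norm (x ^ m) < 1" using assms(1) by (simp add: norm_power power_less_one_iff)
    from has_sum_powser[OF converges_on_disk_power this, of j]
    show "((\<lambda>d. case (m, d) of (m, d) \<Rightarrow> of_nat d ^ j * (x ^ m) ^ d) has_sum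
        powser (\<lambda>d. of_nat d ^ j) (x ^ m)) {1..}"
      using assms(2) by (subst has_sum_atLeast1_iff) auto
  qed
  then show ?thesis by (simp add: TT)
qed

lemma has_sum_even_int:
  fixes R :: "int \<Rightarrow> complex"
  assumes "(R has_sum S) UNIV" "\<And>m. R (- m) = R m"
  shows "((\<lambda>m. R (int m)) has_sum (S - R 0) / 2) {1..}"
proof -
  have "R summable_on {1..}"
    by (rule summable_on_subset[where A = UNIV]) (use assms(1) in \<open>auto simp: summable_on_def\<close>)
  then obtain T where T: "(R has_sum T) {1..}" by (auto simp: summable_on_def)
  have T': "(R has_sum T) {..-1}"
    using T by (subst has_sum_reindex_bij_witness[where i = uminus and j = uminus and T = "{1..}" and h = R and s' = T])
      (auto simp: assms(2))
  have "(R has_sum (T + R 0 + T)) ({1..} \<union> {0} \<union> {..-1})"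
    by (intro has_sum_Un_disjoint T T' has_sum_finiteI) auto
  moreover have "{1..} \<union> {0} \<union> {..-1} = (UNIV :: int set)" by auto
  ultimately have "S = T + R 0 + T" using assms(1) has_sum_unique by metis
  moreover have "((\<lambda>m. R (int m)) has_sum T) {1..}"
    using T by (subst has_sum_reindex_bij_witness[where i = nat and j = int and T = "{1..}" and h = R and s' = T]) auto
  ultimately show ?thesis by simp
qed

lemma lattice_lower_bound:
  assumes "Im \<tau> > 0"
  obtains c where "c > 0" "\<And>m n :: int. c * (\<bar>real_of_int m\<bar> + \<bar>real_of_int n\<bar>) \<le> norm (of_int m * \<tau> + of_int n)"
proof -
  define C where "C = 1 / Im \<tau> + 1 + norm \<tau> / Im \<tau>"
  have "C > 0" using assms by (simp add: C_def add_pos_nonneg)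
  have "\<bar>real_of_int m\<bar> + \<bar>real_of_int n\<bar> \<le> C * norm (of_int m * \<tau> + of_int n)" for m n :: int
  proof -
    let ?w = "of_int m * \<tau> + of_int n"
    have "\<bar>Im ?w\<bar> \<le> norm ?w" by (rule abs_Im_le_cmod)
    then have m: "\<bar>real_of_int m\<bar> \<le> norm ?w / Im \<tau>"
      using assms by (simp add: abs_mult field_simps)
    have "\<bar>real_of_int n\<bar> = norm (?w - of_int m * \<tau>)" by simp
    also have "\<dots> \<le> norm ?w + norm (of_int m * \<tau>)" by (rule norm_triangle_ineq4)
    also have "norm (of_int m * \<tau>) = \<bar>real_of_int m\<bar> * norm \<tau>" by (simp add: norm_mult)
    also have "\<dots> \<le> norm ?w / Im \<tau> * norm \<tau>" by (intro mult_right_mono m) simp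
    finally show ?thesis using m by (simp add: C_def algebra_simps)
  qed
  then have "1 / C * (\<bar>real_of_int m\<bar> + \<bar>real_of_int n\<bar>) \<le> norm (of_int m * \<tau> + of_int n)" for m n :: int
    using \<open>C > 0\<close> by (simp add: field_simps)
  then show ?thesis using \<open>C > 0\<close> by (intro that[of "1 / C"]) auto
qed

text \<open>With s = |m| + |n| >= 1 one has (1 + |m|)(1 + |n|) <= (2 s)^2. Hence 1 / s^3 is at most
  8 times a product of two one-variable terms of exponent -3/2, and the majorant factorises. At the
  origin the weight is \<open>1 / 0 = 0\<close>.\<close>

lemma summable_lattice_weight:
  "(\<lambda>(m::int, n::int). 1 / (\<bar>real_of_int m\<bar> + \<bar>real_of_int n\<bar>) ^ 3) summable_on UNIV"
proof -
  define u where "u = (\<lambda>n::int. (1 + \<bar>real_of_int n\<bar>) powr (- 3 / 2))"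
  have "summable (\<lambda>n. real (Suc n) powr (- 3 / 2))"
    by (subst summable_Suc_iff) (simp add: summable_real_powr_iff)
  then have s: "summable (\<lambda>n. (1 + real n) powr (- 3 / 2))" by (simp add: add.commute)
  then have "summable (\<lambda>n. (1 + real (Suc n)) powr (- 3 / 2))"
    by (subst summable_Suc_iff)
  with s have u: "u summable_on UNIV"
    by (intro summable_on_int_split summable_nonneg_imp_summable_on)
      (simp_all add: u_def add.commute add.left_commute)
  have "(\<lambda>p. u (fst p) * u (snd p)) summable_on Sigma UNIV (\<lambda>_. UNIV)"
    using u by (intro summable_on_SigmaI[where g = "\<lambda>m. u m * infsum u UNIV"])
      (auto intro!: has_sum_cmult_right summable_on_cmult_left simp: u_def[abs_def])
  then have "(\<lambda>p. 8 * (u (fst p) * u (snd p))) summable_on UNIV"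
    by (intro summable_on_cmult_right) simp
  then show ?thesis
  proof (rule summable_on_comparison_test, safe)
    fix m n :: int
    define s where "s = \<bar>real_of_int m\<bar> + \<bar>real_of_int n\<bar>"
    show "1 / (\<bar>real_of_int m\<bar> + \<bar>real_of_int n\<bar>) ^ 3 \<le> 8 * (u (fst (m, n)) * u (snd (m, n)))"
    proof (cases "m = 0 \<and> n = 0")
      case False
      then have "s \<ge> 1" unfolding s_def by linarith
      define p where "p = (1 + \<bar>real_of_int m\<bar>) * (1 + \<bar>real_of_int n\<bar>)"
      have "p > 0" by (simp add: p_def add_pos_nonneg)
      have "p \<le> (1 + s) * (1 + s)" unfolding p_def s_def by (intro mult_mono) auto
      also have "\<dots> \<le> (2 * s) * (2 * s)" using \<open>s \<ge> 1\<close> by (intro mult_mono) auto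
      finally have "p powr (3 / 2) \<le> ((2 * s) ^ 2) powr (3 / 2)"
        using \<open>p > 0\<close> by (intro powr_mono2) (auto simp: power2_eq_square)
      also have "(2 * s) ^ 2 = (2 * s) powr 2"
        using \<open>s \<ge> 1\<close> by simp
      also have "((2 * s) powr 2) powr (3 / 2) = (2 * s) powr 3"
        by (subst powr_powr) simp
      also have "\<dots> = 8 * s ^ 3"
        using \<open>s \<ge> 1\<close> by (simp add: power_mult_distrib)
      finally have "1 / (8 * s ^ 3) \<le> 1 / p powr (3 / 2)"
        using \<open>p > 0\<close> \<open>s \<ge> 1\<close> by (intro divide_left_mono mult_pos_pos) auto
      also have "\<dots> = u m * u n"
        using \<open>p > 0\<close> by (simp add: u_def p_def powr_mult powr_minus_divide)
      finally show ?thesis using \<open>s \<ge> 1\<close> by (simp add: field_simps s_def)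
    qed (simp add: u_def)
  qed auto
qed

lemma summable_lattice_comparison:
  assumes "\<And>m n. (m, n) \<noteq> (0, 0) \<Longrightarrow>
     norm (g (m, n)) \<le> K / (\<bar>real_of_int m\<bar> + \<bar>real_of_int n\<bar>) ^ 3"
  shows "(g :: int \<times> int \<Rightarrow> complex) summable_on (UNIV - {(0, 0)})"
proof -
  have "(\<lambda>(m::int, n::int). K * (1 / (\<bar>real_of_int m\<bar> + \<bar>real_of_int n\<bar>) ^ 3)) summable_on (UNIV - {(0, 0)})"
    by (rule summable_on_subset[where A = UNIV])
      (use summable_on_cmult_right[OF summable_lattice_weight, of K] in \<open>auto simp: case_prod_unfold\<close>)
  then have "(\<lambda>p. norm (g p)) summable_on (UNIV - {(0, 0)})"
    by (rule Infinite_Sum.abs_summable_on_comparison_test') (use assms in auto)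
  then show ?thesis by (rule abs_summable_summable)
qed

section \<open>Eisenstein series and the Weierstrass zeta function, summed by rows\<close>

definition lattice_sum :: "nat \<Rightarrow> complex \<Rightarrow> complex" where
  "lattice_sum k \<tau> = (\<Sum>\<^sub>\<infinity>(m::int, n::int)\<in>UNIV - {(0, 0)}. 1 / (of_int m * \<tau> + of_int n) ^ k)"

lemma g2_lattice_sum: "g2 \<tau> = 60 * lattice_sum 4 \<tau>"
  and g3_lattice_sum: "g3 \<tau> = 140 * lattice_sum 6 \<tau>"
  by (simp_all add: g2_def g3_def lattice_sum_def)

lemma summable_lattice_sum:
  assumes "Im \<tau> > 0" "k \<ge> 3"
  shows "(\<lambda>(m::int, n::int). 1 / (of_int m * \<tau> + of_int n) ^ k) summable_on (UNIV - {(0, 0)})"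
proof -
  obtain c where c: "c > 0" "\<And>m n :: int. c * (\<bar>real_of_int m\<bar> + \<bar>real_of_int n\<bar>) \<le> norm (of_int m * \<tau> + of_int n)"
    using lattice_lower_bound[OF assms(1)] by blast
  show ?thesis
  proof (rule summable_lattice_comparison[where K = "1 / c ^ k"])
    fix m n :: int assume mn: "(m, n) \<noteq> (0, 0)"
    define s where "s = \<bar>real_of_int m\<bar> + \<bar>real_of_int n\<bar>"
    have s: "s \<ge> 1" using mn unfolding s_def by (auto; linarith)
    have "(c * s) ^ k \<le> norm (of_int m * \<tau> + of_int n) ^ k"
      using c s unfolding s_def by (intro power_mono) auto
    then have "1 / norm (of_int m * \<tau> + of_int n) ^ k \<le> 1 / (c * s) ^ k"
      using c s by (intro frac_le) auto
    also have "\<dots> = 1 / c ^ k * (1 / s ^ k)" by (simp add: power_mult_distrib)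
    also have "\<dots> \<le> 1 / c ^ k * (1 / s ^ 3)"
      using c s assms(2) by (intro mult_left_mono frac_le power_increasing) auto
    finally show "norm (case (m, n) of (m, n) \<Rightarrow> 1 / (of_int m * \<tau> + of_int n) ^ k)
        \<le> 1 / c ^ k / (\<bar>real_of_int m\<bar> + \<bar>real_of_int n\<bar>) ^ 3"
      by (simp add: norm_divide norm_power s_def)
  qed
qed

lemma nome_of_nat_mult: "nome (of_nat m * \<tau>) = nome \<tau> ^ m"
  by (simp add: nome_def exp_of_nat_mult[symmetric] mult_ac)

text \<open>The index 0 contributes \<open>1 / 0 = 0\<close>, so the sum over all integers is twice
  the zeta value.\<close>

lemma zeta_even_has_sum_int:
  assumes "(\<lambda>n. 1 / real (Suc n) ^ k) sums Z" "even k" "k \<ge> 2"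
  shows "((\<lambda>n::int. 1 / complex_of_int n ^ k) has_sum of_real (2 * Z)) UNIV"
proof -
  have c: "(\<lambda>n. 1 / (1 + complex_of_nat n) ^ k) sums of_real Z"
    using sums_of_real[OF assms(1), where 'a = complex] by (simp add: add.commute)
  have s: "summable (\<lambda>n. norm (1 / (1 + complex_of_nat n) ^ k))"
    by (rule summable_norm_shifted_power[OF assms(3)])
  have "((\<lambda>n. 1 / (complex_of_int (int n)) ^ k) has_sum of_real Z) UNIV"
  proof (rule norm_summable_imp_has_sum)
    show "summable (\<lambda>n. norm (1 / (complex_of_int (int n)) ^ k))"
      using s by (subst summable_Suc_iff[symmetric]) simp
    show "(\<lambda>n. 1 / complex_of_int (int n) ^ k) sums of_real Z"
      using sums_Suc[of "\<lambda>n. 1 / complex_of_int (int n) ^ k" "of_real Z"] c assms(3) by (simp add: power_0_left)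
  qed
  moreover have "((\<lambda>n. 1 / (complex_of_int (- 1 - int n)) ^ k) has_sum of_real Z) UNIV"
  proof -
    have "1 / (complex_of_int (- 1 - int n)) ^ k = 1 / (1 + complex_of_nat n) ^ k" for n
    proof -
      have "complex_of_int (- 1 - int n) = - (1 + complex_of_nat n)" by simp
      then show ?thesis using assms(2) by (simp only: power_minus_even)
    qed
    then show ?thesis using norm_summable_imp_has_sum[OF s c] by presburger
  qed
  ultimately have "((\<lambda>n::int. 1 / complex_of_int n ^ k) has_sum (of_real Z + of_real Z)) UNIV"
    by (rule has_sum_int_split)
  then show ?thesis by (simp only: flip: of_real_add) simp
qed

lemma Lipschitz_row:
  assumes "Im \<tau> > 0" "odd j" "m > 0"
  shows "((\<lambda>n::int. 1 / (of_int (int m) * \<tau> + of_int n) ^ (j + 1)) has_sum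
           ((2 * of_real pi * \<i>) ^ (j + 1) / fact j * powser (\<lambda>d. of_nat d ^ j) (nome \<tau> ^ m))) UNIV"
  using Lipschitz_formula[of "of_nat m * \<tau>" j] assms by (simp add: nome_of_nat_mult)

lemma row_minus:
  fixes \<tau> :: complex
  assumes "even k"
  shows "infsum (\<lambda>n::int. 1 / (of_int (- m) * \<tau> + of_int n) ^ k) UNIV =
         infsum (\<lambda>n::int. 1 / (of_int m * \<tau> + of_int n) ^ k) UNIV"
proof (rule infsum_reindex_bij_witness[where i = uminus and j = uminus])
  fix n :: int
  have "of_int m * \<tau> + of_int (- n) = - (of_int (- m) * \<tau> + of_int n)" by simp
  then show "1 / (of_int m * \<tau> + of_int (- n)) ^ k = 1 / (of_int (- m) * \<tau> + of_int n) ^ k"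
    using assms by (simp only: power_minus_even)
qed auto

text \<open>Row 0 is 2 zeta(j + 1), the origin contributing \<open>1 / 0 = 0\<close>. Rows m and -m
  agree; the Lipschitz formula makes row m a power series in the m-th power of the nome, and the
  Lambert sum collects the rows.\<close>

lemma lattice_sum_expansion:
  assumes "Im \<tau> > 0" "odd j" "j \<ge> 3" "(\<lambda>n. 1 / real (Suc n) ^ (j + 1)) sums Z"
  shows "lattice_sum (j + 1) \<tau> = of_real (2 * Z) +
    2 * ((2 * of_real pi * \<i>) ^ (j + 1) / fact j * powser (\<lambda>n. of_nat (sigma_sum j n)) (nome \<tau>))"
proof -
  define k where "k = j + 1"
  have k: "even k" "k \<ge> 3" "k \<ge> 2" "k > 0" using assms(2,3) by (auto simp: k_def)
  let ?h = "\<lambda>p :: int \<times> int. 1 / (of_int (fst p) * \<tau> + of_int (snd p)) ^ k"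
  let ?R = "\<lambda>m::int. infsum (\<lambda>n. ?h (m, n)) UNIV"
  have "(?h has_sum lattice_sum k \<tau>) (UNIV - {(0, 0)})"
    using summable_lattice_sum[OF assms(1) k(2)] unfolding lattice_sum_def
    by (simp add: case_prod_unfold)
  then have h: "(?h has_sum lattice_sum k \<tau>) (UNIV \<times> UNIV)"
    using k by (subst has_sum_cong_neutral[where T = "UNIV - {(0, 0)}" and g = ?h]) (auto simp: power_0_left)
  have "(\<lambda>(m, n). ?h (m, n)) summable_on (UNIV \<times> UNIV)"
    using h by (auto simp: summable_on_def case_prod_unfold)
  then have row: "((\<lambda>n. ?h (m, n)) has_sum ?R m) UNIV" for m
    using summable_on_SigmaD1[of "\<lambda>m n. ?h (m, n)" UNIV "\<lambda>_. UNIV" m] by simp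
  have R: "(?R has_sum lattice_sum k \<tau>) UNIV"
    by (rule has_sum_SigmaD[OF h]) (rule row)
  have "((\<lambda>m. ?R (int m)) has_sum (lattice_sum k \<tau> - ?R 0) / 2) {1..}"
    by (rule has_sum_even_int[OF R]) (use row_minus[OF k(1), of _ \<tau>] in simp)
  moreover have "?R (int m) = (2 * of_real pi * \<i>) ^ k / fact j * powser (\<lambda>d. of_nat d ^ j) (nome \<tau> ^ m)"
    if "m \<in> {1..}" for m
    using infsumI[OF Lipschitz_row[OF assms(1,2), of m]] that by (simp add: k_def)
  ultimately have 1: "((\<lambda>m. (2 * of_real pi * \<i>) ^ k / fact j * powser (\<lambda>d. of_nat d ^ j) (nome \<tau> ^ m)) has_sum
      (lattice_sum k \<tau> - ?R 0) / 2) {1..}"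
    by (rule has_sum_cong[THEN iffD1, rotated])
  have 2: "((\<lambda>m. (2 * of_real pi * \<i>) ^ k / fact j * powser (\<lambda>d. of_nat d ^ j) (nome \<tau> ^ m)) has_sum
      (2 * of_real pi * \<i>) ^ k / fact j * powser (\<lambda>n. of_nat (sigma_sum j n)) (nome \<tau>)) {1..}"
    using assms(1,3) norm_nome_less_1 by (intro has_sum_cmult_right sum_Lambert_powser) auto
  have "?R 0 = of_real (2 * Z)"
    using infsumI[OF zeta_even_has_sum_int[OF assms(4)]] k by (simp add: k_def)
  with has_sum_unique[OF 1 2] show ?thesis by (simp add: k_def field_simps)
qed

lemma has_sum_diff:
  fixes g h :: "'a \<Rightarrow> complex"
  assumes "(g has_sum a) A" "(h has_sum b) A"
  shows "((\<lambda>x. g x - h x) has_sum (a - b)) A"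
  using has_sum_add[OF assms(1) has_sum_uminusI[OF assms(2)]] by simp

text \<open>The conditionally convergent parts of
  the summands of the zeta function cancel between \<open>\<omega>\<close> and \<open>- \<omega>\<close>; what is left telescopes along
  the rows of the lattice.\<close>

lemma weierstrass_zeta_rows:
  assumes \<tau>: "Im \<tau> > 0" and z: "z \<notin> \<int>"
    and zm: "\<And>m. m > 0 \<Longrightarrow> of_nat m * \<tau> - z \<notin> \<int>" "\<And>m. m > 0 \<Longrightarrow> of_nat m * \<tau> + z \<notin> \<int>"
    and c: "c > 0" "\<And>m n :: int. c * (\<bar>real_of_int m\<bar> + \<bar>real_of_int n\<bar>) \<le> norm (z - (of_int m * \<tau> + of_int n))"
  defines "P \<equiv> \<lambda>u. of_real pi * cot (of_real pi * u)"
  shows "((\<lambda>m. z * ((2 * of_real pi * \<i>) ^ 2 * powser of_nat (nome \<tau> ^ m)) -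
              (P (of_nat m * \<tau> - z) - P (of_nat m * \<tau> + z)) / 2) has_sum
            (weierstrass_zeta z \<tau> - z * of_real (pi ^ 2 / 3) - P z) / 2) {1..}"
proof -
  let ?w = "\<lambda>p :: int \<times> int. of_int (fst p) * \<tau> + of_int (snd p)"
  define g where "g = (\<lambda>p. 1 / (z - ?w p) + 1 / ?w p + z / ?w p ^ 2)"
  obtain c' where c': "c' > 0" "\<And>m n :: int. c' * (\<bar>real_of_int m\<bar> + \<bar>real_of_int n\<bar>) \<le> norm (of_int m * \<tau> + of_int n)"
    using lattice_lower_bound[OF \<tau>] by blast
  have pos: "\<bar>real_of_int m\<bar> + \<bar>real_of_int n\<bar> > 0" if "(m, n) \<noteq> (0, 0)" for m n
    using that by (auto simp: add_pos_nonneg add_nonneg_pos)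
  have nz: "?w p \<noteq> 0" "z - ?w p \<noteq> 0" if "p \<noteq> (0, 0)" for p
  proof -
    obtain m n where p: "p = (m, n)" by force
    have "0 < c * (\<bar>real_of_int m\<bar> + \<bar>real_of_int n\<bar>)" "0 < c' * (\<bar>real_of_int m\<bar> + \<bar>real_of_int n\<bar>)"
      using pos[of m n] that c(1) c'(1) by (auto simp: p)
    then have "0 < norm (?w p)" "0 < norm (z - ?w p)"
      using c(2)[of m n] c'(2)[of m n] unfolding p fst_conv snd_conv by linarith+
    then show "?w p \<noteq> 0" "z - ?w p \<noteq> 0" by auto
  qed
  have "g summable_on (UNIV - {(0, 0)})"
  proof (rule summable_lattice_comparison[where K = "norm z ^ 2 / (c' ^ 2 * c)"])
    fix m n :: int assume mn: "(m, n) \<noteq> (0, 0)"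
    define s where "s = \<bar>real_of_int m\<bar> + \<bar>real_of_int n\<bar>"
    have s: "s > 0" using pos[OF mn] by (simp add: s_def)
    \<comment> \<open>The two correction terms cancel the expansion of 1 / (z - w) to second order,
      which leaves cubic decay.\<close>
    have "g (m, n) = z ^ 2 / (?w (m, n) ^ 2 * (z - ?w (m, n)))"
      unfolding g_def using nz[OF mn] by (simp add: divide_simps) (simp add: algebra_simps power2_eq_square)
    then have "norm (g (m, n)) = norm z ^ 2 / (norm (?w (m, n)) ^ 2 * norm (z - ?w (m, n)))"
      by (simp only: norm_divide norm_mult norm_power)
    also have "\<dots> \<le> norm z ^ 2 / ((c' * s) ^ 2 * (c * s))"
    proof (intro divide_left_mono mult_mono power_mono)
      show "c' * s \<le> norm (?w (m, n))" "c * s \<le> norm (z - ?w (m, n))"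
        using c'(2)[of m n] c(2)[of m n] by (simp_all add: s_def)
      show "0 < norm (?w (m, n)) ^ 2 * norm (z - ?w (m, n)) * ((c' * s) ^ 2 * (c * s))"
        using nz[OF mn] s c(1) c'(1) by (simp only: zero_less_mult_iff zero_less_power zero_less_norm_iff) simp
    qed (use s c(1) c'(1) in auto)
    also have "\<dots> = norm z ^ 2 / (c' ^ 2 * c) / s ^ 3"
      by (simp add: power_mult_distrib eval_nat_numeral mult_ac)
    finally show "norm (g (m, n)) \<le> norm z ^ 2 / (c' ^ 2 * c) / (\<bar>real_of_int m\<bar> + \<bar>real_of_int n\<bar>) ^ 3"
      by (simp add: s_def)
  qed
  then have g: "(g has_sum (weierstrass_zeta z \<tau> - 1 / z)) (UNIV - {(0, 0)})"
    by (simp add: weierstrass_zeta_def g_def case_prod_unfold Let_def)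
  have g': "((\<lambda>p. g (- p)) has_sum (weierstrass_zeta z \<tau> - 1 / z)) (UNIV - {(0, 0)})"
    using g by (subst has_sum_reindex_bij_witness[where i = uminus and j = uminus
        and T = "UNIV - {(0, 0)}" and h = g and s' = "weierstrass_zeta z \<tau> - 1 / z"]) auto
  define s where "s = (\<lambda>p. z * (1 / ?w p ^ 2) - (1 / (?w p - z) - 1 / (?w p + z)) / 2)"
  have "(g p + g (- p)) / 2 = s p" for p
  proof -
    define W where "W = ?w p"
    have "?w (- p) = - W" by (simp add: W_def)
    then have "g (- p) = 1 / (z - - W) + 1 / - W + z / (- W) ^ 2"
      by (simp only: g_def)
    also have "\<dots> = 1 / (W + z) - 1 / W + z / W ^ 2"
      by (simp add: add.commute)
    finally have 1: "g (- p) = 1 / (W + z) - 1 / W + z / W ^ 2" .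
    have "1 / (z - W) = - (1 / (W - z))"
      by (simp add: minus_divide_right)
    then have 2: "g p = - (1 / (W - z)) + 1 / W + z / W ^ 2"
      by (simp only: g_def W_def)
    have 3: "s p = z / W ^ 2 - (1 / (W - z) - 1 / (W + z)) / 2"
      by (simp add: s_def W_def)
    have "(- u + b + a + (v - b + a)) / 2 = a - (u - v) / 2" for u v a b :: complex
      by (simp add: field_simps)
    then show ?thesis unfolding 1 2 3 .
  qed
  moreover have "((\<lambda>p. (g p + g (- p)) / 2) has_sum
      (((weierstrass_zeta z \<tau> - 1 / z) + (weierstrass_zeta z \<tau> - 1 / z)) / 2)) (UNIV - {(0, 0)})"
    by (intro has_sum_divide_const has_sum_add g g')
  moreover have "(X + X) / 2 = X" for X :: complex by simp
  ultimately have s: "(s has_sum (weierstrass_zeta z \<tau> - 1 / z)) (UNIV - {(0, 0)})" by (simp only:)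
  \<comment> \<open>At the origin the symmetrised summand is 1 / z, because
    \<open>1 / 0 = 0\<close>. The leading term of the zeta function is thus the term of the omitted
    lattice point, and the sum extends to the full lattice.\<close>
  have s0: "s (0, 0) = 1 / z" by (simp add: s_def)
  have "(s has_sum (1 / z + (weierstrass_zeta z \<tau> - 1 / z))) (insert (0, 0) (UNIV - {(0, 0)}))"
    using has_sum_insert[of "(0, 0)" "UNIV - {(0, 0)}" s "weierstrass_zeta z \<tau> - 1 / z"] s
    by (simp add: s0 add.commute)
  then have s: "(s has_sum weierstrass_zeta z \<tau>) (UNIV \<times> UNIV)"
    by (simp add: insert_absorb)
  have row0: "((\<lambda>n. s (0, n)) has_sum (z * of_real (pi ^ 2 / 3) - (P (- z) - P z) / 2)) UNIV"
  proof -
    have "(\<lambda>n. 1 / real (Suc n) ^ 2) sums (pi ^ 2 / 6)"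
      using inverse_squares_sums by (simp add: add.commute)
    from zeta_even_has_sum_int[OF this] have 1: "((\<lambda>n::int. 1 / complex_of_int n ^ 2) has_sum of_real (pi ^ 2 / 3)) UNIV"
      by simp
    have "- z \<notin> \<int>" using z by simp
    from has_sum_cot_diff[OF this z]
    have "((\<lambda>n::int. 1 / (- z + of_int n) - 1 / (z + of_int n)) has_sum (P (- z) - P z)) UNIV"
      by (simp only: P_def)
    from has_sum_diff[OF has_sum_cmult_right[OF 1] has_sum_divide_const[OF this]]
    show ?thesis by (simp add: s_def add_ac)
  qed
  have rowm: "((\<lambda>n. s (int m, n)) has_sum z * ((2 * of_real pi * \<i>) ^ 2 * powser of_nat (nome \<tau> ^ m)) -
              (P (of_nat m * \<tau> - z) - P (of_nat m * \<tau> + z)) / 2) UNIV" if "m \<in> {1..}" for m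
  proof -
    have m: "m > 0" using that by auto
    have 1: "((\<lambda>n::int. 1 / (of_nat m * \<tau> + of_int n) ^ 2) has_sum ((2 * of_real pi * \<i>) ^ 2 * powser of_nat (nome \<tau> ^ m))) UNIV"
      using Lipschitz_row[OF \<tau> _ m, of 1] by (simp add: numeral_2_eq_2)
    from has_sum_cot_diff[OF zm(1)[OF m] zm(2)[OF m]]
    have "((\<lambda>n::int. 1 / (of_nat m * \<tau> - z + of_int n) - 1 / (of_nat m * \<tau> + z + of_int n)) has_sum
        (P (of_nat m * \<tau> - z) - P (of_nat m * \<tau> + z))) UNIV"
      by (simp only: P_def)
    from has_sum_diff[OF has_sum_cmult_right[OF 1] has_sum_divide_const[OF this]]
    show ?thesis by (simp add: s_def algebra_simps)
  qed
  have "(\<lambda>(m, n). s (m, n)) summable_on (UNIV \<times> UNIV)"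
    using s by (auto simp: summable_on_def case_prod_unfold)
  then have row: "((\<lambda>n. s (m, n)) has_sum infsum (\<lambda>n. s (m, n)) UNIV) UNIV" for m
    using summable_on_SigmaD1[of "\<lambda>m n. s (m, n)" UNIV "\<lambda>_. UNIV" m] by simp
  have R: "((\<lambda>m. infsum (\<lambda>n. s (m, n)) UNIV) has_sum weierstrass_zeta z \<tau>) UNIV"
    by (rule has_sum_SigmaD[OF s]) (rule row)
  have s_minus: "s (- p) = s p" for p
  proof -
    define W where "W = ?w p"
    have "?w (- p) = - W" by (simp add: W_def)
    then have "s (- p) = z * (1 / (- W) ^ 2) - (1 / (- W - z) - 1 / (- W + z)) / 2"
      by (simp only: s_def)
    also have "\<dots> = z * (1 / W ^ 2) - (1 / (W - z) - 1 / (W + z)) / 2"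
    proof -
      have "- W - z = - (W + z)" "- W + z = - (W - z)" by simp_all
      then show ?thesis by (simp only: divide_minus_right power2_minus) simp
    qed
    also have "\<dots> = s p" by (simp only: s_def W_def)
    finally show ?thesis .
  qed
  have "infsum (\<lambda>n. s (- m, n)) UNIV = infsum (\<lambda>n. s (m, n)) UNIV" for m
    by (rule infsum_reindex_bij_witness[where i = uminus and j = uminus])
      (use s_minus[of "(- m, _)"] in auto)
  from has_sum_even_int[OF R this]
  have "((\<lambda>m. infsum (\<lambda>n. s (int m, n)) UNIV) has_sum (weierstrass_zeta z \<tau> - infsum (\<lambda>n. s (0, n)) UNIV) / 2) {1..}" .
  then have "((\<lambda>m. z * ((2 * of_real pi * \<i>) ^ 2 * powser of_nat (nome \<tau> ^ m)) -
              (P (of_nat m * \<tau> - z) - P (of_nat m * \<tau> + z)) / 2) has_sum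
     (weierstrass_zeta z \<tau> - infsum (\<lambda>n. s (0, n)) UNIV) / 2) {1..}"
    by (subst has_sum_cong[where g = "\<lambda>m. infsum (\<lambda>n. s (int m, n)) UNIV"]) (use infsumI[OF rowm] in auto)
  moreover have "P (- z) = - P z" by (simp add: P_def)
  ultimately show ?thesis using infsumI[OF row0] by (simp add: algebra_simps)
qed

section \<open>Quasi-periods and Fourier expansions\<close>

abbreviation sigma_powser :: "nat \<Rightarrow> complex \<Rightarrow> complex" where
  "sigma_powser k \<equiv> powser (\<lambda>n. of_nat (sigma_sum k n))"

text \<open>Doubled, the difference is a lattice point with one odd coordinate of the form 1 - 2 n,
  and |n| <= |1 - 2 n| for integers; the bound for the lattice itself carries over.\<close>

lemma half_lattice_lower_bound:
  assumes "Im \<tau> > 0" "z = 1 / 2 \<or> z = \<tau> / 2"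
  obtains c where "c > 0"
    "\<And>m n :: int. c * (\<bar>real_of_int m\<bar> + \<bar>real_of_int n\<bar>) \<le> norm (z - (of_int m * \<tau> + of_int n))"
proof -
  obtain c where c: "c > 0" "\<And>m n :: int. c * (\<bar>real_of_int m\<bar> + \<bar>real_of_int n\<bar>) \<le> norm (of_int m * \<tau> + of_int n)"
    using lattice_lower_bound[OF assms(1)] by blast
  have odd_ge: "\<bar>real_of_int n\<bar> \<le> \<bar>real_of_int (1 - 2 * n)\<bar>" for n
  proof -
    have "\<bar>n\<bar> \<le> \<bar>1 - 2 * n\<bar>" by presburger
    then show ?thesis by (metis of_int_abs of_int_le_iff)
  qed
  have *: "c / 2 * (\<bar>real_of_int m\<bar> + \<bar>real_of_int n\<bar>) \<le> norm (z - (of_int m * \<tau> + of_int n))" for m n :: int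
  proof -
    obtain m' n' :: int where mn: "z - (of_int m * \<tau> + of_int n) = (of_int m' * \<tau> + of_int n') / 2"
      "\<bar>real_of_int m\<bar> \<le> \<bar>real_of_int m'\<bar>" "\<bar>real_of_int n\<bar> \<le> \<bar>real_of_int n'\<bar>"
    proof (cases "z = 1 / 2")
      case True
      then show ?thesis using odd_ge[of n] by (intro that[of "- 2 * m" "1 - 2 * n"]) (auto simp: field_simps)
    next
      case False
      then have "z = \<tau> / 2" using assms(2) by simp
      then show ?thesis using odd_ge[of m] by (intro that[of "1 - 2 * m" "- 2 * n"]) (auto simp: field_simps)
    qed
    have "c * (\<bar>real_of_int m\<bar> + \<bar>real_of_int n\<bar>) \<le> c * (\<bar>real_of_int m'\<bar> + \<bar>real_of_int n'\<bar>)"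
      using mn c(1) by (intro mult_left_mono add_mono) auto
    also have "\<dots> \<le> norm (of_int m' * \<tau> + of_int n')" by (rule c(2))
    finally show ?thesis unfolding mn(1) by (simp add: norm_divide)
  qed
  show ?thesis by (rule that[OF _ *]) (use c(1) in simp)
qed

lemma nome_add_1: "nome (z + 1) = nome z"
proof -
  have "nome (z + 1) = nome z * exp (2 * of_real pi * \<i>)"
    unfolding nome_def by (simp add: exp_add ring_distribs)
  then show ?thesis by simp
qed

text \<open>At z = 1/2 the two cotangents of each row have arguments differing by a period and
  cancel, and cot(pi / 2) = 0. What remains is the Eisenstein series of weight 2.\<close>

lemma weierstrass_zeta_half:
  assumes \<tau>: "Im \<tau> > 0"
  shows "weierstrass_zeta (1 / 2) \<tau> = of_real (pi ^ 2 / 6) * (1 - 24 * sigma_powser 1 (nome \<tau>))"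
proof -
  define P where "P = (\<lambda>u. of_real pi * cot (of_real pi * u :: complex))"
  define L where "L = (2 * of_real pi * \<i>) ^ 2 * sigma_powser 1 (nome \<tau>)"
  obtain c where c: "c > 0" "\<And>m n :: int. c * (\<bar>real_of_int m\<bar> + \<bar>real_of_int n\<bar>) \<le> norm (1 / 2 - (of_int m * \<tau> + of_int n))"
    using half_lattice_lower_bound[OF \<tau>, of "1 / 2"] by blast
  have z: "(1 / 2 :: complex) \<notin> \<int>"
    using of_real_not_Int[of "1 / 2"] by simp
  have I: "of_nat m * \<tau> - 1 / 2 \<notin> \<int>" "of_nat m * \<tau> + 1 / 2 \<notin> \<int>" if "m > 0" for m
    using that \<tau> by (intro not_Int_if_Im; simp)+
  have P: "P (of_nat m * \<tau> - 1 / 2) = P (of_nat m * \<tau> + 1 / 2)" if "m > 0" for m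
    using that \<tau> nome_add_1[of "of_nat m * \<tau> - 1 / 2"] unfolding P_def
    by (subst (1 2) pi_cot_conv_nome) (auto simp: algebra_simps)
  have P2: "P (1 / 2) = 0"
  proof -
    have "cos (of_real pi * (1 / 2) :: complex) = of_real (cos (pi / 2))"
      by (subst cos_of_real[symmetric]) simp
    then show ?thesis by (simp add: P_def cot_def)
  qed
  have "((\<lambda>m. 1 / 2 * ((2 * of_real pi * \<i>) ^ 2 * powser of_nat (nome \<tau> ^ m))) has_sum
      (weierstrass_zeta (1 / 2) \<tau> - 1 / 2 * of_real (pi ^ 2 / 3) - P (1 / 2)) / 2) {1..}"
  proof (rule has_sum_cong[THEN iffD1])
    show "((\<lambda>m. 1 / 2 * ((2 * of_real pi * \<i>) ^ 2 * powser of_nat (nome \<tau> ^ m)) -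
        (P (of_nat m * \<tau> - 1 / 2) - P (of_nat m * \<tau> + 1 / 2)) / 2) has_sum
        (weierstrass_zeta (1 / 2) \<tau> - 1 / 2 * of_real (pi ^ 2 / 3) - P (1 / 2)) / 2) {1..}"
      unfolding P_def by (rule weierstrass_zeta_rows[OF \<tau> z I c])
  qed (use P in auto)
  moreover have "((\<lambda>m. 1 / 2 * ((2 * of_real pi * \<i>) ^ 2 * powser of_nat (nome \<tau> ^ m))) has_sum 1 / 2 * L) {1..}"
    unfolding L_def using sum_Lambert_powser[OF norm_nome_less_1[OF \<tau>], of 1]
    by (intro has_sum_cmult_right) simp
  ultimately have "(weierstrass_zeta (1 / 2) \<tau> - 1 / 2 * of_real (pi ^ 2 / 3) - P (1 / 2)) / 2 = 1 / 2 * L"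
    by (rule has_sum_unique)
  then show ?thesis by (simp add: P2 L_def field_simps power2_eq_square)
qed

text \<open>At z = \<tau> / 2 the cotangents of row m are the values at (m - 1/2) \<tau> and (m +
  1/2) \<tau>, so they telescope over the rows. The weight 2 part is \<tau> times that of z = 1/2
  and combines to \<tau> \<open>eta1\<close>.\<close>

lemma Legendre_relation:
  assumes \<tau>: "Im \<tau> > 0"
  shows "eta2 \<tau> = \<tau> * eta1 \<tau> - 2 * of_real pi * \<i>"
proof -
  define P where "P = (\<lambda>u. of_real pi * cot (of_real pi * u :: complex))"
  define L where "L = (2 * of_real pi * \<i>) ^ 2 * sigma_powser 1 (nome \<tau>)"
  define a where "a = (\<lambda>n. P (of_nat n * \<tau> + \<tau> / 2))"
  define X where "X = weierstrass_zeta (\<tau> / 2) \<tau>"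
  obtain c where c: "c > 0" "\<And>m n :: int. c * (\<bar>real_of_int m\<bar> + \<bar>real_of_int n\<bar>) \<le> norm (\<tau> / 2 - (of_int m * \<tau> + of_int n))"
    using half_lattice_lower_bound[OF \<tau>, of "\<tau> / 2"] by blast
  have z: "\<tau> / 2 \<notin> \<int>"
    using \<tau> by (intro not_Int_if_Im) simp
  have I: "of_nat m * \<tau> - \<tau> / 2 \<notin> \<int>" "of_nat m * \<tau> + \<tau> / 2 \<notin> \<int>" if "m > 0" for m
  proof -
    have "real m * Im \<tau> \<ge> 1 * Im \<tau>" using that \<tau> by (intro mult_right_mono) auto
    then show "of_nat m * \<tau> - \<tau> / 2 \<notin> \<int>" "of_nat m * \<tau> + \<tau> / 2 \<notin> \<int>"
      using \<tau> by (intro not_Int_if_Im; simp; linarith)+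
  qed
  have 1: "((\<lambda>m. \<tau> / 2 * ((2 * of_real pi * \<i>) ^ 2 * powser of_nat (nome \<tau> ^ m)) -
      (P (of_nat m * \<tau> - \<tau> / 2) - P (of_nat m * \<tau> + \<tau> / 2)) / 2) has_sum
      (X - \<tau> / 2 * of_real (pi ^ 2 / 3) - P (\<tau> / 2)) / 2) {1..}"
    unfolding P_def X_def by (rule weierstrass_zeta_rows[OF \<tau> z I c])
  have 2: "((\<lambda>m. \<tau> / 2 * ((2 * of_real pi * \<i>) ^ 2 * powser of_nat (nome \<tau> ^ m))) has_sum \<tau> / 2 * L) {1..}"
    unfolding L_def using sum_Lambert_powser[OF norm_nome_less_1[OF \<tau>], of 1]
    by (intro has_sum_cmult_right) simp
  from has_sum_diff[OF 2 1]
  have 3: "((\<lambda>m. (P (of_nat m * \<tau> - \<tau> / 2) - P (of_nat m * \<tau> + \<tau> / 2)) / 2) has_sum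
      (\<tau> / 2 * L - (X - \<tau> / 2 * of_real (pi ^ 2 / 3) - P (\<tau> / 2)) / 2)) {1..}"
    by simp
  have "bij_betw Suc UNIV {1..}"
    by (rule bij_betwI[of _ _ _ "\<lambda>n. n - 1"]) auto
  from 3[folded has_sum_reindex_bij_betw[OF this]]
  have "(\<lambda>n. (P (of_nat (Suc n) * \<tau> - \<tau> / 2) - P (of_nat (Suc n) * \<tau> + \<tau> / 2)) / 2) sums
      (\<tau> / 2 * L - (X - \<tau> / 2 * of_real (pi ^ 2 / 3) - P (\<tau> / 2)) / 2)"
    by (rule has_sum_imp_sums)
  moreover have "P (of_nat (Suc n) * \<tau> - \<tau> / 2) = a n" "P (of_nat (Suc n) * \<tau> + \<tau> / 2) = a (Suc n)" for n
    unfolding a_def by (simp_all add: algebra_simps)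
  ultimately have 4: "(\<lambda>n. (a n - a (Suc n)) / 2) sums
      (\<tau> / 2 * L - (X - \<tau> / 2 * of_real (pi ^ 2 / 3) - P (\<tau> / 2)) / 2)"
    by simp
  have a_eq: "a = (\<lambda>n. of_real pi * \<i> - 2 * of_real pi * \<i> / (1 - nome \<tau> ^ n * nome (\<tau> / 2)))"
  proof
    fix n
    have "nome (of_nat n * \<tau> + \<tau> / 2) = nome \<tau> ^ n * nome (\<tau> / 2)"
      unfolding nome_of_nat_mult[symmetric] by (simp add: nome_def ring_distribs flip: exp_add)
    moreover have "0 < Im (of_nat n * \<tau> + \<tau> / 2)" using \<tau> by (simp add: add_nonneg_pos)
    ultimately show "a n = of_real pi * \<i> - 2 * of_real pi * \<i> / (1 - nome \<tau> ^ n * nome (\<tau> / 2))"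
      unfolding a_def P_def by (subst pi_cot_conv_nome) auto
  qed
  have "(\<lambda>n. nome \<tau> ^ n) \<longlonglongrightarrow> 0"
    by (rule LIMSEQ_power_zero) (rule norm_nome_less_1[OF \<tau>])
  \<comment> \<open>The limit is -pi i. This boundary term of the telescoping sum at the cusp is the
    origin of the 2 pi i in the relation.\<close>
  then have "a \<longlonglongrightarrow> of_real pi * \<i> - 2 * of_real pi * \<i> / (1 - 0 * nome (\<tau> / 2))"
    unfolding a_eq using norm_nome_less_1[OF \<tau>] by (intro tendsto_intros) auto
  then have "(\<lambda>n. a n - a (Suc n)) sums (a 0 - (of_real pi * \<i> - 2 * of_real pi * \<i> / (1 - 0 * nome (\<tau> / 2))))"
    by (rule telescope_sums')
  then have "(\<lambda>n. (a n - a (Suc n)) / 2) sums ((P (\<tau> / 2) + of_real pi * \<i>) / 2)"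
    by (intro sums_divide) (simp add: a_def mult.commute)
  with 4 have e: "\<tau> / 2 * L - (X - \<tau> / 2 * of_real (pi ^ 2 / 3) - P (\<tau> / 2)) / 2 = (P (\<tau> / 2) + of_real pi * \<i>) / 2"
    by (rule sums_unique2)
  have "2 * X = 2 * (\<tau> * L + \<tau> / 2 * of_real (pi ^ 2 / 3) + P (\<tau> / 2) -
      2 * (\<tau> / 2 * L - (X - \<tau> / 2 * of_real (pi ^ 2 / 3) - P (\<tau> / 2)) / 2))"
    by (simp add: field_simps)
  also have "\<dots> = \<tau> * (of_real (pi ^ 2 / 3) + 2 * L) - 2 * of_real pi * \<i>"
    unfolding e by (simp add: field_simps)
  also have "\<dots> = \<tau> * eta1 \<tau> - 2 * of_real pi * \<i>"
    unfolding eta1_def weierstrass_zeta_half[OF \<tau>] L_def by (simp add: field_simps power2_eq_square)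
  finally show ?thesis by (simp add: eta2_def X_def)
qed

lemma eta1_expansion:
  assumes "Im \<tau> > 0"
  shows "eta1 \<tau> = of_real (pi ^ 2 / 3) * (1 - 24 * sigma_powser 1 (nome \<tau>))"
  by (simp add: eta1_def weierstrass_zeta_half[OF assms])

lemma g2_expansion:
  assumes "Im \<tau> > 0"
  shows "g2 \<tau> = of_real (4 * pi ^ 4 / 3) * (1 + 240 * sigma_powser 3 (nome \<tau>))"
proof -
  have e: "lattice_sum 4 \<tau> = of_real (2 * (pi ^ 4 / 90)) +
      2 * ((2 * of_real pi * \<i>) ^ 4 / fact 3 * sigma_powser 3 (nome \<tau>))"
    using lattice_sum_expansion[OF assms, of 3 "pi ^ 4 / 90"] zeta_4_sums by simp
  show ?thesis
    unfolding g2_lattice_sum e by (simp add: fact_numeral power_mult_distrib field_simps)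
qed

lemma g3_expansion:
  assumes "Im \<tau> > 0"
  shows "g3 \<tau> = of_real (8 * pi ^ 6 / 27) * (1 - 504 * sigma_powser 5 (nome \<tau>))"
proof -
  have e: "lattice_sum 6 \<tau> = of_real (2 * (pi ^ 6 / 945)) +
      2 * ((2 * of_real pi * \<i>) ^ 6 / fact 5 * sigma_powser 5 (nome \<tau>))"
    using lattice_sum_expansion[OF assms, of 5 "pi ^ 6 / 945"] zeta_6_sums by simp
  show ?thesis
    unfolding g3_lattice_sum e by (simp add: fact_numeral power_mult_distrib field_simps)
qed

lemma lattice_sum_inversion:
  assumes "\<tau> \<noteq> 0"
  shows "lattice_sum k (- 1 / \<tau>) = \<tau> ^ k * lattice_sum k \<tau>"
proof -
  have "lattice_sum k (- 1 / \<tau>) =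
      (\<Sum>\<^sub>\<infinity>(m::int, n::int)\<in>UNIV - {(0, 0)}. \<tau> ^ k * (1 / (of_int m * \<tau> + of_int n) ^ k))"
    unfolding lattice_sum_def
  proof (rule infsum_reindex_bij_witness[where j = "\<lambda>(m, n). (n, - m)" and i = "\<lambda>(m, n). (- n, m)"])
    fix p :: "int \<times> int"
    obtain m n where p: "p = (m, n)" by force
    have "of_int m * (- 1 / \<tau>) + of_int n = (of_int n * \<tau> + of_int (- m)) / \<tau>"
      using assms by (simp add: field_simps)
    then show "(case (case p of (m, n) \<Rightarrow> (n, - m)) of (m, n) \<Rightarrow> \<tau> ^ k * (1 / (of_int m * \<tau> + of_int n) ^ k)) =
        (case p of (m, n) \<Rightarrow> 1 / (of_int m * (- 1 / \<tau>) + of_int n) ^ k)"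
      unfolding p prod.case by (simp only: power_divide) simp
  qed auto
  also have "\<dots> = \<tau> ^ k * lattice_sum k \<tau>"
    unfolding lattice_sum_def case_prod_unfold by (rule infsum_cmult_right')
  finally show ?thesis .
qed

text \<open>The lattice of -1 / \<tau> is that of \<tau> divided by \<tau>, and the zeta function is
  homogeneous of degree -1. This gives \<tau> \<open>eta2\<close>, and Legendre's relation supplies
  the anomalous term.\<close>

lemma eta1_inversion:
  assumes \<tau>: "Im \<tau> > 0"
  shows "eta1 (- 1 / \<tau>) = \<tau> ^ 2 * eta1 \<tau> - 2 * of_real pi * \<i> * \<tau>"
proof -
  have t0: "\<tau> \<noteq> 0" using \<tau> by auto
  have "(\<Sum>\<^sub>\<infinity>(m::int, n::int)\<in>UNIV - {(0, 0)}.
        let \<omega> = of_int m * (- 1 / \<tau>) + of_int n in 1 / (1 / 2 - \<omega>) + 1 / \<omega> + 1 / 2 / \<omega> ^ 2) =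
      (\<Sum>\<^sub>\<infinity>(m::int, n::int)\<in>UNIV - {(0, 0)}.
        \<tau> * (let \<omega> = of_int m * \<tau> + of_int n in 1 / (\<tau> / 2 - \<omega>) + 1 / \<omega> + \<tau> / 2 / \<omega> ^ 2))"
  proof (rule infsum_reindex_bij_witness[where j = "\<lambda>(m, n). (n, - m)" and i = "\<lambda>(m, n). (- n, m)"])
    fix p :: "int \<times> int"
    obtain m n where p: "p = (m, n)" by force
    define w where "w = of_int n * \<tau> + of_int (- m)"
    have e: "of_int m * (- 1 / \<tau>) + of_int n = w / \<tau>"
      using t0 by (simp add: field_simps w_def)
    have "1 / 2 - w / \<tau> = (\<tau> / 2 - w) / \<tau>" using t0 by (simp add: field_simps)
    then have "1 / (1 / 2 - w / \<tau>) = \<tau> * (1 / (\<tau> / 2 - w))" by simp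
    moreover have "1 / (w / \<tau>) = \<tau> * (1 / w)" by simp
    moreover have "1 / 2 / (w / \<tau>) ^ 2 = \<tau> * (\<tau> / 2 / w ^ 2)"
      by (simp add: power_divide power2_eq_square)
    ultimately show "(case (case p of (m, n) \<Rightarrow> (n, - m)) of (m, n) \<Rightarrow> 
          \<tau> * (let \<omega> = of_int m * \<tau> + of_int n in 1 / (\<tau> / 2 - \<omega>) + 1 / \<omega> + \<tau> / 2 / \<omega> ^ 2)) =
        (case p of (m, n) \<Rightarrow> let \<omega> = of_int m * (- 1 / \<tau>) + of_int n in 1 / (1 / 2 - \<omega>) + 1 / \<omega> + 1 / 2 / \<omega> ^ 2)"
      unfolding p prod.case Let_def e w_def[symmetric] by (simp only: distrib_left)
  qed auto
  also have "\<dots> = \<tau> * (\<Sum>\<^sub>\<infinity>(m::int, n::int)\<in>UNIV - {(0, 0)}.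
        let \<omega> = of_int m * \<tau> + of_int n in 1 / (\<tau> / 2 - \<omega>) + 1 / \<omega> + \<tau> / 2 / \<omega> ^ 2)"
    unfolding case_prod_unfold by (rule infsum_cmult_right')
  finally have "weierstrass_zeta (1 / 2) (- 1 / \<tau>) = \<tau> * weierstrass_zeta (\<tau> / 2) \<tau>"
    unfolding weierstrass_zeta_def using t0 by (simp add: distrib_left)
  then have "eta1 (- 1 / \<tau>) = \<tau> * eta2 \<tau>" by (simp add: eta1_def eta2_def)
  then show ?thesis by (simp add: Legendre_relation[OF \<tau>] algebra_simps power2_eq_square)
qed

section \<open>Ramanujan's identity\<close>

text \<open>This is -1/504 times q dE6/dq, as a series in q.\<close>

definition E6_deriv_series :: "complex \<Rightarrow> complex" where
  "E6_deriv_series = powser (\<lambda>n. of_nat n * of_nat (sigma_sum 5 n))"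

lemma DERIV_g3_expansion:
  assumes "Im \<tau> > 0"
  shows "(g3 has_field_derivative
           of_real (8 * pi ^ 6 / 27) * (- 504 * (2 * of_real pi * \<i> * E6_deriv_series (nome \<tau>)))) (at \<tau>)"
proof (rule has_field_derivative_transform_within_open[OF _ open_upper_half_plane])
  show "((\<lambda>\<tau>. of_real (8 * pi ^ 6 / 27) * (1 - 504 * sigma_powser 5 (nome \<tau>))) has_field_derivative
           of_real (8 * pi ^ 6 / 27) * (- 504 * (2 * of_real pi * \<i> * E6_deriv_series (nome \<tau>)))) (at \<tau>)"
    unfolding E6_deriv_series_def
    by (auto intro!: derivative_eq_intros DERIV_powser_nome converges_on_disk_sigma assms)
qed (use assms g3_expansion in auto)

lemma deriv_g3_expansion:
  assumes "Im \<tau> > 0"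
  shows "deriv g3 \<tau> =
    of_real (8 * pi ^ 6 / 27) * (- 504 * (2 * of_real pi * \<i> * E6_deriv_series (nome \<tau>)))"
  using DERIV_g3_expansion[OF assms] by (rule DERIV_imp_deriv)

lemma DERIV_g3: "Im \<tau> > 0 \<Longrightarrow> (g3 has_field_derivative deriv g3 \<tau>) (at \<tau>)"
  using DERIV_g3_expansion deriv_g3_expansion by metis

lemma Im_neg_inverse: "Im (- 1 / \<tau>) = Im \<tau> / norm \<tau> ^ 2"
  by (simp add: Im_divide cmod_power2)

lemma Im_neg_inverse_pos: "Im \<tau> > 0 \<Longrightarrow> Im (- 1 / \<tau>) > 0"
  unfolding Im_neg_inverse by (intro divide_pos_pos zero_less_power) auto

lemma g3_inversion: "\<tau> \<noteq> 0 \<Longrightarrow> g3 (- 1 / \<tau>) = \<tau> ^ 6 * g3 \<tau>"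
  and g2_inversion: "\<tau> \<noteq> 0 \<Longrightarrow> g2 (- 1 / \<tau>) = \<tau> ^ 4 * g2 \<tau>"
  unfolding g3_lattice_sum g2_lattice_sum by (subst lattice_sum_inversion; simp)+

lemma deriv_g3_inversion:
  assumes "Im \<tau> > 0"
  shows "deriv g3 (- 1 / \<tau>) = \<tau> ^ 8 * deriv g3 \<tau> + 6 * \<tau> ^ 7 * g3 \<tau>"
proof -
  have t0: "\<tau> \<noteq> 0" using assms by auto
  have "((\<lambda>\<tau>. - 1 / \<tau>) has_field_derivative 1 / \<tau> ^ 2) (at \<tau>)"
    using t0 by (auto intro!: derivative_eq_intros simp: power2_eq_square)
  from DERIV_chain2[where f = g3 and g = "\<lambda>\<tau>. - 1 / \<tau>" and x = \<tau>, OF DERIV_g3[OF Im_neg_inverse_pos[OF assms]] this]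
  have 1: "((\<lambda>\<tau>. g3 (- 1 / \<tau>)) has_field_derivative deriv g3 (- 1 / \<tau>) * (1 / \<tau> ^ 2)) (at \<tau>)" .
  have 2: "((\<lambda>\<tau>. \<tau> ^ 6 * g3 \<tau>) has_field_derivative 6 * \<tau> ^ 5 * g3 \<tau> + deriv g3 \<tau> * \<tau> ^ 6) (at \<tau>)"
    using DERIV_g3[OF assms] by (auto intro!: derivative_eq_intros)
  have "deriv g3 (- 1 / \<tau>) * (1 / \<tau> ^ 2) = 6 * \<tau> ^ 5 * g3 \<tau> + deriv g3 \<tau> * \<tau> ^ 6"
  proof (rule DERIV_unique_open[OF open_upper_half_plane _ _ 1 2])
    show "g3 (- 1 / w) = w ^ 6 * g3 w" if "w \<in> {z. Im z > 0}" for w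
      using that by (intro g3_inversion) auto
  qed (use assms in auto)
  then have "deriv g3 (- 1 / \<tau>) = \<tau> ^ 2 * (6 * \<tau> ^ 5 * g3 \<tau> + deriv g3 \<tau> * \<tau> ^ 6)"
    using t0 by (simp add: field_simps)
  then show ?thesis by (simp add: algebra_simps flip: power_add)
qed

text \<open>Ramanujan's identity \<open>q dE\<^sub>6/dq = (E\<^sub>2 E\<^sub>6 - E\<^sub>4\<^sup>2) / 2\<close>: the difference of the two sides
  is a cusp form of weight 8. Such a form vanishes, because at a point with imaginary part \<open>3/4\<close> where
  \<open>\<bar>D/q\<bar>\<close> is maximal, the inversion would produce a larger value higher up.\<close>

definition ramanujan_defect :: "complex \<Rightarrow> complex" where
  "ramanujan_defect x = 1008 * E6_deriv_series x - (1 + 240 * sigma_powser 3 x) ^ 2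
     + (1 - 24 * sigma_powser 1 x) * (1 - 504 * sigma_powser 5 x)"

lemma holomorphic_ramanujan_defect: "ramanujan_defect holomorphic_on ball 0 1"
  unfolding ramanujan_defect_def[abs_def] E6_deriv_series_def
  by (intro holomorphic_intros holomorphic_powser converges_on_disk_sigma converges_on_disk_times_n)

lemma powser_0: "powser c 0 = c 0"
  by (simp add: powser_def)

lemma ramanujan_defect_0: "ramanujan_defect 0 = 0"
  by (simp add: ramanujan_defect_def E6_deriv_series_def powser_0)

lemma ramanujan_defect_eq:
  assumes "Im \<tau> > 0"
  shows "of_real (16 * pi ^ 8 / 9) * ramanujan_defect (nome \<tau>) =
    6 * of_real pi * \<i> * deriv g3 \<tau> - g2 \<tau> ^ 2 + 18 * eta1 \<tau> * g3 \<tau>"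
  unfolding deriv_g3_expansion[OF assms] g2_expansion[OF assms] g3_expansion[OF assms]
    eta1_expansion[OF assms] ramanujan_defect_def
  by (simp add: field_simps eval_nat_numeral)

text \<open>The anomalous terms cancel: 36 pi i \<tau>^7 g3 from \<open>deriv g3\<close> against -36
  pi i \<tau>^7 g3 from \<open>eta1\<close>. The combination is therefore modular of weight
  8.\<close>

lemma ramanujan_defect_inversion:
  assumes "Im \<tau> > 0"
  shows "ramanujan_defect (nome (- 1 / \<tau>)) = \<tau> ^ 8 * ramanujan_defect (nome \<tau>)"
proof -
  have t0: "\<tau> \<noteq> 0" using assms by auto
  have "of_real (16 * pi ^ 8 / 9) * ramanujan_defect (nome (- 1 / \<tau>)) =
      \<tau> ^ 8 * (of_real (16 * pi ^ 8 / 9) * ramanujan_defect (nome \<tau>))"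
    unfolding ramanujan_defect_eq[OF assms] ramanujan_defect_eq[OF Im_neg_inverse_pos[OF assms]]
      g2_inversion[OF t0] g3_inversion[OF t0] deriv_g3_inversion[OF assms] eta1_inversion[OF assms]
    by algebra
  then show ?thesis by simp
qed

lemma nome_surj_on_circle:
  assumes "norm x = exp (- (2 * pi * y))"
  obtains \<tau> where "nome \<tau> = x" "Im \<tau> = y" "\<bar>Re \<tau>\<bar> \<le> 1 / 2"
proof
  define \<tau> where "\<tau> = Complex (Arg x / (2 * pi)) y"
  have "x \<noteq> 0" using assms by auto
  have "2 * of_real pi * \<i> * \<tau> = of_real (- (2 * pi * y)) + \<i> * of_real (Arg x)"
    by (simp add: \<tau>_def complex_eq_iff)
  then have "nome \<tau> = of_real (norm x) * exp (\<i> * of_real (Arg x))"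
    unfolding nome_def by (simp only: exp_add exp_of_real assms)
  then show "nome \<tau> = x"
    using Arg_eq[OF \<open>x \<noteq> 0\<close>] by simp
  show "Im \<tau> = y" by (simp add: \<tau>_def)
  show "\<bar>Re \<tau>\<bar> \<le> 1 / 2"
    using Arg_bounded[of x] by (simp add: \<tau>_def abs_mult abs_le_iff field_simps)
qed

lemma ramanujan_defect_eq_0:
  assumes "norm x < 1"
  shows "ramanujan_defect x = 0"
proof -
  define Q where "Q = (\<lambda>z. if z = 0 then deriv ramanujan_defect 0
      else (ramanujan_defect z - ramanujan_defect 0) / (z - 0))"
  have Q: "Q holomorphic_on ball 0 1"
    unfolding Q_def by (rule pole_lemma[OF holomorphic_ramanujan_defect]) simp
  have QD: "ramanujan_defect z = z * Q z" for z
    by (simp add: Q_def ramanujan_defect_0)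
  \<comment> \<open>The height 3/4 has two virtues. It is below sqrt 3 / 2, so inversion raises
    every point with |Re \<tau>| <= 1/2 on that line; and 2 pi * 3/4 > 4, so the decay of the nome
    beats the weight factor |\<tau>|^8.\<close>
  define r where "r = exp (- (2 * pi * (3 / 4)))"
  have r: "0 < r" "r < 1" by (simp_all add: r_def)
  have sub: "cball 0 r \<subseteq> ball (0::complex) 1" using r by auto
  have cont: "continuous_on (cball 0 r) Q"
    using holomorphic_on_imp_continuous_on[OF holomorphic_on_subset[OF Q sub]] .
  have "\<exists>x\<in>sphere 0 r. \<forall>y\<in>sphere (0::complex) r. norm (Q y) \<le> norm (Q x)"
    using r by (intro continuous_attains_sup continuous_intros continuous_on_subset[OF cont]) auto
  then obtain x0 where x0: "norm x0 = r" "\<And>y. norm y = r \<Longrightarrow> norm (Q y) \<le> norm (Q x0)"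
    by auto
  have max: "norm (Q y) \<le> norm (Q x0)" if "norm y \<le> r" for y
  proof (rule maximum_modulus_frontier[of Q "cball 0 r"])
    show "Q holomorphic_on interior (cball 0 r)"
      using sub by (intro holomorphic_on_subset[OF Q]) auto
    show "continuous_on (closure (cball 0 r)) Q" using cont by simp
    show "norm (Q z) \<le> norm (Q x0)" if "z \<in> frontier (cball 0 r)" for z
      using that r x0(2) by (simp add: frontier_cball)
  qed (use that in auto)
  have "Q x0 = 0"
  proof (rule ccontr)
    assume "Q x0 \<noteq> 0"
    obtain \<tau> where \<tau>: "nome \<tau> = x0" "Im \<tau> = 3 / 4" "\<bar>Re \<tau>\<bar> \<le> 1 / 2"
      using nome_surj_on_circle[of x0 "3 / 4"] x0(1) by (auto simp: r_def)
    have t: "Im \<tau> > 0" using \<tau> by simp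
    define u where "u = 1 / norm \<tau> ^ 2"
    have "norm \<tau> ^ 2 = Re \<tau> ^ 2 + (3 / 4) ^ 2" using \<tau>(2) by (simp add: cmod_power2)
    also have "Re \<tau> ^ 2 \<le> (1 / 2) ^ 2" using power_mono[OF \<tau>(3), of 2] by simp
    finally have "norm \<tau> ^ 2 < 1" by (simp add: power2_eq_square)
    moreover have npos: "norm \<tau> ^ 2 > 0" using t by auto
    ultimately have u: "u > 1" by (simp add: u_def)
    define x1 where "x1 = nome (- 1 / \<tau>)"
    have n1: "norm x1 = exp (- (2 * pi * (3 / 4 * u)))"
      unfolding x1_def norm_nome Im_neg_inverse \<tau>(2) by (simp add: u_def)
    have "norm x1 \<le> r" unfolding n1 r_def using u by simp
    from max[OF this] have "norm x1 * norm (Q x1) \<le> norm x1 * norm (Q x0)"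
      by (intro mult_left_mono) auto
    moreover have "norm x1 * norm (Q x1) = norm \<tau> ^ 8 * (r * norm (Q x0))"
      using ramanujan_defect_inversion[OF t] unfolding x1_def[symmetric] \<tau>(1) QD
      by (metis norm_mult norm_power x0(1))
    ultimately have "norm \<tau> ^ 8 * r \<le> norm x1"
      using \<open>Q x0 \<noteq> 0\<close> by (simp flip: mult.assoc)
    moreover have "norm \<tau> ^ 8 = 1 / u ^ 4"
      by (simp add: u_def power_divide flip: power_mult)
    ultimately have "r \<le> u ^ 4 * norm x1" using u by (simp add: field_simps)
    \<comment> \<open>The inequality u <= exp(u - 1) puts the weight factor on the same exponential
      scale as the nome, so that only the exponents have to be compared.\<close>
    also have "\<dots> \<le> exp (u - 1) ^ 4 * norm x1"
      using exp_ge_add_one_self[of "u - 1"] u by (intro mult_right_mono power_mono) auto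
    also have "exp (u - 1) ^ 4 = exp (4 * (u - 1))" by (simp flip: exp_of_nat_mult)
    also have "exp (4 * (u - 1)) * norm x1 = exp (4 * (u - 1) - 2 * pi * (3 / 4 * u))"
      unfolding n1 by (simp flip: exp_add)
    finally have "- (2 * pi * (3 / 4)) \<le> 4 * (u - 1) - 2 * pi * (3 / 4 * u)"
      by (simp add: r_def)
    moreover have "(6 * pi / 4 - 4) * (u - 1) = 2 * pi * (3 / 4 * u) - 2 * pi * (3 / 4) - 4 * (u - 1)"
      by (simp add: field_simps)
    ultimately have "(6 * pi / 4 - 4) * (u - 1) \<le> 0" by linarith
    moreover have "(6 * pi / 4 - 4) * (u - 1) > 0" using u pi_gt3 by (intro mult_pos_pos) auto
    ultimately show False by simp
  qed
  then have 0: "ramanujan_defect z = 0" if "z \<in> ball 0 r" for z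
    using max[of z] that by (simp add: QD)
  show ?thesis
  proof (rule analytic_continuation_open[of "ball 0 r" "ball 0 1" ramanujan_defect "\<lambda>_. 0" x])
    show "ramanujan_defect holomorphic_on ball 0 1" by (rule holomorphic_ramanujan_defect)
  qed (use r 0 assms in auto)
qed

text \<open>By Legendre's relation C \<open>eta1\<close> - \<open>eta2\<close> is (C - \<tau>)
  \<open>eta1\<close> + 2 pi i, and the vanishing defect expresses the square of \<open>g2\<close>.
  The two terms in \<open>eta1\<close> times \<open>g3\<close> cancel.\<close>

lemma f_eq:
  assumes "Im \<tau> > 0"
  shows "f C \<tau> = 6 * of_real pi * \<i> * ((of_real C - \<tau>) * deriv g3 \<tau> - 6 * g3 \<tau>)"
proof -
  have "6 * of_real pi * \<i> * deriv g3 \<tau> - g2 \<tau> ^ 2 + 18 * eta1 \<tau> * g3 \<tau> = 0"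
    using ramanujan_defect_eq[OF assms] ramanujan_defect_eq_0[OF norm_nome_less_1[OF assms]] by simp
  then have "g2 \<tau> ^ 2 = 6 * of_real pi * \<i> * deriv g3 \<tau> + 18 * eta1 \<tau> * g3 \<tau>"
    by (simp add: algebra_simps)
  then show ?thesis
    unfolding f_def Legendre_relation[OF assms] by (simp add: algebra_simps)
qed

section \<open>Equivariance of the zeros\<close>

text \<open>The pair \<open>(p, r)\<close> stands for the point \<open>p / r\<close> of the real projective line, so that
  \<open>(1, 0)\<close> gives the zeros of the derivative of \<open>g3\<close>.\<close>

definition zero_form :: "real \<Rightarrow> real \<Rightarrow> complex \<Rightarrow> complex" where
  "zero_form p r \<tau> = (of_real p - of_real r * \<tau>) * deriv g3 \<tau> - 6 * of_real r * g3 \<tau>"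

lemma f_eq_0_iff: "Im \<tau> > 0 \<Longrightarrow> f C \<tau> = 0 \<longleftrightarrow> zero_form C 1 \<tau> = 0"
  by (simp add: f_eq zero_form_def)

lemma zero_form_scale: "zero_form (k * p) (k * r) \<tau> = of_real k * zero_form p r \<tau>"
  by (simp add: zero_form_def algebra_simps)

lemma g3_add_1: "Im \<tau> > 0 \<Longrightarrow> g3 (\<tau> + 1) = g3 \<tau>"
  and deriv_g3_add_1: "Im \<tau> > 0 \<Longrightarrow> deriv g3 (\<tau> + 1) = deriv g3 \<tau>"
  by (simp_all add: g3_expansion deriv_g3_expansion nome_add_1)

text \<open>The map \<tau> -> 1 - 1/\<tau> has order three, and (p, r) -> (r, r - p) is its inverse
  on p / r. The homogeneous pair lets the rotation reach the zeros of \<open>deriv g3\<close>, since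
  (1, 1) goes to (1, 0).\<close>

lemma zero_form_rotation:
  assumes "Im \<tau> > 0"
  shows "zero_form p r (1 - 1 / \<tau>) = \<tau> ^ 7 * zero_form r (r - p) \<tau>"
proof -
  have t0: "\<tau> \<noteq> 0" using assms by auto
  have e: "1 - 1 / \<tau> = - 1 / \<tau> + 1" by simp
  have g: "g3 (1 - 1 / \<tau>) = \<tau> ^ 6 * g3 \<tau>" "deriv g3 (1 - 1 / \<tau>) = \<tau> ^ 8 * deriv g3 \<tau> + 6 * \<tau> ^ 7 * g3 \<tau>"
    unfolding e using Im_neg_inverse_pos[OF assms]
    by (simp_all only: g3_add_1 deriv_g3_add_1 g3_inversion[OF t0] deriv_g3_inversion[OF assms])
  define X where "X = of_real p - of_real r * (1 - 1 / \<tau>)"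
  have X: "X * \<tau> ^ 8 = \<tau> ^ 7 * (of_real (p - r) * \<tau> + of_real r)"
    "X * \<tau> ^ 7 = \<tau> ^ 6 * (of_real (p - r) * \<tau> + of_real r)"
    using t0 by (simp_all add: X_def field_simps eval_nat_numeral)
  have "zero_form p r (1 - 1 / \<tau>) =
      X * (\<tau> ^ 8 * deriv g3 \<tau> + 6 * \<tau> ^ 7 * g3 \<tau>) - 6 * of_real r * (\<tau> ^ 6 * g3 \<tau>)"
    by (simp only: zero_form_def g X_def)
  also have "\<dots> = X * \<tau> ^ 8 * deriv g3 \<tau> + 6 * (X * \<tau> ^ 7) * g3 \<tau> - 6 * of_real r * (\<tau> ^ 6 * g3 \<tau>)"
    by (simp add: algebra_simps)
  also have "\<dots> = \<tau> ^ 7 * (of_real (p - r) * \<tau> + of_real r) * deriv g3 \<tau> +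
      6 * (\<tau> ^ 6 * (of_real (p - r) * \<tau> + of_real r)) * g3 \<tau> - 6 * of_real r * (\<tau> ^ 6 * g3 \<tau>)"
    unfolding X ..
  also have "\<dots> = \<tau> ^ 7 * zero_form r (r - p) \<tau>"
    by (simp add: zero_form_def algebra_simps eval_nat_numeral)
  finally show ?thesis .
qed

lemma powser_cnj:
  assumes "converges_on_disk c" "norm x < 1" "\<And>n. cnj (c n) = c n"
  shows "powser c (cnj x) = cnj (powser c x)"
proof -
  have "(\<lambda>n. cnj (c n * x ^ n)) sums cnj (powser c x)"
    using powser_sums[OF assms(1,2)] by (simp only: sums_cnj)
  then have "(\<lambda>n. c n * cnj x ^ n) sums cnj (powser c x)"
    by (simp add: assms(3))
  moreover have "(\<lambda>n. c n * cnj x ^ n) sums powser c (cnj x)"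
    using assms by (intro powser_sums) auto
  ultimately show ?thesis using sums_unique2 by blast
qed

lemma nome_neg_cnj: "nome (- cnj \<tau>) = cnj (nome \<tau>)"
  by (simp add: nome_def exp_cnj)

lemma g3_neg_cnj: "Im \<tau> > 0 \<Longrightarrow> g3 (- cnj \<tau>) = cnj (g3 \<tau>)"
  and deriv_g3_neg_cnj: "Im \<tau> > 0 \<Longrightarrow> deriv g3 (- cnj \<tau>) = - cnj (deriv g3 \<tau>)"
  using norm_nome_less_1[of \<tau>]
  by (simp_all add: g3_expansion deriv_g3_expansion nome_neg_cnj E6_deriv_series_def
      powser_cnj converges_on_disk_sigma converges_on_disk_times_n)

text \<open>The q-expansions have real coefficients, so reflection in the imaginary axis conjugates
  \<open>g3\<close>. On values of h the reflection in Re \<tau> = 1/2 is C -> 1 - C.\<close>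

lemma zero_form_reflection:
  assumes "Im \<tau> > 0"
  shows "zero_form p r (1 - cnj \<tau>) = cnj (zero_form (r - p) r \<tau>)"
proof -
  have "1 - cnj \<tau> = - cnj \<tau> + 1" by simp
  then have "g3 (1 - cnj \<tau>) = cnj (g3 \<tau>)" "deriv g3 (1 - cnj \<tau>) = - cnj (deriv g3 \<tau>)"
    using assms g3_add_1[of "- cnj \<tau>"] deriv_g3_add_1[of "- cnj \<tau>"]
    by (simp_all add: g3_neg_cnj deriv_g3_neg_cnj)
  then show ?thesis by (simp add: zero_form_def algebra_simps)
qed

text \<open>On the circle the inversion and the reflection \<tau> -> -\<open>cnj\<close> \<tau>
  coincide. For a real value C of h they give -1/C = -C; the computation is this with denominators
  cleared.\<close>

lemma zero_form_on_circle:
  assumes "Im \<tau> > 0" "norm \<tau> = 1" "deriv g3 \<tau> \<noteq> 0" "zero_form C 1 \<tau> = 0"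
  shows "C = 1 \<or> C = - 1"
proof -
  have t0: "\<tau> \<noteq> 0" using assms(1) by auto
  have "\<tau> * cnj \<tau> = 1" using assms(2) by (simp add: complex_norm_square[symmetric])
  then have "- 1 / \<tau> = - cnj \<tau>" using t0 by (simp add: field_simps)
  then have "- cnj (deriv g3 \<tau>) = \<tau> ^ 8 * deriv g3 \<tau> + 6 * \<tau> ^ 7 * g3 \<tau>" and G: "cnj (g3 \<tau>) = \<tau> ^ 6 * g3 \<tau>"
    using deriv_g3_inversion[OF assms(1)] g3_inversion[OF t0] assms(1)
    by (simp_all add: g3_neg_cnj deriv_g3_neg_cnj)
  then have D: "cnj (deriv g3 \<tau>) = - (\<tau> ^ 8 * deriv g3 \<tau> + \<tau> ^ 7 * (6 * g3 \<tau>))"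
    by (metis minus_minus mult.assoc mult.left_commute)
  have z: "6 * g3 \<tau> = (of_real C - \<tau>) * deriv g3 \<tau>"
    using assms(4) by (simp add: zero_form_def)
  have "(of_real C - cnj \<tau>) * cnj (deriv g3 \<tau>) = 6 * cnj (g3 \<tau>)"
    using arg_cong[OF assms(4), of cnj] by (simp add: zero_form_def)
  also have "\<dots> = \<tau> ^ 6 * (6 * g3 \<tau>)" by (simp add: G)
  finally have "(of_real C - cnj \<tau>) * (- (\<tau> ^ 8 * deriv g3 \<tau> + \<tau> ^ 7 * ((of_real C - \<tau>) * deriv g3 \<tau>))) =
      \<tau> ^ 6 * ((of_real C - \<tau>) * deriv g3 \<tau>)"
    unfolding D z .
  then have "\<tau> ^ 6 * deriv g3 \<tau> * ((of_real C - cnj \<tau>) * (\<tau> * of_real C) + (of_real C - \<tau>)) = 0"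
    by (simp add: algebra_simps eval_nat_numeral)
  then have "(of_real C - cnj \<tau>) * (\<tau> * of_real C) + (of_real C - \<tau>) = 0"
    using assms(3) t0 by simp
  then have "of_real C ^ 2 * \<tau> - (\<tau> * cnj \<tau>) * of_real C + of_real C - \<tau> = 0"
    by (simp add: algebra_simps power2_eq_square)
  then have "(of_real C ^ 2 - 1) * \<tau> = 0"
    unfolding \<open>\<tau> * cnj \<tau> = 1\<close> by (simp add: algebra_simps)
  then have "complex_of_real (C ^ 2) = of_real 1" using t0 by simp
  then show ?thesis by (simp only: of_real_eq_iff power2_eq_1_iff)
qed

section \<open>The equivariant function in terms of the nome\<close>

text \<open>At a zero of \<open>deriv g3\<close>, where h should have a pole, division by zero gives
  the value \<tau>; hence the nonvanishing assumptions where zeros are read off from values.\<close>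

definition h_fun :: "complex \<Rightarrow> complex" where
  "h_fun \<tau> = \<tau> + 6 * g3 \<tau> / deriv g3 \<tau>"

lemma zero_form_iff_h_fun:
  assumes "deriv g3 \<tau> \<noteq> 0"
  shows "zero_form C 1 \<tau> = 0 \<longleftrightarrow> h_fun \<tau> = of_real C"
  using assms by (auto simp: zero_form_def h_fun_def field_simps)

abbreviation E6_deriv2_series :: "complex \<Rightarrow> complex" where
  "E6_deriv2_series \<equiv> powser (\<lambda>n. of_nat n * (of_nat n * of_nat (sigma_sum 5 n)))"

lemma deriv_g3_eq_0_iff: "Im \<tau> > 0 \<Longrightarrow> deriv g3 \<tau> = 0 \<longleftrightarrow> E6_deriv_series (nome \<tau>) = 0"
  by (simp add: deriv_g3_expansion)

lemma h_fun_expansion: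
  assumes "Im \<tau> > 0"
  shows "h_fun \<tau> = \<tau> + of_real (3 / pi) * \<i> * ((1 / 504 - sigma_powser 5 (nome \<tau>)) / E6_deriv_series (nome \<tau>))"
proof (cases "E6_deriv_series (nome \<tau>) = 0")
  case False
  then show ?thesis
    unfolding h_fun_def g3_expansion[OF assms] deriv_g3_expansion[OF assms]
    by (simp add: field_simps)
qed (simp add: h_fun_def deriv_g3_expansion[OF assms])

text \<open>This is h' = 7 - 6 g3 g3'' / g3'^2 written in the nome. The sign of Im h' is that of the
  imaginary part of the quotient.\<close>

lemma DERIV_h_fun:
  assumes "Im \<tau> > 0" "E6_deriv_series (nome \<tau>) \<noteq> 0"
  shows "(h_fun has_field_derivative
    7 + 6 * ((1 / 504 - sigma_powser 5 (nome \<tau>)) * E6_deriv2_series (nome \<tau>) / E6_deriv_series (nome \<tau>) ^ 2)) (at \<tau>)"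
proof (rule has_field_derivative_transform_within_open[OF _ open_upper_half_plane])
  define A where "A = sigma_powser 5 (nome \<tau>)"
  define B where "B = E6_deriv_series (nome \<tau>)"
  define C where "C = E6_deriv2_series (nome \<tau>)"
  have A: "((\<lambda>\<tau>. sigma_powser 5 (nome \<tau>)) has_field_derivative 2 * of_real pi * \<i> * B) (at \<tau>)"
    unfolding B_def E6_deriv_series_def by (rule DERIV_powser_nome[OF converges_on_disk_sigma assms(1)])
  have B: "((\<lambda>\<tau>. E6_deriv_series (nome \<tau>)) has_field_derivative 2 * of_real pi * \<i> * C) (at \<tau>)"
    unfolding C_def E6_deriv_series_def
    by (rule DERIV_powser_nome[OF converges_on_disk_times_n[OF converges_on_disk_sigma] assms(1)])
  have "((\<lambda>\<tau>. \<tau> + of_real (3 / pi) * \<i> * ((1 / 504 - sigma_powser 5 (nome \<tau>)) / E6_deriv_series (nome \<tau>)))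
      has_field_derivative 1 + of_real (3 / pi) * \<i> *
        (((0 - 2 * of_real pi * \<i> * B) * B - (1 / 504 - A) * (2 * of_real pi * \<i> * C)) / (B * B))) (at \<tau>)"
    unfolding A_def using assms(2) unfolding B_def
    by (intro DERIV_add DERIV_cmult DERIV_ident DERIV_divide DERIV_diff DERIV_const A[unfolded B_def] B)
  also have "1 + of_real (3 / pi) * \<i> *
        (((0 - 2 * of_real pi * \<i> * B) * B - (1 / 504 - A) * (2 * of_real pi * \<i> * C)) / (B * B)) =
      7 + 6 * ((1 / 504 - A) * C / B ^ 2)"
    using assms(2) unfolding B_def[symmetric] by (simp add: field_simps power2_eq_square)
  finally show "((\<lambda>\<tau>. \<tau> + of_real (3 / pi) * \<i> * ((1 / 504 - sigma_powser 5 (nome \<tau>)) / E6_deriv_series (nome \<tau>)))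
      has_field_derivative 7 + 6 * ((1 / 504 - sigma_powser 5 (nome \<tau>)) * E6_deriv2_series (nome \<tau>) / E6_deriv_series (nome \<tau>) ^ 2)) (at \<tau>)"
    unfolding A_def B_def C_def .
qed (use assms h_fun_expansion in auto)

section \<open>Estimates near the cusp\<close>

lemma divisors_1_to_4:
  "{d::nat. d dvd 1} = {1}" "{d::nat. d dvd 2} = {1, 2}" "{d::nat. d dvd 3} = {1, 3}" "{d::nat. d dvd 4} = {1, 2, 4}"
proof -
  have *: "{d. d dvd n} = {d \<in> {1..n}. d dvd n}" if "n > 0" for n :: nat
    using that by (auto dest: dvd_imp_le intro: Nat.gr0I simp: Suc_le_eq)
  have "{1..2} = {1, 2::nat}" "{1..3} = {1, 2, 3::nat}" "{1..4} = {1, 2, 3, 4::nat}" by auto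
  then show "{d::nat. d dvd 2} = {1, 2}" "{d::nat. d dvd 3} = {1, 3}" "{d::nat. d dvd 4} = {1, 2, 4}"
    by (subst *; force)+
qed auto

lemma sigma_sum_5_values:
  "sigma_sum 5 1 = 1" "sigma_sum 5 2 = 33" "sigma_sum 5 3 = 244" "sigma_sum 5 4 = 1057"
  unfolding sigma_sum_def divisors_1_to_4 by simp_all

text \<open>Power series with real coefficients are controlled near the real axis by the pair of bounds
  \<open>norm z \<le> a\<close> and \<open>\<bar>Im z\<bar> \<le> v * b\<close>, where \<open>v\<close> is the imaginary part of the argument.\<close>

definition im_bounded :: "real \<Rightarrow> complex \<Rightarrow> real \<Rightarrow> real \<Rightarrow> bool" where
  "im_bounded v z a b \<longleftrightarrow> norm z \<le> a \<and> \<bar>Im z\<bar> \<le> v * b"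

lemma im_bounded_add:
  "im_bounded v z a b \<Longrightarrow> im_bounded v w a' b' \<Longrightarrow> im_bounded v (z + w) (a + a') (b + b')"
  unfolding im_bounded_def by (auto simp: distrib_left intro: order.trans[OF norm_triangle_ineq add_mono])

lemma im_bounded_uminus: "im_bounded v z a b \<Longrightarrow> im_bounded v (- z) a b"
  unfolding im_bounded_def by simp

lemma im_bounded_diff:
  "im_bounded v z a b \<Longrightarrow> im_bounded v w a' b' \<Longrightarrow> im_bounded v (z - w) (a + a') (b + b')"
  using im_bounded_add[OF _ im_bounded_uminus] by fastforce

text \<open>The second bound acts like a majorant of the derivative, so products and powers follow
  the rules of differentiation.\<close>

lemma im_bounded_mult:
  assumes "im_bounded v z a b" "im_bounded v w a' b'" "v \<ge> 0" "b \<ge> 0" "b' \<ge> 0"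
  shows "im_bounded v (z * w) (a * a') (a * b' + b * a')"
proof -
  have n: "norm z \<le> a" "norm w \<le> a'" "\<bar>Im z\<bar> \<le> v * b" "\<bar>Im w\<bar> \<le> v * b'"
    using assms by (auto simp: im_bounded_def)
  then have p: "0 \<le> a" "0 \<le> a'" using norm_ge_zero[of z] norm_ge_zero[of w] by linarith+
  have "norm (z * w) \<le> a * a'" unfolding norm_mult using n p by (intro mult_mono) auto
  moreover have "\<bar>Im (z * w)\<bar> \<le> \<bar>Re z\<bar> * \<bar>Im w\<bar> + \<bar>Im z\<bar> * \<bar>Re w\<bar>"
    by (simp add: abs_mult[symmetric])
  moreover have "\<bar>Re z\<bar> * \<bar>Im w\<bar> \<le> a * (v * b')"
    using n p abs_Re_le_cmod[of z] by (intro mult_mono) auto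
  moreover have "\<bar>Im z\<bar> * \<bar>Re w\<bar> \<le> (v * b) * a'"
    using n p abs_Re_le_cmod[of w] assms by (intro mult_mono) auto
  ultimately show ?thesis unfolding im_bounded_def by (simp add: algebra_simps)
qed

lemma im_bounded_cmult:
  assumes "im_bounded v z a b" "k \<ge> 0"
  shows "im_bounded v (of_real k * z) (k * a) (k * b)"
  using assms mult_left_mono[of "\<bar>Im z\<bar>" "v * b" k] mult_left_mono[of "norm z" a k]
  by (auto simp: im_bounded_def norm_mult abs_mult mult_left_mono mult_ac)

lemma im_bounded_mono:
  "im_bounded v z a b \<Longrightarrow> a \<le> a' \<Longrightarrow> b \<le> b' \<Longrightarrow> v \<ge> 0 \<Longrightarrow> im_bounded v z a' b'"
  unfolding im_bounded_def using mult_left_mono[of b b' v] by auto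

lemma im_bounded_power:
  "im_bounded \<bar>Im u\<bar> (u ^ Suc n) (norm u ^ Suc n) (real (Suc n) * norm u ^ n)"
proof (induction n)
  case 0
  show ?case by (simp add: im_bounded_def)
next
  case (Suc n)
  have "im_bounded \<bar>Im u\<bar> (u * u ^ Suc n) (norm u * norm u ^ Suc n)
      (norm u * (real (Suc n) * norm u ^ n) + 1 * norm u ^ Suc n)"
    by (rule im_bounded_mult[OF _ Suc]) (auto simp: im_bounded_def)
  then show ?case by (simp add: algebra_simps)
qed

text \<open>The tail starts at n = 5 and is dominated by a geometric series of ratio 6 |u| <= 6/230.
  The constants are 5^8 and 5^9 times 230/224, rounded up; the imaginary part costs one more factor
  n. The exponent 8 accommodates n^2 times the fifth divisor sum.\<close>

lemma powser_tail:
  fixes c :: "nat \<Rightarrow> nat"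
  assumes c: "c 0 = 0" "\<And>n. c n \<le> n ^ 8" and u: "norm u \<le> 1 / 230"
  obtains R where
    "powser (\<lambda>n. of_nat (c n)) u = u * (of_nat (c 1) + of_nat (c 2) * u + of_nat (c 3) * u ^ 2 + of_nat (c 4) * u ^ 3 + R)"
    "im_bounded \<bar>Im u\<bar> R (403000 * norm u ^ 4) (2020000 * norm u ^ 3)"
proof -
  define r where "r = norm u"
  have r: "0 \<le> r" "r \<le> 1 / 230" using u by (auto simp: r_def)
  \<comment> \<open>The base 6 works because (6/5)^k <= 6 for both exponents in use, k = 8 and k =
    9.\<close>
  have step: "(real n + 6) ^ k \<le> 6 * (real n + 5) ^ k" if "(6::real) ^ k \<le> 6 * 5 ^ k" for n k
  proof -
    have "5 ^ k * (real n + 6) ^ k = (5 * (real n + 6)) ^ k" by (simp only: power_mult_distrib)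
    also have "\<dots> \<le> (6 * (real n + 5)) ^ k" by (intro power_mono) auto
    also have "\<dots> = 6 ^ k * (real n + 5) ^ k" by (simp only: power_mult_distrib)
    also have "\<dots> \<le> 6 * 5 ^ k * (real n + 5) ^ k" using that by (intro mult_right_mono) auto
    finally show ?thesis by simp
  qed
  have pow: "(real n + 5) ^ k \<le> 5 ^ k * 6 ^ n" if "(6::real) ^ k \<le> 6 * 5 ^ k" for n k
  proof (induction n)
    case (Suc n)
    have "(real (Suc n) + 5) ^ k = (real n + 6) ^ k" by (simp add: add_ac)
    also have "\<dots> \<le> 6 * (real n + 5) ^ k" by (rule step[OF that])
    also have "\<dots> \<le> 6 * (5 ^ k * 6 ^ n)" using Suc by simp
    finally show ?case by simp
  qed simp
  have geo: "(\<lambda>n. K * (6 * r) ^ n) sums (K * (1 / (1 - 6 * r)))" for K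
    using r by (intro sums_mult geometric_sums) auto
  have geo_le: "K * (1 / (1 - 6 * r)) \<le> K * (230 / 224)" if "K \<ge> 0" for K
    using r that by (intro mult_left_mono) (auto simp: field_simps)
  define t where "t = (\<lambda>n. of_nat (c (n + 5)) * u ^ (n + 4))"
  have c5: "real (c (n + 5)) \<le> (real n + 5) ^ 8" for n
    using of_nat_mono[OF c(2)[of "n + 5"], where 'a = real] by simp
  have t1: "norm (t n) \<le> 5 ^ 8 * r ^ 4 * (6 * r) ^ n" for n
  proof -
    have "norm (t n) = real (c (n + 5)) * r ^ (n + 4)" by (simp add: t_def norm_mult norm_power r_def)
    also have "\<dots> \<le> (5 ^ 8 * 6 ^ n) * r ^ (n + 4)"
      using order.trans[OF c5 pow[of 8]] r by (intro mult_right_mono) auto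
    finally show ?thesis by (simp add: power_add power_mult_distrib mult_ac)
  qed
  have t2: "norm (Im (t n)) \<le> 5 ^ 9 * r ^ 3 * \<bar>Im u\<bar> * (6 * r) ^ n" for n
  proof -
    have "norm (Im (t n)) = real (c (n + 5)) * \<bar>Im (u ^ Suc (n + 3))\<bar>"
      by (simp add: t_def abs_mult eval_nat_numeral)
    also have "\<dots> \<le> real (c (n + 5)) * (\<bar>Im u\<bar> * (real (Suc (n + 3)) * r ^ (n + 3)))"
      using im_bounded_power[of u "n + 3"] unfolding im_bounded_def r_def by (intro mult_left_mono) auto
    also have "\<dots> \<le> (real n + 5) ^ 8 * (\<bar>Im u\<bar> * ((real n + 5) * r ^ (n + 3)))"
      using c5 r by (intro mult_mono) auto
    also have "\<dots> = (real n + 5) ^ 9 * (\<bar>Im u\<bar> * r ^ (n + 3))"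
      by (simp add: eval_nat_numeral mult_ac)
    also have "\<dots> \<le> (5 ^ 9 * 6 ^ n) * (\<bar>Im u\<bar> * r ^ (n + 3))"
      using pow[of 9] r by (intro mult_right_mono) auto
    finally show ?thesis by (simp add: power_add power_mult_distrib mult_ac)
  qed
  have sn: "summable (\<lambda>n. norm (t n))"
    by (rule summable_comparison_test'[OF sums_summable[OF geo]]) (use t1 in simp)
  then have st: "t sums suminf t" using summable_norm_cancel by blast
  have sI: "summable (\<lambda>n. norm (Im (t n)))"
    by (rule summable_comparison_test'[OF sums_summable[OF geo]]) (use t2 in simp)
  have b1: "norm (suminf t) \<le> 403000 * r ^ 4"
  proof -
    have "norm (suminf t) \<le> (\<Sum>n. norm (t n))" by (rule summable_norm[OF sn])
    also have "\<dots> \<le> 5 ^ 8 * r ^ 4 * (1 / (1 - 6 * r))"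
      by (rule sums_le[OF t1 summable_sums[OF sn] geo])
    also have "\<dots> \<le> 5 ^ 8 * r ^ 4 * (230 / 224)" by (rule geo_le) (use r in auto)
    also have "\<dots> \<le> 403000 * r ^ 4" using zero_le_power[OF r(1), of 4] by simp
    finally show ?thesis .
  qed
  have b2: "\<bar>Im (suminf t)\<bar> \<le> \<bar>Im u\<bar> * (2020000 * r ^ 3)"
  proof -
    have "(\<lambda>n. Im (t n)) sums Im (suminf t)" using st by (rule sums_Im)
    then have "\<bar>Im (suminf t)\<bar> = norm (\<Sum>n. Im (t n))" by (simp add: sums_iff)
    also have "\<dots> \<le> (\<Sum>n. norm (Im (t n)))" by (rule summable_norm[OF sI])
    also have "\<dots> \<le> 5 ^ 9 * r ^ 3 * \<bar>Im u\<bar> * (1 / (1 - 6 * r))"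
      by (rule sums_le[OF t2 summable_sums[OF sI] geo])
    also have "\<dots> \<le> 5 ^ 9 * r ^ 3 * \<bar>Im u\<bar> * (230 / 224)" by (rule geo_le) (use r in auto)
    also have "\<dots> \<le> 2020000 * (r ^ 3 * \<bar>Im u\<bar>)"
      using mult_nonneg_nonneg[OF zero_le_power[OF r(1), of 3] abs_ge_zero[of "Im u"]] by (simp add: mult_ac)
    finally show ?thesis by (simp add: mult_ac)
  qed
  have "(\<lambda>n. u * t n) sums (u * suminf t)" using st by (rule sums_mult)
  then have "(\<lambda>n. of_nat (c (n + 5)) * u ^ (n + 5)) sums (u * suminf t)"
    by (simp add: t_def mult_ac eval_nat_numeral)
  then have "(\<lambda>n. of_nat (c n) * u ^ n) sums (u * suminf t + (\<Sum>n<5. of_nat (c n) * u ^ n))"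
    by (subst (asm) sums_iff_shift)
  then have "powser (\<lambda>n. of_nat (c n)) u = u * suminf t + (\<Sum>n<5. of_nat (c n) * u ^ n)"
    by (simp add: powser_def sums_iff)
  also have "\<dots> = u * (of_nat (c 1) + of_nat (c 2) * u + of_nat (c 3) * u ^ 2 + of_nat (c 4) * u ^ 3 + suminf t)"
    using c(1) by (simp add: eval_nat_numeral algebra_simps)
  finally show ?thesis using b1 b2 by (intro that[of "suminf t"]) (auto simp: im_bounded_def r_def)
qed

text \<open>Each power of r beyond the displayed one is traded for 1/230, which produces the
  constants; for instance 257 >= 244 + 1057/230 + 403000/230^2. The second series is bounded both
  with and without its quadratic term, since that term is needed exactly where c - b^2 is
  formed.\<close>

lemma E6_series_expansion:
  assumes u: "norm u \<le> 1 / 230"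
  defines "r \<equiv> norm u" and "v \<equiv> \<bar>Im u\<bar>"
  obtains \<alpha> \<beta> \<gamma> where
    "sigma_powser 5 u = u * (1 + 33 * u + \<alpha>)" "im_bounded v \<alpha> (257 * r ^ 2) (541 * r)"
    "E6_deriv_series u = u * (1 + 66 * u + (732 * u ^ 2 + \<beta>))" "im_bounded v \<beta> (5981 * r ^ 3) (21467 * r ^ 2)"
    "im_bounded v (732 * u ^ 2 + \<beta>) (759 * r ^ 2) (1558 * r)"
    "E6_deriv2_series u = u * (1 + 132 * u + 2196 * u ^ 2 + \<gamma>)" "im_bounded v \<gamma> (18665 * r ^ 3) (59519 * r ^ 2)"
proof -
  have r: "0 \<le> r" "r \<le> 1 / 230" using u by (auto simp: r_def)
  have v: "v \<ge> 0" by (simp add: v_def)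
  have p: "r ^ Suc n \<le> r ^ n / 230" for n
    using mult_left_mono[OF r(2), of "r ^ n"] r(1) by (simp add: mult.commute)
  have ps: "r ^ 2 \<le> r / 230" "r ^ 3 \<le> r ^ 2 / 230" "r ^ 4 \<le> r ^ 3 / 230" "0 \<le> r ^ 2" "0 \<le> r ^ 3"
    using p[of 1] p[of 2] p[of 3] r by (simp_all add: eval_nat_numeral)
  have sg: "sigma_sum 5 n \<le> n ^ 6" for n using sigma_sum_le[of 5 n] by simp
  have le8: "n ^ 6 \<le> n ^ 8" "n ^ 7 \<le> n ^ 8" for n :: nat
    by (cases "n = 0"; simp add: power_increasing)+
  have pw: "im_bounded v (u ^ 2) (r ^ 2) (2 * r)" "im_bounded v (u ^ 3) (r ^ 3) (3 * r ^ 2)"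
    using im_bounded_power[of u 1] im_bounded_power[of u 2] by (simp_all add: v_def r_def eval_nat_numeral)
  obtain R1 where R1: "powser (\<lambda>n. of_nat (sigma_sum 5 n)) u = u * (of_nat (sigma_sum 5 1) + of_nat (sigma_sum 5 2) * u
      + of_nat (sigma_sum 5 3) * u ^ 2 + of_nat (sigma_sum 5 4) * u ^ 3 + R1)"
      "im_bounded v R1 (403000 * r ^ 4) (2020000 * r ^ 3)"
    unfolding v_def r_def using powser_tail[of "sigma_sum 5" u] order.trans[OF sg le8(1)] u by auto
  obtain R2 where R2: "powser (\<lambda>n. of_nat (n * sigma_sum 5 n)) u = u * (of_nat (1 * sigma_sum 5 1) + of_nat (2 * sigma_sum 5 2) * u
      + of_nat (3 * sigma_sum 5 3) * u ^ 2 + of_nat (4 * sigma_sum 5 4) * u ^ 3 + R2)"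
      "im_bounded v R2 (403000 * r ^ 4) (2020000 * r ^ 3)"
  proof -
    have "n * sigma_sum 5 n \<le> n ^ 8" for n
    proof -
      have "n * sigma_sum 5 n \<le> n * n ^ 6" by (intro mult_left_mono sg) simp
      also have "\<dots> = n ^ 7" by (simp flip: power_Suc)
      finally show ?thesis using le8(2)[of n] by simp
    qed
    then show ?thesis
      unfolding v_def r_def using powser_tail[of "\<lambda>n. n * sigma_sum 5 n" u] u that by (auto simp: v_def r_def)
  qed
  obtain R3 where R3: "powser (\<lambda>n. of_nat (n * (n * sigma_sum 5 n))) u = u * (of_nat (1 * (1 * sigma_sum 5 1)) + of_nat (2 * (2 * sigma_sum 5 2)) * u
      + of_nat (3 * (3 * sigma_sum 5 3)) * u ^ 2 + of_nat (4 * (4 * sigma_sum 5 4)) * u ^ 3 + R3)"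
      "im_bounded v R3 (403000 * r ^ 4) (2020000 * r ^ 3)"
  proof -
    have "n * (n * sigma_sum 5 n) \<le> n ^ 8" for n
      using mult_left_mono[OF sg[of n], of "n * n"] by (simp add: eval_nat_numeral mult_ac)
    then show ?thesis
      unfolding v_def r_def using powser_tail[of "\<lambda>n. n * (n * sigma_sum 5 n)" u] u that by (auto simp: v_def r_def)
  qed
  show ?thesis
  proof (rule that[of "244 * u ^ 2 + 1057 * u ^ 3 + R1" "4228 * u ^ 3 + R2" "16912 * u ^ 3 + R3"])
    show "sigma_powser 5 u = u * (1 + 33 * u + (244 * u ^ 2 + 1057 * u ^ 3 + R1))"
      unfolding R1(1) sigma_sum_5_values by (simp add: algebra_simps)
    show "E6_deriv_series u = u * (1 + 66 * u + (732 * u ^ 2 + (4228 * u ^ 3 + R2)))"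
      unfolding E6_deriv_series_def using R2(1) unfolding sigma_sum_5_values by (simp add: algebra_simps)
    show "E6_deriv2_series u = u * (1 + 132 * u + 2196 * u ^ 2 + (16912 * u ^ 3 + R3))"
      using R3(1) unfolding sigma_sum_5_values by (simp add: algebra_simps)
    have "im_bounded v (of_real 244 * u ^ 2 + of_real 1057 * u ^ 3 + R1)
        (244 * r ^ 2 + 1057 * r ^ 3 + 403000 * r ^ 4) (244 * (2 * r) + 1057 * (3 * r ^ 2) + 2020000 * r ^ 3)"
      by (intro im_bounded_add im_bounded_cmult pw R1) auto
    then have "im_bounded v (of_real 244 * u ^ 2 + of_real 1057 * u ^ 3 + R1) (257 * r ^ 2) (541 * r)"
      by (rule im_bounded_mono) ((use ps r v in linarith)+)
    then show "im_bounded v (244 * u ^ 2 + 1057 * u ^ 3 + R1) (257 * r ^ 2) (541 * r)" by simp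
    have "im_bounded v (of_real 4228 * u ^ 3 + R2)
        (4228 * r ^ 3 + 403000 * r ^ 4) (4228 * (3 * r ^ 2) + 2020000 * r ^ 3)"
      by (intro im_bounded_add im_bounded_cmult pw R2) auto
    then have \<beta>: "im_bounded v (of_real 4228 * u ^ 3 + R2) (5981 * r ^ 3) (21467 * r ^ 2)"
      by (rule im_bounded_mono) ((use ps r v in linarith)+)
    then show "im_bounded v (4228 * u ^ 3 + R2) (5981 * r ^ 3) (21467 * r ^ 2)" by simp
    have "im_bounded v (of_real 732 * u ^ 2 + (of_real 4228 * u ^ 3 + R2))
        (732 * r ^ 2 + 5981 * r ^ 3) (732 * (2 * r) + 21467 * r ^ 2)"
      by (intro im_bounded_add im_bounded_cmult pw \<beta>) auto
    then have "im_bounded v (of_real 732 * u ^ 2 + (of_real 4228 * u ^ 3 + R2)) (759 * r ^ 2) (1558 * r)"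
      by (rule im_bounded_mono) ((use ps r v in linarith)+)
    then show "im_bounded v (732 * u ^ 2 + (4228 * u ^ 3 + R2)) (759 * r ^ 2) (1558 * r)" by simp
    have "im_bounded v (of_real 16912 * u ^ 3 + R3)
        (16912 * r ^ 3 + 403000 * r ^ 4) (16912 * (3 * r ^ 2) + 2020000 * r ^ 3)"
      by (intro im_bounded_add im_bounded_cmult pw R3) auto
    then have "im_bounded v (of_real 16912 * u ^ 3 + R3) (18665 * r ^ 3) (59519 * r ^ 2)"
      by (rule im_bounded_mono) ((use ps r v in linarith)+)
    then show "im_bounded v (16912 * u ^ 3 + R3) (18665 * r ^ 3) (59519 * r ^ 2)" by simp
  qed
qed

section \<open>Bounds for the periodic part of the equivariant function\<close>

text \<open>One has h(\<tau>) = \<tau> + (3 i / pi) \<open>h_quotient\<close> (\<open>nome\<close>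
  \<tau>), so Im h is governed by the real part of this quotient and Re h by its imaginary
  part.\<close>

definition h_quotient :: "complex \<Rightarrow> complex" where
  "h_quotient u = (1 / 504 - sigma_powser 5 u) / E6_deriv_series u"

text \<open>A common factor u is split off: \<open>b\<close> is close to 1, and \<open>w\<close>
  carries the pole 1 / (504 u) at the cusp.\<close>

lemma h_quotient_factors:
  assumes u: "u \<noteq> 0" "norm u \<le> 1 / 230"
  defines "r \<equiv> norm u" and "v \<equiv> \<bar>Im u\<bar>"
  obtains \<alpha> w b where
    "w = 1 / (504 * u) - 1 - 33 * u - \<alpha>" "h_quotient u = w / b" "E6_deriv_series u = u * b"
    "norm (b - 1 - 66 * u) \<le> 759 * r ^ 2" "\<bar>Im b\<bar> \<le> v * (66 + 1558 * r)"
    "norm \<alpha> \<le> 257 * r ^ 2" "\<bar>Im \<alpha>\<bar> \<le> v * (541 * r)"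
    "b \<noteq> 0" "r > 0" "r \<le> 1 / 230" "r ^ 2 \<le> r / 230"
proof -
  have r: "0 < r" "r \<le> 1 / 230" using u by (auto simp: r_def)
  have r2: "r ^ 2 \<le> r / 230"
    using mult_left_mono[OF r(2), of r] r by (simp add: power2_eq_square)
  obtain \<alpha> \<beta> \<gamma> where *: "sigma_powser 5 u = u * (1 + 33 * u + \<alpha>)" "im_bounded v \<alpha> (257 * r ^ 2) (541 * r)"
    "E6_deriv_series u = u * (1 + 66 * u + (732 * u ^ 2 + \<beta>))"
    "im_bounded v (732 * u ^ 2 + \<beta>) (759 * r ^ 2) (1558 * r)"
    by (rule E6_series_expansion[OF u(2), folded r_def v_def]) (rule that)
  define b where "b = 1 + 66 * u + (732 * u ^ 2 + \<beta>)"
  define w where "w = 1 / (504 * u) - 1 - 33 * u - \<alpha>"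
  have "norm (66 * u + (732 * u ^ 2 + \<beta>)) \<le> norm (66 * u) + norm (732 * u ^ 2 + \<beta>)"
    by (rule norm_triangle_ineq)
  then have b1: "norm (b - 1) \<le> 66 * r + 759 * r ^ 2"
    using *(4) by (simp add: b_def im_bounded_def norm_mult r_def)
  have "\<bar>Im b\<bar> \<le> 66 * v + \<bar>Im (732 * u ^ 2 + \<beta>)\<bar>"
    unfolding b_def v_def by simp
  then have b2: "\<bar>Im b\<bar> \<le> v * (66 + 1558 * r)"
    using *(4) by (simp add: im_bounded_def algebra_simps)
  have "norm (b - 1) < 1" using b1 r r2 by linarith
  then have b0: "b \<noteq> 0" by auto
  have "1 / 504 - sigma_powser 5 u = u * w"
    using u(1) by (simp add: *(1) w_def field_simps)
  then have "h_quotient u = w / b"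
    using u(1) by (simp add: h_quotient_def *(3) b_def)
  then show ?thesis
    using *(2,3,4) b0 b2 r r2 by (intro that[of w \<alpha> b]) (auto simp: im_bounded_def w_def b_def)
qed

lemma E6_deriv_series_nonzero:
  assumes "u \<noteq> 0" "norm u \<le> 1 / 230"
  shows "E6_deriv_series u \<noteq> 0"
  by (rule h_quotient_factors[OF assms]) (use assms(1) in auto)

text \<open>Positive arguments are the edge Re \<tau> = 0. The worst case is x = 1/230, where
  230/504 - 1 - 33/230 - 257/230^2 is just above -7/10; division by b >= 1 preserves the
  bound.\<close>

lemma Re_h_quotient_pos_ge:
  assumes "0 < x" "x \<le> 1 / 230"
  shows "Re (h_quotient (of_real x)) \<ge> - 7 / 10"
proof -
  define u where "u = complex_of_real x"
  have u: "u \<noteq> 0" "norm u \<le> 1 / 230" "norm u = x" "\<bar>Im u\<bar> = 0" using assms by (auto simp: u_def)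
  obtain \<alpha> w b
    where *: "w = 1 / (504 * u) - 1 - 33 * u - \<alpha>" "h_quotient u = w / b" "E6_deriv_series u = u * b"
    "norm (b - 1 - 66 * u) \<le> 759 * x ^ 2" "\<bar>Im b\<bar> \<le> 0 * (66 + 1558 * x)"
    "norm \<alpha> \<le> 257 * x ^ 2" "\<bar>Im \<alpha>\<bar> \<le> 0 * (541 * x)"
    "b \<noteq> 0" "x > 0" "x \<le> 1 / 230" "x ^ 2 \<le> x / 230"
    by (rule h_quotient_factors[OF u(1,2), unfolded u(3,4)]) (rule that)
  have b: "b = of_real (Re b)" using *(5) by (simp add: complex_eq_iff)
  have "Re b \<ge> 1 + 66 * x - 759 * x ^ 2"
    using abs_Re_le_cmod[of "b - 1 - 66 * u"] *(4) by (simp add: u_def)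
  then have b1: "Re b \<ge> 1" using *(11) assms by linarith
  have iu: "1 / (504 * u) = of_real (1 / (504 * x))" by (simp add: u_def)
  have "Re w = 1 / (504 * x) - 1 - 33 * x - Re \<alpha>"
    unfolding *(1) iu by (simp add: u_def)
  moreover have "Re \<alpha> \<le> 257 * x ^ 2" using *(6) abs_Re_le_cmod[of \<alpha>] by linarith
  moreover have "1 / (504 * x) \<ge> 230 / 504" using assms by (simp add: field_simps)
  ultimately have w: "Re w \<ge> - 7 / 10" using *(11) assms by linarith
  have "Re (w / b) = Re w / Re b" by (subst b) (simp only: Re_divide_of_real)
  also have "\<dots> \<ge> - 7 / 10" using w b1 by (simp add: field_simps)
  finally show ?thesis unfolding *(2)[symmetric] u_def .
qed

text \<open>Negative arguments are the edge Re \<tau> = 1/2. The number 85/100 is below 1 - 33/230 -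
  257/230^2, and as 0 < b <= 1 here, division by b can only lower a negative value.\<close>

lemma Re_h_quotient_neg_le:
  assumes "0 < x" "x \<le> 1 / 230"
  shows "Re (h_quotient (- of_real x)) \<le> - (1 / (504 * x) + 85 / 100)"
proof -
  define u where "u = - complex_of_real x"
  have u: "u \<noteq> 0" "norm u \<le> 1 / 230" "norm u = x" "\<bar>Im u\<bar> = 0" using assms by (auto simp: u_def)
  obtain \<alpha> w b
    where *: "w = 1 / (504 * u) - 1 - 33 * u - \<alpha>" "h_quotient u = w / b" "E6_deriv_series u = u * b"
    "norm (b - 1 - 66 * u) \<le> 759 * x ^ 2" "\<bar>Im b\<bar> \<le> 0 * (66 + 1558 * x)"
    "norm \<alpha> \<le> 257 * x ^ 2" "\<bar>Im \<alpha>\<bar> \<le> 0 * (541 * x)"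
    "b \<noteq> 0" "x > 0" "x \<le> 1 / 230" "x ^ 2 \<le> x / 230"
    by (rule h_quotient_factors[OF u(1,2), unfolded u(3,4)]) (rule that)
  have b: "b = of_real (Re b)" using *(5) by (simp add: complex_eq_iff)
  have "\<bar>Re b - 1 + 66 * x\<bar> \<le> 759 * x ^ 2"
    using abs_Re_le_cmod[of "b - 1 - 66 * u"] *(4) by (simp add: u_def)
  then have b1: "0 < Re b" "Re b \<le> 1" using *(11) assms by linarith+
  have iu: "1 / (504 * u) = of_real (- (1 / (504 * x)))" by (simp add: u_def)
  have "Re w = - (1 / (504 * x)) - 1 + 33 * x - Re \<alpha>"
    unfolding *(1) iu by (simp add: u_def)
  moreover have "- Re \<alpha> \<le> 257 * x ^ 2" using *(6) abs_Re_le_cmod[of \<alpha>] by linarith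
  ultimately have w: "Re w \<le> - (1 / (504 * x) + 85 / 100)" using *(11) assms by linarith
  have "1 / (504 * x) > 0" using assms by simp
  then have "Re w < 0" using w by linarith
  have "Re (w / b) = Re w / Re b" by (subst b) (simp only: Re_divide_of_real)
  also have "\<dots> \<le> Re w"
    using mult_left_mono_neg[OF b1(2), of "Re w"] \<open>Re w < 0\<close> b1 by (simp add: field_simps)
  finally show ?thesis using w unfolding *(2)[symmetric] u_def by linarith
qed

text \<open>A crude form of the pole at the cusp, which serves the growth of h high up in the half
  strip.\<close>

lemma norm_h_quotient_ge:
  assumes "u \<noteq> 0" "norm u \<le> 1 / 230"
  shows "norm (h_quotient u) \<ge> (1 / (504 * norm u) - 6 / 5) / (27 / 20)"
proof -
  define r where "r = norm u"
  obtain \<alpha> w b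
    where *: "w = 1 / (504 * u) - 1 - 33 * u - \<alpha>" "h_quotient u = w / b" "E6_deriv_series u = u * b"
    "norm (b - 1 - 66 * u) \<le> 759 * r ^ 2" "\<bar>Im b\<bar> \<le> \<bar>Im u\<bar> * (66 + 1558 * r)"
    "norm \<alpha> \<le> 257 * r ^ 2" "\<bar>Im \<alpha>\<bar> \<le> \<bar>Im u\<bar> * (541 * r)"
    "b \<noteq> 0" "r > 0" "r \<le> 1 / 230" "r ^ 2 \<le> r / 230"
    by (rule h_quotient_factors[OF assms(1,2), folded r_def]) (rule that)
  have "norm b = norm (1 + 66 * u + (b - 1 - 66 * u))" by simp
  also have "\<dots> \<le> norm (1 + 66 * u) + norm (b - 1 - 66 * u)" by (rule norm_triangle_ineq)
  also have "norm (1 + 66 * u) \<le> 1 + norm (66 * u)" using norm_triangle_ineq[of 1 "66 * u"] by simp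
  finally have b: "norm b \<le> 27 / 20" using * by (simp add: norm_mult r_def[symmetric])
  have "1 / (504 * u) = w + (1 + 33 * u + \<alpha>)" by (simp add: *(1))
  then have "norm (1 / (504 * u)) \<le> norm w + norm (1 + 33 * u + \<alpha>)" by (simp only: norm_triangle_ineq)
  also have "norm (1 + 33 * u + \<alpha>) \<le> norm (1 + 33 * u) + norm \<alpha>" by (rule norm_triangle_ineq)
  also have "norm (1 + 33 * u) \<le> 1 + norm (33 * u)" using norm_triangle_ineq[of 1 "33 * u"] by simp
  finally have w: "1 / (504 * r) - 6 / 5 \<le> norm w"
    using * by (simp add: norm_mult norm_divide r_def[symmetric])
  have "(1 / (504 * r) - 6 / 5) / (27 / 20) \<le> norm w / (27 / 20)"
    using w by (intro divide_right_mono) auto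
  also have "\<dots> \<le> norm w / norm b"
    using b *(8) by (intro divide_left_mono) auto
  finally show ?thesis by (simp add: *(2) norm_divide r_def)
qed

text \<open>The constant has to stay below pi / 3 for the sake of Re h > -1. Since Im w <= 0, only
  -Re w Im b can be positive, and there the pole of w is compensated by |Im b| = O(|u|).\<close>

lemma Im_h_quotient_less:
  assumes "u \<noteq> 0" "norm u \<le> 1 / 230" "Im u \<ge> 0"
  shows "Im (h_quotient u) < 1045 / 1000"
proof -
  define r where "r = norm u"
  define v where "v = Im u"
  have v: "\<bar>Im u\<bar> = v" "0 \<le> v" "v \<le> r" using assms(3) abs_Im_le_cmod[of u] by (simp_all add: v_def r_def)
  obtain \<alpha> w b
    where *: "w = 1 / (504 * u) - 1 - 33 * u - \<alpha>" "h_quotient u = w / b" "E6_deriv_series u = u * b"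
    "norm (b - 1 - 66 * u) \<le> 759 * r ^ 2" "\<bar>Im b\<bar> \<le> v * (66 + 1558 * r)"
    "norm \<alpha> \<le> 257 * r ^ 2" "\<bar>Im \<alpha>\<bar> \<le> v * (541 * r)"
    "b \<noteq> 0" "r > 0" "r \<le> 1 / 230" "r ^ 2 \<le> r / 230"
    by (rule h_quotient_factors[OF assms(1,2), folded r_def, unfolded v(1)]) (rule that)
  have "norm (b - 1) \<le> norm (66 * u) + norm (b - 1 - 66 * u)"
    using norm_triangle_ineq[of "66 * u" "b - 1 - 66 * u"] by simp
  then have "norm (b - 1) \<le> 66 * r + 759 * r ^ 2"
    using *(4) by (simp add: norm_mult r_def)
  then have "norm (b - 1) \<le> 66 / 230 + 759 / 230 / 230" using *(10,11) by linarith
  moreover have "Re b \<ge> 1 - norm (b - 1)" using abs_Re_le_cmod[of "b - 1"] by simp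
  ultimately have Reb: "Re b \<ge> 6986 / 10000" by linarith
  then have nb: "norm b ^ 2 \<ge> (6986 / 10000) ^ 2"
    using abs_Re_le_cmod[of b] by (intro power_mono) auto
  have iu: "1 / (504 * u) = of_real (1 / 504) * (cnj u / of_real (r ^ 2))"
    using assms(1) complex_norm_square[of u] by (simp add: r_def divide_simps)
  have Imw: "Im w = - (v / (504 * r ^ 2)) - 33 * v - Im \<alpha>"
    unfolding *(1) iu by (simp add: v_def Im_divide_of_real)
  have "v * (541 * r) \<le> v * 33" using *(10) v by (intro mult_left_mono) auto
  moreover have "v / (504 * r ^ 2) \<ge> 0" using v by simp
  ultimately have Imw0: "Im w \<le> 0" using *(7) unfolding Imw by linarith
  have "norm w = norm (1 / (504 * u) - (1 + 33 * u + \<alpha>))" by (simp add: *(1) algebra_simps)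
  also have "\<dots> \<le> norm (1 / (504 * u)) + norm (1 + 33 * u + \<alpha>)" by (rule norm_triangle_ineq4)
  also have "norm (1 + 33 * u + \<alpha>) \<le> norm (1 + 33 * u) + norm \<alpha>" by (rule norm_triangle_ineq)
  also have "norm (1 + 33 * u) \<le> 1 + norm (33 * u)" using norm_triangle_ineq[of 1 "33 * u"] by simp
  finally have "norm w \<le> 1 / (504 * r) + (1 + 33 * r + 257 * r ^ 2)"
    using *(6) by (simp add: norm_mult norm_divide r_def[symmetric])
  then have "norm w \<le> 1 / (504 * r) + (1 + 33 / 230 + 257 / 230 / 230)"
    using *(10,11) by linarith
  then have "r * norm w \<le> r * (1 / (504 * r) + (1 + 33 / 230 + 257 / 230 / 230))"
    using *(9) by (intro mult_left_mono) auto
  also have "\<dots> = 1 / 504 + r * (1 + 33 / 230 + 257 / 230 / 230)" using *(9) by (simp add: field_simps)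
  also have "\<dots> \<le> 1 / 504 + 1 / 230 * (1 + 33 / 230 + 257 / 230 / 230)"
    using *(10) by (intro add_left_mono mult_right_mono) auto
  finally have rw: "r * norm w \<le> 698 / 100000" by simp
  have "\<bar>Im b\<bar> \<le> r * (66 + 1558 * r)"
    by (rule order.trans[OF *(5) mult_right_mono[OF v(3)]]) (use *(9) in simp)
  also have "\<dots> \<le> r * (728 / 10)" using *(9,10) by (intro mult_left_mono) auto
  finally have "\<bar>Re w\<bar> * \<bar>Im b\<bar> \<le> norm w * (r * (728 / 10))"
    using abs_Re_le_cmod[of w] by (intro mult_mono) auto
  also have "\<dots> \<le> 698 / 100000 * (728 / 10)" using rw by simp
  finally have RI: "\<bar>Re w\<bar> * \<bar>Im b\<bar> \<le> 5082 / 10000" by simp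
  have "Im w * Re b \<le> 0" using Imw0 Reb by (intro mult_nonpos_nonneg) auto
  then have "Im w * Re b - Re w * Im b \<le> 5082 / 10000"
    using RI abs_ge_minus_self[of "Re w * Im b"] by (simp add: abs_mult)
  also have "\<dots> < 1045 / 1000 * (6986 / 10000) ^ 2" by (simp add: power2_eq_square)
  also have "\<dots> \<le> 1045 / 1000 * norm b ^ 2" using nb by (intro mult_left_mono) auto
  finally have "(Im w * Re b - Re w * Im b) / norm b ^ 2 < 1045 / 1000"
    using *(8) by (simp add: divide_less_eq)
  then show ?thesis by (simp add: *(2) Im_divide cmod_power2)
qed

text \<open>Writing the three series as \<open>u b\<close>, \<open>u c\<close> and \<open>1/504 - u w\<close>, the quantity is \<open>w c / b\<^sup>2\<close>.
  The linear terms of \<open>c\<close> and \<open>b\<^sup>2\<close> agree, so \<open>c / b\<^sup>2\<close> is nearly real; its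
  leading imaginary part is that of \<open>- 3624 u\<^sup>2\<close>, which is harmless exactly where \<open>\<bar>b\<bar>\<close> is small.\<close>

lemma Im_second_quotient_neg:
  assumes u: "norm u \<le> 1 / 230" "Im u > 0"
  shows "Im ((1 / 504 - sigma_powser 5 u) * E6_deriv2_series u / E6_deriv_series u ^ 2) < 0"
proof -
  define r where "r = norm u"
  define v where "v = Im u"
  have u0: "u \<noteq> 0" using u by auto
  have v: "\<bar>Im u\<bar> = v" "0 < v" "v \<le> r" using u(2) abs_Im_le_cmod[of u] by (simp_all add: v_def r_def)
  have r: "0 < r" "r \<le> 1 / 230" using u u0 by (auto simp: r_def)
  have p: "r ^ Suc n \<le> r ^ n / 230" for n
    using mult_left_mono[OF r(2), of "r ^ n"] r(1) by (simp add: mult.commute)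
  have ps: "r ^ 2 \<le> r / 230" "r ^ 3 \<le> r ^ 2 / 230" "r ^ 4 \<le> r ^ 3 / 230" "0 \<le> r ^ 2" "0 \<le> r ^ 3"
    using p[of 1] p[of 2] p[of 3] r by (simp_all add: eval_nat_numeral)
  have pw: "im_bounded v (u ^ 3) (r ^ 3) (3 * r ^ 2)" "im_bounded v u r 1"
    using im_bounded_power[of u 2] im_bounded_power[of u 0] v(1)
    by (simp_all add: r_def eval_nat_numeral)
  obtain \<alpha> \<beta> \<gamma> where *: "sigma_powser 5 u = u * (1 + 33 * u + \<alpha>)" "im_bounded v \<alpha> (257 * r ^ 2) (541 * r)"
    "E6_deriv_series u = u * (1 + 66 * u + (732 * u ^ 2 + \<beta>))" "im_bounded v \<beta> (5981 * r ^ 3) (21467 * r ^ 2)"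
    "im_bounded v (732 * u ^ 2 + \<beta>) (759 * r ^ 2) (1558 * r)"
    "E6_deriv2_series u = u * (1 + 132 * u + 2196 * u ^ 2 + \<gamma>)" "im_bounded v \<gamma> (18665 * r ^ 3) (59519 * r ^ 2)"
    by (rule E6_series_expansion[OF u(1), folded r_def, unfolded v(1)]) (rule that)
  define B where "B = 732 * u ^ 2 + \<beta>"
  define b where "b = 1 + 66 * u + B"
  define c where "c = 1 + 132 * u + 2196 * u ^ 2 + \<gamma>"
  define w where "w = 1 / (504 * u) - 1 - 33 * u - \<alpha>"
  \<comment> \<open>What remains of c - b^2 beyond the quadratic term. The constant and linear terms
    cancel, 2196 - 66^2 - 2 * 732 = -3624, and 96624 = 132 * 732.\<close>
  define d3 where "d3 = \<gamma> - of_real 2 * \<beta> - of_real 96624 * u ^ 3 - of_real 132 * (u * \<beta>) - B * B"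
  define d where "d = c - b ^ 2"
  define n where "n = norm b"
  have d: "d = - 3624 * u ^ 2 + d3"
    unfolding d_def c_def b_def d3_def B_def by (simp add: eval_nat_numeral algebra_simps)
  have B: "im_bounded v B (759 * r ^ 2) (1558 * r)" using *(5) by (simp add: B_def)
  have "im_bounded v d3
      (18665 * r ^ 3 + 2 * (5981 * r ^ 3) + 96624 * r ^ 3 + 132 * (r * (5981 * r ^ 3)) + 759 * r ^ 2 * (759 * r ^ 2))
      (59519 * r ^ 2 + 2 * (21467 * r ^ 2) + 96624 * (3 * r ^ 2) + 132 * (r * (21467 * r ^ 2) + 1 * (5981 * r ^ 3))
        + (759 * r ^ 2 * (1558 * r) + 1558 * r * (759 * r ^ 2)))"
    unfolding d3_def using r v by (intro im_bounded_diff im_bounded_cmult im_bounded_mult pw B *) auto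
  then have "im_bounded v d3 (580 * r ^ 2) (1819 * r)"
  proof (rule im_bounded_mono)
    have "r * (5981 * r ^ 3) = 5981 * r ^ 4" "759 * r ^ 2 * (759 * r ^ 2) = 576081 * r ^ 4"
      by (simp_all add: eval_nat_numeral)
    then show "18665 * r ^ 3 + 2 * (5981 * r ^ 3) + 96624 * r ^ 3 + 132 * (r * (5981 * r ^ 3)) + 759 * r ^ 2 * (759 * r ^ 2) \<le> 580 * r ^ 2"
      using ps r by linarith
    have "59519 * r ^ 2 + 2 * (21467 * r ^ 2) + 96624 * (3 * r ^ 2) + 132 * (r * (21467 * r ^ 2) + 1 * (5981 * r ^ 3))
        + (759 * r ^ 2 * (1558 * r) + 1558 * r * (759 * r ^ 2)) = 392325 * r ^ 2 + 5988180 * r ^ 3"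
      by (simp add: eval_nat_numeral)
    also have "\<dots> \<le> 1819 * r" using ps r by linarith
    finally show "59519 * r ^ 2 + 2 * (21467 * r ^ 2) + 96624 * (3 * r ^ 2) + 132 * (r * (21467 * r ^ 2) + 1 * (5981 * r ^ 3))
        + (759 * r ^ 2 * (1558 * r) + 1558 * r * (759 * r ^ 2)) \<le> 1819 * r" .
  qed (use v in auto)
  then have d3: "norm d3 \<le> 580 * r ^ 2" "\<bar>Im d3\<bar> \<le> v * (1819 * r)" by (auto simp: im_bounded_def)
  have nB: "norm B \<le> 759 * r ^ 2" "\<bar>Im B\<bar> \<le> v * (1558 * r)" using B by (auto simp: im_bounded_def)
  have "norm d \<le> norm (- 3624 * u ^ 2) + norm d3" unfolding d by (rule norm_triangle_ineq)
  then have nd: "norm d \<le> 4204 * r ^ 2" using d3 by (simp add: norm_mult norm_power r_def)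
  have nd': "norm d \<le> 795 / 10000" using nd ps r by linarith
  have "norm (1 + 66 * u) \<ge> 1 - norm (66 * u)" using norm_triangle_ineq2[of 1 "- 66 * u"] by simp
  moreover have n1: "n \<ge> norm (1 + 66 * u) - norm B" unfolding n_def b_def using norm_triangle_ineq2[of "1 + 66 * u" "- B"] by simp
  ultimately have n: "n \<ge> 698 / 1000" using nB ps r by (simp add: norm_mult r_def[symmetric])
  have b0: "b \<noteq> 0" using n by (auto simp: n_def)

  \<comment> \<open>Multiplication by the square of \<open>cnj b\<close> makes the denominator n^4.
    Then Y is n^4 up to a small error, whose leading part is -3624 P^2.\<close>
  define Y where "Y = c * cnj b ^ 2"
  define P where "P = u * cnj b"
  have bc: "b * cnj b = of_real (n ^ 2)" using complex_norm_square[of b] by (simp add: n_def)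
  have Y: "Y = of_real (n ^ 4) + d * cnj b ^ 2"
  proof -
    have "Y = (b * cnj b) ^ 2 + d * cnj b ^ 2" by (simp add: Y_def d_def algebra_simps power2_eq_square)
    then show ?thesis unfolding bc by (simp flip: of_real_power power_mult)
  qed
  have "\<bar>Re (d * cnj b ^ 2)\<bar> \<le> norm d * n ^ 2"
    using abs_Re_le_cmod[of "d * cnj b ^ 2"] by (simp add: norm_mult norm_power n_def)
  also have "\<dots> \<le> 795 / 10000 * n ^ 2" using nd' by (intro mult_right_mono) auto
  finally have ReD: "\<bar>Re (d * cnj b ^ 2)\<bar> \<le> 795 / 10000 * n ^ 2" .
  have "Re Y = n ^ 4 + Re (d * cnj b ^ 2)" unfolding Y by (simp only: plus_complex.sel Re_complex_of_real)
  then have ReY: "Re Y \<ge> n ^ 4 - 795 / 10000 * n ^ 2" using ReD by linarith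
  have Imb: "\<bar>Im b\<bar> \<le> v * (728 / 10)"
  proof -
    have "\<bar>Im b\<bar> \<le> 66 * v + v * (1558 * r)" unfolding b_def using nB v by (simp add: v_def)
    also have "v * (1558 * r) \<le> v * (68 / 10)" using r v by (intro mult_left_mono) auto
    finally show ?thesis by simp
  qed
  have E: "\<bar>Im (d3 * cnj b ^ 2)\<bar> \<le> v * r * (n * (1819 * n + 368))"
  proof -
    have "im_bounded v (cnj b) n (728 / 10)" using Imb by (simp add: im_bounded_def n_def)
    then have "im_bounded v (d3 * (cnj b * cnj b)) (580 * r ^ 2 * (n * n))
        (580 * r ^ 2 * (n * (728 / 10) + 728 / 10 * n) + 1819 * r * (n * n))"
      using d3 r v n by (intro im_bounded_mult) (auto simp: im_bounded_def)
    then have "\<bar>Im (d3 * cnj b ^ 2)\<bar> \<le> v * (580 * r ^ 2 * (n * (728 / 10) + 728 / 10 * n) + 1819 * r * (n * n))"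
      by (simp add: im_bounded_def power2_eq_square)
    also have "580 * r ^ 2 * (n * (728 / 10) + 728 / 10 * n) = 84448 * r ^ 2 * n" by simp
    also have "84448 * r ^ 2 * n \<le> 368 * r * n" using ps n by (intro mult_right_mono) auto
    finally show ?thesis using v by (simp add: algebra_simps mult_left_mono)
  qed
  have ImP: "\<bar>Im P - v\<bar> \<le> 439 / 10000 * v" and ReP: "Re P \<le> Re u + 66 * r ^ 2 + 759 * r ^ 3"
  proof -
    have uu: "u * cnj u = of_real (r ^ 2)" using complex_norm_square[of u] by (simp add: r_def)
    \<comment> \<open>The linear term of b contributes the real number 66 r^2, so Im P stays within
      5 percent of v.\<close>
    have P: "P = u + 66 * (u * cnj u) + u * cnj B" by (simp add: P_def b_def algebra_simps)
    have "im_bounded v (u * cnj B) (r * (759 * r ^ 2)) (r * (1558 * r) + 1 * (759 * r ^ 2))"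
      using B r v pw(2) by (intro im_bounded_mult) (auto simp: im_bounded_def)
    then have "im_bounded v (u * cnj B) (759 * r ^ 3) (439 / 10000)"
    proof (rule im_bounded_mono)
      have "r * (1558 * r) = 1558 * r ^ 2" by (simp add: power2_eq_square)
      then show "r * (1558 * r) + 1 * (759 * r ^ 2) \<le> 439 / 10000" using ps r by linarith
    qed (use v in \<open>auto simp: eval_nat_numeral\<close>)
    then have 1: "\<bar>Im (u * cnj B)\<bar> \<le> v * (439 / 10000)" "norm (u * cnj B) \<le> 759 * r ^ 3"
      by (auto simp: im_bounded_def)
    have "Im P = v + Im (u * cnj B)" unfolding P uu by (simp add: v_def)
    then show "\<bar>Im P - v\<bar> \<le> 439 / 10000 * v" using 1 by simp
    have "Re P = Re u + 66 * r ^ 2 + Re (u * cnj B)" unfolding P uu by simp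
    then show "Re P \<le> Re u + 66 * r ^ 2 + 759 * r ^ 3" using 1(2) abs_Re_le_cmod[of "u * cnj B"] by linarith
  qed
  have nP: "\<bar>Re P\<bar> \<le> r * n" using abs_Re_le_cmod[of P] by (simp add: P_def norm_mult r_def n_def)
  have ImY: "Im Y = - 7248 * (Re P * Im P) + Im (d3 * cnj b ^ 2)"
  proof -
    have "d * cnj b ^ 2 = - 3624 * P ^ 2 + d3 * cnj b ^ 2" by (simp add: d P_def algebra_simps power2_eq_square)
    then show ?thesis unfolding Y by (simp add: Im_power2)
  qed

  have iu: "1 / (504 * u) = of_real (1 / 504) * (cnj u / of_real (r ^ 2))"
    using u0 complex_norm_square[of u] by (simp add: r_def divide_simps)
  have na: "norm \<alpha> \<le> 257 * r ^ 2" "\<bar>Im \<alpha>\<bar> \<le> v * (541 * r)" using *(2) by (auto simp: im_bounded_def)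
  \<comment> \<open>The pole contributes at least 104.95 v and the linear term 33 v; the remainder
    takes back at most 2.4 v.\<close>
  have Imw: "- Im w \<ge> v * (1355 / 10)"
  proof -
    have "Im w = - (v / (504 * r ^ 2)) - 33 * v - Im \<alpha>"
      unfolding w_def iu by (simp add: v_def Im_divide_of_real)
    moreover have "v * (541 * r) \<le> v * (24 / 10)" using r v by (intro mult_left_mono) auto
    moreover have "v * (10495 / 100) \<le> v / (504 * r ^ 2)"
    proof -
      have "(230 * r) ^ 2 \<le> 1 ^ 2" using r by (intro power_mono) auto
      then have "10495 / 100 \<le> 1 / (504 * r ^ 2)" using r by (simp add: field_simps)
      from mult_left_mono[OF this, of v] show ?thesis using v by simp
    qed
    moreover have "\<bar>Im \<alpha>\<bar> \<le> v * (541 * r)" by (rule na)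
    ultimately show ?thesis by linarith
  qed
  have Rew: "\<bar>Re w\<bar> * r \<le> 7 / 1000"
  proof -
    have "norm w = norm (1 / (504 * u) - (1 + 33 * u + \<alpha>))" by (simp add: w_def algebra_simps)
    also have "\<dots> \<le> norm (1 / (504 * u)) + norm (1 + 33 * u + \<alpha>)" by (rule norm_triangle_ineq4)
    also have "norm (1 + 33 * u + \<alpha>) \<le> norm (1 + 33 * u) + norm \<alpha>" by (rule norm_triangle_ineq)
    also have "norm (1 + 33 * u) \<le> 1 + norm (33 * u)" using norm_triangle_ineq[of 1 "33 * u"] by simp
    finally have "norm w \<le> 1 / (504 * r) + (1 + 33 * r + 257 * r ^ 2)"
      using na by (simp add: norm_mult norm_divide r_def[symmetric])
    also have "\<dots> \<le> 1 / (504 * r) + 115 / 100" using r ps by (intro add_left_mono) linarith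
    finally have "\<bar>Re w\<bar> * r \<le> (1 / (504 * r) + 115 / 100) * r"
      using abs_Re_le_cmod[of w] r by (intro mult_right_mono) auto
    also have "\<dots> = 1 / 504 + 115 / 100 * r" using r by (simp add: field_simps)
    also have "\<dots> \<le> 1 / 504 + 115 / 100 * (1 / 230)" using r by (intro add_left_mono mult_left_mono) auto
    finally show ?thesis by simp
  qed
  have E': "\<bar>Re w * Im (d3 * cnj b ^ 2)\<bar> \<le> v * (7 / 1000 * (n * (1819 * n + 368)))"
  proof -
    have "\<bar>Re w * Im (d3 * cnj b ^ 2)\<bar> \<le> \<bar>Re w\<bar> * (v * r * (n * (1819 * n + 368)))"
      unfolding abs_mult using E by (intro mult_left_mono) auto
    also have "\<dots> = (\<bar>Re w\<bar> * r) * (v * (n * (1819 * n + 368)))" by simp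
    also have "\<dots> \<le> 7 / 1000 * (v * (n * (1819 * n + 368)))"
      using Rew v n by (intro mult_right_mono) auto
    finally show ?thesis by simp
  qed
  have ReY0: "n ^ 4 - 795 / 10000 * n ^ 2 = n * (n * (n ^ 2 - 795 / 10000))" by (simp add: eval_nat_numeral algebra_simps)
  have nn: "n ^ 2 \<ge> (698 / 1000) ^ 2" using n by (intro power_mono) auto
  have "n ^ 4 - 795 / 10000 * n ^ 2 \<ge> 0"
    unfolding ReY0 using n nn by (intro mult_nonneg_nonneg) (auto simp: power2_eq_square)
  then have "v * (1355 / 10) * (n ^ 4 - 795 / 10000 * n ^ 2) \<le> - Im w * Re Y"
    using Imw ReY v by (intro mult_mono) auto
  then have main: "v * n * (1355 / 10 * (n * (n ^ 2 - 795 / 10000))) \<le> - Im w * Re Y"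
    unfolding ReY0 by (simp add: mult_ac)
  have "x * (- 7248 * y + z) = - 7248 * (x * y) + x * z" for x y z :: real by (simp add: algebra_simps)
  then have RI: "Re w * Im Y = - 7248 * (Re w * (Re P * Im P)) + Re w * Im (d3 * cnj b ^ 2)" unfolding ImY .
  have ImwY: "- Im (w * Y) = - Im w * Re Y - Re w * Im Y" by simp
  have vn: "v * n > 0" using v n by simp
  have "Im (w * Y) < 0"
  \<comment> \<open>In the left sector |b| may be as small as 0.698, but Re w and Re P are both
    nonpositive and the term with 7248 has the favourable sign. Elsewhere |b| >= 0.877, and its
    absolute value can be afforded.\<close>
  proof (cases "Re u \<le> - r / 2")
    case True
    have "Re w = Re u / (504 * r ^ 2) - 1 - 33 * Re u - Re \<alpha>"
      unfolding w_def iu by (simp add: Re_divide_of_real)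
    moreover have "Re u / (504 * r ^ 2) \<le> 33 * Re u"
    proof -
      have "(230 * r) ^ 2 \<le> 1 ^ 2" using r by (intro power_mono) auto
      then have "1 / (504 * r ^ 2) \<ge> 33" using r by (simp add: field_simps)
      from mult_left_mono_neg[OF this, of "Re u"] show ?thesis using True r by (simp add: mult.commute)
    qed
    moreover have "- Re \<alpha> \<le> 257 * r ^ 2" using na abs_Re_le_cmod[of \<alpha>] by linarith
    ultimately have "Re w \<le> 0" using r ps by linarith
    moreover have "Re P \<le> 0" using ReP True r ps by linarith
    moreover have "Im P \<ge> 0" using ImP v by linarith
    ultimately have "Re w * (Re P * Im P) \<ge> 0" by (intro mult_nonpos_nonpos mult_nonpos_nonneg) auto
    then have "- (Re w * Im Y) \<ge> - (v * (7 / 1000 * (n * (1819 * n + 368))))"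
      unfolding RI using E' by linarith
    moreover have "v * n * (K - 7 / 1000 * L) = v * n * K - v * (7 / 1000 * (n * L))" for K L
      by (simp add: algebra_simps)
    ultimately have M: "- Im (w * Y) \<ge> v * n * (1355 / 10 * (n * (n ^ 2 - 795 / 10000)) - 7 / 1000 * (1819 * n + 368))"
      using main ImwY by smt
    have "n * (n ^ 2 - 795 / 10000) \<ge> n * (4 / 10)"
      using nn n by (intro mult_left_mono) (auto simp: power2_eq_square)
    moreover have "1355 / 10 * N - 7 / 1000 * (1819 * n + 368) > 0" if "N \<ge> n * (4 / 10)" for N
      using n that by simp
    ultimately have "1355 / 10 * (n * (n ^ 2 - 795 / 10000)) - 7 / 1000 * (1819 * n + 368) > 0" by blast
    then have "v * n * (1355 / 10 * (n * (n ^ 2 - 795 / 10000)) - 7 / 1000 * (1819 * n + 368)) > 0"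
      using vn by (rule mult_pos_pos[rotated])
    then show ?thesis using M by linarith
  next
    case False
    have "norm (1 + 66 * u) ^ 2 = 1 + 132 * Re u + 4356 * r ^ 2"
      unfolding r_def cmod_power2 by (simp add: power2_eq_square algebra_simps)
    \<comment> \<open>The lower bound 1 - 66 r + 4356 r^2 decreases up to r = 1/132. The product is
      its excess over the value at 1/230, in factored form.\<close>
    moreover have "(1 / 230 - r) * (66 - 4356 * (r + 1 / 230)) \<ge> 0" using r by (intro mult_nonneg_nonneg) auto
    moreover have "(1 / 230 - r) * (66 - 4356 * (r + 1 / 230)) = 66 / 230 - 4356 / 52900 - 66 * r + 4356 * r ^ 2"
      by (simp add: field_simps power2_eq_square)
    ultimately have "norm (1 + 66 * u) ^ 2 \<ge> 7952 / 10000"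
      using False by linarith
    then have "norm (1 + 66 * u) ^ 2 \<ge> (8915 / 10000) ^ 2" by (simp add: power2_eq_square)
    then have "norm (1 + 66 * u) \<ge> 8915 / 10000" by (rule power2_le_imp_le) simp
    then have n: "n \<ge> 877 / 1000" using n1 nB ps r by linarith
    then have nn: "n ^ 2 \<ge> (877 / 1000) ^ 2" by (intro power_mono) auto
    have "\<bar>Im P\<bar> \<le> 10439 / 10000 * v" using ImP v by linarith
    then have "\<bar>Re P * Im P\<bar> \<le> (r * n) * (10439 / 10000 * v)"
      unfolding abs_mult using nP n r by (intro mult_mono) auto
    then have "\<bar>Re w\<bar> * \<bar>Re P * Im P\<bar> \<le> \<bar>Re w\<bar> * ((r * n) * (10439 / 10000 * v))"
      by (intro mult_left_mono) auto
    also have "\<dots> = (\<bar>Re w\<bar> * r) * (10439 / 10000 * (v * n))" by simp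
    also have "\<dots> \<le> 7 / 1000 * (10439 / 10000 * (v * n))" using Rew vn by (intro mult_right_mono) auto
    finally have "\<bar>Re w * (Re P * Im P)\<bar> \<le> 7 / 1000 * (10439 / 10000 * (v * n))" by (simp only: abs_mult)
    then have "- (Re w * Im Y) \<ge> - (7248 * (7 / 1000 * (10439 / 10000 * (v * n)))) - v * (7 / 1000 * (n * (1819 * n + 368)))"
      unfolding RI using E' by linarith
    moreover have "7248 * (7 / 1000 * (10439 / 10000 * (v * n))) \<le> v * (7 / 1000 * (n * 7567))"
      using vn by (simp add: mult.commute)
    moreover have "v * n * (K - 7 / 1000 * (L + 7935)) = v * n * K - v * (7 / 1000 * (n * (L + 368))) - v * (7 / 1000 * (n * 7567))" for K L
      by (simp add: algebra_simps)
    ultimately have M: "- Im (w * Y) \<ge> v * n * (1355 / 10 * (n * (n ^ 2 - 795 / 10000)) - 7 / 1000 * (1819 * n + 7935))"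
      using main ImwY by smt
    have "n * (n ^ 2 - 795 / 10000) \<ge> n * (689 / 1000)"
      using nn n by (intro mult_left_mono) (auto simp: power2_eq_square)
    moreover have "1355 / 10 * N - 7 / 1000 * (1819 * n + 7935) > 0" if "N \<ge> n * (689 / 1000)" for N
      using n that by simp
    ultimately have "1355 / 10 * (n * (n ^ 2 - 795 / 10000)) - 7 / 1000 * (1819 * n + 7935) > 0" by blast
    then have "v * n * (1355 / 10 * (n * (n ^ 2 - 795 / 10000)) - 7 / 1000 * (1819 * n + 7935)) > 0"
      using vn by (rule mult_pos_pos[rotated])
    then show ?thesis using M by linarith
  qed
  moreover have "(1 / 504 - sigma_powser 5 u) * E6_deriv2_series u / E6_deriv_series u ^ 2 = w * Y / of_real (n ^ 4)"
  proof -
    have "1 / 504 - sigma_powser 5 u = u * w" using u0 by (simp add: *(1) w_def field_simps)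
    then have "(1 / 504 - sigma_powser 5 u) * E6_deriv2_series u / E6_deriv_series u ^ 2 = w * c / b ^ 2"
      using u0 unfolding *(3,6) b_def[symmetric, unfolded B_def] c_def[symmetric]
      by (simp add: power_mult_distrib power2_eq_square)
    also have "\<dots> = w * Y / (b * cnj b) ^ 2" using b0 by (simp add: Y_def power_mult_distrib)
    also have "(b * cnj b) ^ 2 = of_real (n ^ 4)" unfolding bc by (simp flip: of_real_power power_mult)
    finally show ?thesis .
  qed
  ultimately show ?thesis using n by (simp only: Im_divide_of_real) (simp add: divide_neg_pos)
qed

section \<open>The equivariant function on the half strip\<close>

lemma exp_ge_Taylor:
  fixes x :: real
  assumes "x \<ge> 0"
  shows "(\<Sum>m<n. x ^ m / fact m) \<le> exp x"
proof -
  obtain t where "exp x = (\<Sum>m<n. x ^ m / fact m) + exp t / fact n * x ^ n"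
    using Maclaurin_exp_le[of x n] by blast
  then show ?thesis using assms by simp
qed

text \<open>The height sqrt 3 / 2 is that of the corner of \<open>F\<close>, where the exponential
  is exp(pi sqrt 3) = 230.76...; this is the source of the radius 1/230.\<close>

lemma exp_ge_230:
  assumes "y \<ge> sqrt 3 / 2"
  shows "230 \<le> exp (2 * pi * y)"
proof -
  \<comment> \<open>The rational 136/25 = 5.44 fits between log 230 = 5.4380... and pi sqrt 3 =
    5.4413...\<close>
  have "(230 :: real) \<le> (\<Sum>m<18. (136 / 25) ^ m / fact m)"
    by (simp add: lessThan_nat_numeral fact_numeral power_divide)
  also have "\<dots> \<le> exp (136 / 25)" by (rule exp_ge_Taylor) simp
  also have "136 / 25 \<le> 2 * pi * y"
  proof -
    have "(1732 / 1000) ^ 2 \<le> (3 :: real)" by (simp add: power2_eq_square)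
    then have s: "1732 / 1000 \<le> sqrt 3" by (rule real_le_rsqrt)
    have "136 / 25 \<le> (31415 / 10000) * (1732 / 1000 :: real)" by simp
    also have "\<dots> \<le> pi * sqrt 3" using pi_approx(1) s by (intro mult_mono) auto
    also have "\<dots> = 2 * pi * (sqrt 3 / 2)" by simp
    also have "\<dots> \<le> 2 * pi * y" using assms by (intro mult_left_mono) auto
    finally show ?thesis .
  qed
  finally show ?thesis by simp
qed

lemma sqrt3_pos: "sqrt 3 / 2 > (0::real)"
  and sqrt3_gt: "sqrt 3 / 2 > (86 / 100 :: real)"
  using real_less_rsqrt[of "172 / 100" 3] by (simp_all add: power2_eq_square)

lemma norm_nome_le:
  assumes "Im \<tau> \<ge> sqrt 3 / 2"
  shows "norm (nome \<tau>) \<le> 1 / 230"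
proof -
  have "1 / exp (2 * pi * Im \<tau>) \<le> 1 / 230"
    using exp_ge_230[OF assms] by (intro divide_left_mono) auto
  then show ?thesis by (simp add: norm_nome exp_minus inverse_eq_divide)
qed

lemma nome_Re_Im:
  "Re (nome \<tau>) = exp (- (2 * pi * Im \<tau>)) * cos (2 * pi * Re \<tau>)"
  "Im (nome \<tau>) = exp (- (2 * pi * Im \<tau>)) * sin (2 * pi * Re \<tau>)"
  by (simp_all add: nome_def Re_exp Im_exp)

lemma high_E6_deriv_nonzero:
  assumes "Im \<tau> \<ge> sqrt 3 / 2"
  shows "E6_deriv_series (nome \<tau>) \<noteq> 0" "deriv g3 \<tau> \<noteq> 0" "Im \<tau> > 0"
proof -
  show pos: "Im \<tau> > 0" using assms sqrt3_pos by linarith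
  show "E6_deriv_series (nome \<tau>) \<noteq> 0"
    by (rule E6_deriv_series_nonzero) (use norm_nome_le[OF assms] in auto)
  then show "deriv g3 \<tau> \<noteq> 0" using deriv_g3_eq_0_iff[OF pos] by simp
qed

lemma h_fun_Re_Im:
  assumes "Im \<tau> > 0"
  shows "Re (h_fun \<tau>) = Re \<tau> - 3 / pi * Im (h_quotient (nome \<tau>))"
    "Im (h_fun \<tau>) = Im \<tau> + 3 / pi * Re (h_quotient (nome \<tau>))"
proof -
  have "h_fun \<tau> = \<tau> + of_real (3 / pi) * (\<i> * h_quotient (nome \<tau>))"
    unfolding h_quotient_def h_fun_expansion[OF assms] by (simp only: mult.assoc)
  then show "Re (h_fun \<tau>) = Re \<tau> - 3 / pi * Im (h_quotient (nome \<tau>))"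
    "Im (h_fun \<tau>) = Im \<tau> + 3 / pi * Re (h_quotient (nome \<tau>))"
    by (simp_all only: plus_complex.sel Re_complex_of_real Im_complex_of_real times_complex.sel imaginary_unit.sel) simp_all
qed

lemma continuous_on_h_fun: "continuous_on {\<tau>. Im \<tau> \<ge> sqrt 3 / 2} h_fun"
proof (intro continuous_at_imp_continuous_on ballI)
  fix \<tau> assume "\<tau> \<in> {\<tau>. Im \<tau> \<ge> sqrt 3 / 2}"
  then show "isCont h_fun \<tau>"
    using DERIV_isCont[OF DERIV_h_fun[OF high_E6_deriv_nonzero(3,1)]] by simp
qed

text \<open>The half strip is convex, and the difference quotient is the mean of h' over the segment
  from a to b. The real mean value theorem, applied to the imaginary part of h / (b - a) along it,
  gives the sign.\<close>

lemma Im_difference_quotient_h_fun: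
  assumes a: "0 < Re a" "Re a < 1 / 2" "Im a \<ge> sqrt 3 / 2"
    and b: "0 < Re b" "Re b < 1 / 2" "Im b \<ge> sqrt 3 / 2" and "a \<noteq> b"
  shows "Im ((h_fun b - h_fun a) / (b - a)) < 0"
proof -
  define p where "p = (\<lambda>t::real. a + of_real t * (b - a))"
  define D where "D = (\<lambda>\<tau>. 7 + 6 * ((1 / 504 - sigma_powser 5 (nome \<tau>)) * E6_deriv2_series (nome \<tau>) / E6_deriv_series (nome \<tau>) ^ 2))"
  have D: "(h_fun has_field_derivative D \<tau>) (at \<tau>)" if "Im \<tau> \<ge> sqrt 3 / 2" for \<tau>
    unfolding D_def using high_E6_deriv_nonzero[OF that] by (intro DERIV_h_fun)
  have strip: "0 < Re (p t) \<and> Re (p t) < 1 / 2 \<and> Im (p t) \<ge> sqrt 3 / 2" if t: "0 \<le> t" "t \<le> 1" for t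
  proof -
    have e: "Re (p t) = (1 - t) * Re a + t * Re b" "Im (p t) = (1 - t) * Im a + t * Im b"
      by (simp_all add: p_def algebra_simps)
    have "Im (p t) \<ge> (1 - t) * (sqrt 3 / 2) + t * (sqrt 3 / 2)"
      unfolding e using a b t by (intro add_mono mult_left_mono) auto
    moreover have "0 < Re (p t) \<and> Re (p t) < 1 / 2"
    proof -
      have "convex {0 <..< 1 / 2 :: real}" by (rule convex_real_interval)
      from convexD[OF this, of "Re a" "Re b" "1 - t" t] show ?thesis using a b t by (simp add: e)
    qed
    moreover have "(1 - t) * (sqrt 3 / 2) + t * (sqrt 3 / 2) = sqrt 3 / 2" by (simp only: flip: distrib_right) simp
    ultimately show ?thesis by (intro conjI) linarith+
  qed
  have Dneg: "Im (D \<tau>) < 0" if "0 < Re \<tau>" "Re \<tau> < 1 / 2" "Im \<tau> \<ge> sqrt 3 / 2" for \<tau>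
  proof -
    have "sin (2 * pi * Re \<tau>) > 0"
      using that pi_gt_zero by (intro sin_gt_zero) auto
    then have "Im (nome \<tau>) > 0" by (simp add: nome_Re_Im)
    note neg = Im_second_quotient_neg[OF norm_nome_le[OF that(3)] this]
    have e: "Im (7 + 6 * X) = 6 * Im X" for X by simp
    show ?thesis unfolding D_def e by (rule mult_pos_neg[OF _ neg]) simp
  qed
  have der: "((\<lambda>t. Im (h_fun (p t) / (b - a))) has_real_derivative Im (D (p t))) (at t)" if "0 \<le> t" "t \<le> 1" for t
  proof -
    have "((\<lambda>z. a + z * (b - a)) has_field_derivative (b - a)) (at (of_real t))"
      by (auto intro!: derivative_eq_intros)
    from DERIV_chain2[where f = h_fun and g = "\<lambda>z. a + z * (b - a)" and x = "of_real t", OF D this] strip[OF that]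
    have "((\<lambda>z. h_fun (a + z * (b - a))) has_field_derivative D (p t) * (b - a)) (at (of_real t))"
      by (simp add: p_def)
    then have "((\<lambda>z. h_fun (a + z * (b - a)) / (b - a)) has_field_derivative D (p t) * (b - a) / (b - a)) (at (of_real t))"
      by (rule DERIV_cdivide)
    then have "((\<lambda>t. h_fun (p t) / (b - a)) has_vector_derivative D (p t)) (at t)"
      using \<open>a \<noteq> b\<close> unfolding p_def by (intro has_vector_derivative_real_field) simp
    then have "((\<lambda>t. Im (h_fun (p t) / (b - a))) has_vector_derivative Im (D (p t))) (at t)"
      by (rule bounded_linear.has_vector_derivative[OF bounded_linear_Im])
    then show ?thesis by (simp add: has_real_derivative_iff_has_vector_derivative)
  qed
  have "\<exists>t>0. t < 1 \<and> Im (h_fun (p 1) / (b - a)) - Im (h_fun (p 0) / (b - a)) = (1 - 0) * Im (D (p t))"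
    using der by (intro MVT2) auto
  then obtain t where t: "0 < t" "t < 1" "Im (h_fun b / (b - a)) - Im (h_fun a / (b - a)) = Im (D (p t))"
    by (auto simp: p_def)
  have "Im (D (p t)) < 0" using strip[of t] t by (intro Dneg) auto
  then show ?thesis using t(3) by (simp add: diff_divide_distrib)
qed

lemma Im_h_fun_strict_decreasing:
  assumes "0 < x1" "x1 < x2" "x2 < 1 / 2" "y \<ge> sqrt 3 / 2"
  shows "Im (h_fun (Complex x2 y)) < Im (h_fun (Complex x1 y))"
proof -
  have "Complex x2 y - Complex x1 y = of_real (x2 - x1)" by (simp add: complex_eq_iff)
  then show ?thesis
    using Im_difference_quotient_h_fun[of "Complex x1 y" "Complex x2 y"] assms
    by (simp add: Im_divide_of_real divide_less_0_iff)
qed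

text \<open>With a real numerator d only the denominator has an imaginary part: Im (d / (b - a)) has
  the sign of -d Im (b - a).\<close>

lemma h_fun_real_increasing:
  assumes a: "0 < Re a" "Re a < 1 / 2" "Im a \<ge> sqrt 3 / 2" "Im (h_fun a) = 0"
    and b: "0 < Re b" "Re b < 1 / 2" "Im b \<ge> sqrt 3 / 2" "Im (h_fun b) = 0" and "Im a < Im b"
  shows "Re (h_fun a) < Re (h_fun b)"
proof -
  have "a \<noteq> b" using assms by auto
  define d where "d = Re (h_fun b) - Re (h_fun a)"
  have "h_fun b - h_fun a = of_real d" using a b by (simp add: complex_eq_iff d_def)
  then have "Im ((h_fun b - h_fun a) / (b - a)) = - (d * (Im b - Im a) / norm (b - a) ^ 2)"
    by (simp add: Im_divide cmod_power2)
  then have "d * (Im b - Im a) / norm (b - a) ^ 2 > 0"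
    using Im_difference_quotient_h_fun[OF a(1-3) b(1-3) \<open>a \<noteq> b\<close>] by linarith
  then show ?thesis using \<open>Im a < Im b\<close> by (auto simp: zero_less_divide_iff zero_less_mult_iff d_def)
qed

lemma Im_h_fun_left_edge:
  assumes "y \<ge> sqrt 3 / 2"
  shows "Im (h_fun (Complex 0 y)) > 0"
proof -
  have y: "y > 86 / 100" using assms sqrt3_gt by linarith
  have n: "nome (Complex 0 y) = of_real (exp (- (2 * pi * y)))"
    by (simp add: complex_eq_iff nome_Re_Im)
  have "Re (h_quotient (of_real (exp (- (2 * pi * y))))) \<ge> - 7 / 10"
    using norm_nome_le[of "Complex 0 y"] assms unfolding norm_nome by (intro Re_h_quotient_pos_ge) auto
  then have "3 / pi * Re (h_quotient (nome (Complex 0 y))) \<ge> 3 / pi * (- 7 / 10)"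
    unfolding n by (intro mult_left_mono) auto
  moreover have "3 / pi * (7 / 10) \<le> 7 / 10" using pi_gt3 by (simp add: field_simps)
  ultimately show ?thesis using y by (simp add: h_fun_Re_Im)
qed

lemma Im_h_fun_right_edge:
  assumes "y \<ge> sqrt 3 / 2"
  shows "Im (h_fun (Complex (1 / 2) y)) < 0"
proof -
  have y: "y > 86 / 100" using assms sqrt3_gt by linarith
  define x where "x = exp (- (2 * pi * y))"
  have n: "nome (Complex (1 / 2) y) = - of_real x"
    by (simp add: complex_eq_iff nome_Re_Im x_def)
  have x: "0 < x" "x \<le> 1 / 230"
    using norm_nome_le[of "Complex 0 y"] assms unfolding norm_nome by (auto simp: x_def)
  define t where "t = 2 * pi * y"
  have t: "t > 5" unfolding t_def using mult_strict_mono[of 3 pi "86 / 100" y] pi_gt3 y by simp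
  \<comment> \<open>Tangent line of the exponential at 5, with the slope lowered to 84 = 504 / 6 so
    that the linear terms cancel in the comparison with t / 6; what is left is 85/100 > 4/6.\<close>
  have "84 * (t - 4) \<le> exp 5 * (t - 4)"
  proof (intro mult_right_mono)
    have "(84 :: real) \<le> (\<Sum>m<8. 5 ^ m / fact m)" by (simp add: eval_nat_numeral)
    also have "\<dots> \<le> exp 5" by (rule exp_ge_Taylor) simp
    finally show "84 \<le> exp (5::real)" .
  qed (use t in auto)
  also have "\<dots> \<le> exp 5 * exp (t - 5)"
    using exp_ge_add_one_self[of "t - 5"] by (intro mult_left_mono) auto
  also have "\<dots> = exp t" by (simp flip: exp_add)
  finally have et: "84 * (t - 4) \<le> exp t" .
  have "1 / (504 * x) = exp t / 504" by (simp add: x_def t_def exp_minus inverse_eq_divide)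
  then have "Re (h_quotient (- of_real x)) \<le> - (exp t / 504 + 85 / 100)"
    using Re_h_quotient_neg_le[OF x] by simp
  also have "\<dots> < - (t / 6)" using et t by simp
  also have "t / 6 = pi / 3 * y" by (simp add: t_def)
  finally have "3 / pi * Re (h_quotient (- of_real x)) < 3 / pi * - (pi / 3 * y)"
    by (intro mult_strict_left_mono) auto
  also have "\<dots> = - y" by simp
  finally show ?thesis using y by (simp add: h_fun_Re_Im n)
qed

text \<open>Serves to exclude -1, the other real value that h could take on the unit circle.\<close>

lemma Re_h_fun_gt:
  assumes "0 \<le> Re \<tau>" "Re \<tau> \<le> 1 / 2" "Im \<tau> \<ge> sqrt 3 / 2"
  shows "Re (h_fun \<tau>) > - 1"
proof -
  have "sin (2 * pi * Re \<tau>) \<ge> 0" using assms by (intro sin_ge_zero) auto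
  then have "Im (h_quotient (nome \<tau>)) < 1045 / 1000"
    using norm_nome_le[OF assms(3)] by (intro Im_h_quotient_less) (auto simp: nome_Re_Im)
  then have "3 / pi * Im (h_quotient (nome \<tau>)) < 3 / pi * (1045 / 1000)"
    by (intro mult_strict_left_mono) auto
  also have "\<dots> \<le> 1" using pi_approx(1) by (simp add: field_simps)
  finally show ?thesis unfolding h_fun_Re_Im(1)[OF high_E6_deriv_nonzero(3)[OF assms(3)]] using assms by linarith
qed

text \<open>Makes the values of h unbounded along the locus; 200 is generous. The quadratic bound
  exp(2 pi y) >= (6 y)^2 / 2 = 18 y^2 already outgrows the linear terms.\<close>

lemma norm_h_fun_ge:
  assumes "0 \<le> Re \<tau>" "Re \<tau> \<le> 1 / 2" "Im \<tau> \<ge> 200"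
  shows "norm (h_fun \<tau>) \<ge> Im \<tau>"
proof -
  define y where "y = Im \<tau>"
  have y: "y \<ge> 200" using assms by (simp add: y_def)
  have "sqrt 3 / 2 \<le> (1::real)" using real_sqrt_le_mono[of 3 4] by simp
  then have y': "Im \<tau> \<ge> sqrt 3 / 2" "Im \<tau> > 0" using y by (simp_all add: y_def)
  have e: "18 * y ^ 2 \<le> exp (2 * pi * y)"
  proof -
    have "18 * y ^ 2 = (6 * y) ^ 2 / 2" by (simp add: power2_eq_square)
    also have "\<dots> \<le> (2 * pi * y) ^ 2 / 2"
      using y pi_gt3 by (intro divide_right_mono power_mono mult_right_mono) auto
    also have "\<dots> \<le> 1 + 2 * pi * y + (2 * pi * y) ^ 2 / 2" using y by simp
    also have "\<dots> \<le> exp (2 * pi * y)"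
      using y by (intro exp_lower_Taylor_quadratic) auto
    finally show ?thesis .
  qed
  have "(18 * y ^ 2 / 504 - 6 / 5) / (27 / 20) \<le> (exp (2 * pi * y) / 504 - 6 / 5) / (27 / 20)"
    using e by simp
  also have "\<dots> = (1 / (504 * norm (nome \<tau>)) - 6 / 5) / (27 / 20)"
    by (simp add: norm_nome exp_minus inverse_eq_divide y_def)
  also have "\<dots> \<le> norm (h_quotient (nome \<tau>))"
    by (rule norm_h_quotient_ge) (use norm_nome_le[OF y'(1)] in auto)
  finally have q: "(18 * y ^ 2 / 504 - 6 / 5) / (27 / 20) \<le> norm (h_quotient (nome \<tau>))" .
  have hq: "of_real (3 / pi) * (\<i> * h_quotient (nome \<tau>)) = h_fun \<tau> - \<tau>"
    unfolding h_quotient_def h_fun_expansion[OF y'(2)] by (simp only: mult.assoc) simp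
  have "3 / 4 \<le> 3 / pi" using pi_less_4 by (simp add: field_simps)
  then have "3 / 4 * norm (h_quotient (nome \<tau>)) \<le> 3 / pi * norm (h_quotient (nome \<tau>))"
    by (intro mult_right_mono) auto
  also have "\<dots> = norm (h_fun \<tau> - \<tau>)" unfolding hq[symmetric] by (simp add: norm_mult norm_divide)
  also have "\<dots> \<le> norm (h_fun \<tau>) + norm \<tau>" by (rule norm_triangle_ineq4)
  also have "norm \<tau> \<le> 1 / 2 + y" using cmod_le[of \<tau>] assms by (simp add: y_def)
  finally have "3 / 4 * ((18 * y ^ 2 / 504 - 6 / 5) / (27 / 20)) \<le> norm (h_fun \<tau>) + (1 / 2 + y)"
    using q by simp
  moreover have "y * 200 \<le> y ^ 2" using y by (simp add: power2_eq_square)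
  ultimately show ?thesis using y by (simp add: y_def)
qed

section \<open>The zeros in the fundamental domain\<close>

definition real_locus :: "real \<Rightarrow> real" where
  "real_locus y = (THE x. 0 < x \<and> x < 1 / 2 \<and> Im (h_fun (Complex x y)) = 0)"

lemma continuous_on_h_fun_horizontal:
  assumes "y \<ge> sqrt 3 / 2"
  shows "continuous_on A (\<lambda>x. h_fun (Complex x y))"
  by (rule continuous_on_compose2[OF continuous_on_h_fun]) (use assms in \<open>auto intro!: continuous_intros\<close>)

lemma continuous_on_h_fun_vertical:
  "continuous_on {sqrt 3 / 2..} (\<lambda>y. h_fun (Complex x y))"
  by (rule continuous_on_compose2[OF continuous_on_h_fun]) (auto intro!: continuous_intros)

text \<open>Along a horizontal line Im h is positive at the left edge, negative at the right edge
  and strictly decreasing in between, so the \<open>THE\<close> is well defined.\<close>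

lemma real_locus:
  assumes y: "y \<ge> sqrt 3 / 2"
  shows "0 < real_locus y" "real_locus y < 1 / 2" "Im (h_fun (Complex (real_locus y) y)) = 0"
proof -
  have "\<exists>x\<ge>0. x \<le> 1 / 2 \<and> Im (h_fun (Complex x y)) = 0"
    using Im_h_fun_left_edge[OF y] Im_h_fun_right_edge[OF y]
    by (intro IVT2' continuous_intros continuous_on_h_fun_horizontal[OF y]) auto
  then obtain x where x: "0 \<le> x" "x \<le> 1 / 2" "Im (h_fun (Complex x y)) = 0" by auto
  moreover have "x \<noteq> 0" using x(3) Im_h_fun_left_edge[OF y] by auto
  moreover have "x \<noteq> 1 / 2" using x(3) Im_h_fun_right_edge[OF y] by (metis less_irrefl)
  ultimately have x: "0 < x \<and> x < 1 / 2 \<and> Im (h_fun (Complex x y)) = 0" by auto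
  have "\<exists>!x. 0 < x \<and> x < 1 / 2 \<and> Im (h_fun (Complex x y)) = 0"
  proof (rule ex1I[of _ x])
    show "0 < x \<and> x < 1 / 2 \<and> Im (h_fun (Complex x y)) = 0" by (rule x)
  next
    fix x' assume x': "0 < x' \<and> x' < 1 / 2 \<and> Im (h_fun (Complex x' y)) = 0"
    show "x' = x"
      using Im_h_fun_strict_decreasing[of x x' y] Im_h_fun_strict_decreasing[of x' x y] x x' y
      by (cases x x' rule: linorder_cases) auto
  qed
  from theI'[OF this] show "0 < real_locus y" "real_locus y < 1 / 2" "Im (h_fun (Complex (real_locus y) y)) = 0"
    unfolding real_locus_def by auto
qed

lemma real_locus_iff:
  assumes "y \<ge> sqrt 3 / 2" "0 \<le> x" "x \<le> 1 / 2" "Im (h_fun (Complex x y)) = 0"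
  shows "x = real_locus y"
proof -
  have "x \<noteq> 0" using assms(4) Im_h_fun_left_edge[OF assms(1)] by auto
  moreover have "x \<noteq> 1 / 2" using assms(4) Im_h_fun_right_edge[OF assms(1)] by (metis less_irrefl)
  ultimately show ?thesis
    using Im_h_fun_strict_decreasing[of x "real_locus y" y] Im_h_fun_strict_decreasing[of "real_locus y" x y]
      real_locus[OF assms(1)] assms by (cases x "real_locus y" rule: linorder_cases) auto
qed

text \<open>At a fixed abscissa x beside the locus the sign of Im h is stable under small changes of
  the height, and monotonicity along horizontals then keeps the locus on its side of x.\<close>

lemma continuous_on_real_locus: "continuous_on {sqrt 3 / 2..} real_locus"
  unfolding continuous_on_def
proof
  fix y assume "y \<in> {sqrt 3 / 2..}"
  then have y: "y \<ge> sqrt 3 / 2" by simp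
  have ev: "eventually (\<lambda>z. z \<ge> sqrt 3 / 2) (at y within {sqrt 3 / 2..})"
    by (auto simp: eventually_at_filter)
  have lim: "((\<lambda>z. Im (h_fun (Complex x z))) \<longlongrightarrow> Im (h_fun (Complex x y))) (at y within {sqrt 3 / 2..})" for x
    using continuous_on_h_fun_vertical[of x] y by (intro tendsto_Im) (auto simp: continuous_on_def)
  show "(real_locus \<longlongrightarrow> real_locus y) (at y within {sqrt 3 / 2..})"
  proof (rule order_tendstoI)
    fix a assume "a < real_locus y"
    define x where "x = (max a 0 + real_locus y) / 2"
    have x: "0 < x" "x < real_locus y" "a < x"
      using \<open>a < real_locus y\<close> real_locus[OF y] by (auto simp: x_def field_simps max_def)
    have "0 < Im (h_fun (Complex x y))"
      using Im_h_fun_strict_decreasing[of x "real_locus y" y] x real_locus[OF y] y by simp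
    from order_tendstoD(1)[OF lim this] ev
    show "eventually (\<lambda>z. a < real_locus z) (at y within {sqrt 3 / 2..})"
    proof eventually_elim
      case (elim z)
      have "\<not> real_locus z \<le> x"
        using Im_h_fun_strict_decreasing[of "real_locus z" x z] x real_locus[OF elim(2)] real_locus[OF y] elim
        by (cases "real_locus z = x") auto
      then show ?case using x by simp
    qed
  next
    fix a assume "real_locus y < a"
    define x where "x = (min a (1 / 2) + real_locus y) / 2"
    have x: "x < 1 / 2" "real_locus y < x" "x < a"
      using \<open>real_locus y < a\<close> real_locus[OF y] by (auto simp: x_def field_simps min_def)
    have "Im (h_fun (Complex x y)) < 0"
      using Im_h_fun_strict_decreasing[of "real_locus y" x y] x real_locus[OF y] y by simp
    from order_tendstoD(2)[OF lim this] ev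
    show "eventually (\<lambda>z. real_locus z < a) (at y within {sqrt 3 / 2..})"
    proof eventually_elim
      case (elim z)
      have "\<not> x \<le> real_locus z"
        using Im_h_fun_strict_decreasing[of x "real_locus z" z] x real_locus[OF elim(2)] real_locus[OF y] elim
        by (cases "real_locus z = x") auto
      then show ?case using x by simp
    qed
  qed
qed

section \<open>The values of the equivariant function along its real locus\<close>

definition locus_point :: "real \<Rightarrow> complex" where
  "locus_point y = Complex (real_locus y) y"

definition locus_value :: "real \<Rightarrow> real" where
  "locus_value y = Re (h_fun (locus_point y))"

lemma h_fun_locus_point: "y \<ge> sqrt 3 / 2 \<Longrightarrow> h_fun (locus_point y) = of_real (locus_value y)"
  using real_locus(3)[of y] by (simp add: complex_eq_iff locus_point_def locus_value_def)

lemma continuous_on_locus_point: "continuous_on {sqrt 3 / 2..} locus_point"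
  unfolding locus_point_def by (intro continuous_intros continuous_on_real_locus)

lemma continuous_on_locus_value: "continuous_on {sqrt 3 / 2..} locus_value"
  unfolding locus_value_def
  by (intro continuous_intros continuous_on_compose2[OF continuous_on_h_fun continuous_on_locus_point])
    (auto simp: locus_point_def)

lemma locus_value_strict_mono:
  assumes "sqrt 3 / 2 \<le> y" "y < z"
  shows "locus_value y < locus_value z"
  unfolding locus_value_def using real_locus[of y] real_locus[of z] assms
  by (intro h_fun_real_increasing) (auto simp: locus_point_def)

lemma locus_value_gt: "sqrt 3 / 2 \<le> y \<Longrightarrow> locus_value y > - 1"
  unfolding locus_value_def using real_locus[of y] by (intro Re_h_fun_gt) (auto simp: locus_point_def)

lemma zero_form_iff_locus_value:
  assumes "sqrt 3 / 2 \<le> y"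
  shows "zero_form C 1 (locus_point y) = 0 \<longleftrightarrow> locus_value y = C"
  using zero_form_iff_h_fun[OF high_E6_deriv_nonzero(2)[of "locus_point y"], of C] assms
  by (simp add: h_fun_locus_point) (simp add: locus_point_def)

lemma locus_value_eq_1:
  assumes "sqrt 3 / 2 \<le> y" "norm (locus_point y) = 1"
  shows "locus_value y = 1"
proof -
  have i: "Im (locus_point y) = y" by (simp add: locus_point_def)
  have "locus_value y = 1 \<or> locus_value y = - 1"
    using zero_form_iff_locus_value[OF assms(1), of "locus_value y"] high_E6_deriv_nonzero[of "locus_point y"] assms
    by (intro zero_form_on_circle[of "locus_point y"]) (auto simp: i)
  then show ?thesis using locus_value_gt[OF assms(1)] by auto
qed

lemma norm_locus_point_low: "norm (locus_point (sqrt 3 / 2)) < 1"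
proof -
  have "real_locus (sqrt 3 / 2) ^ 2 < (1 / 2) ^ 2"
    using real_locus[of "sqrt 3 / 2"] by (intro power_strict_mono) auto
  then have "norm (locus_point (sqrt 3 / 2)) ^ 2 < 1 ^ 2"
    by (simp add: cmod_power2 locus_point_def power_divide)
  then show ?thesis by (rule power2_less_imp_less) simp
qed

lemma norm_locus_point_high:
  assumes "y \<ge> 1"
  shows "norm (locus_point y) > 1"
proof -
  have "sqrt 3 / 2 \<le> y" using real_sqrt_le_mono[of 3 4] assms by simp
  then have "1 ^ 2 + 0 < y ^ 2 + real_locus y ^ 2"
    using real_locus[of y] assms by (intro add_le_less_mono power_mono) auto
  then have "1 ^ 2 < norm (locus_point y) ^ 2" by (simp add: cmod_power2 locus_point_def)
  then show ?thesis by (rule power2_less_imp_less) simp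
qed

lemma norm_locus_point_IVT:
  assumes "sqrt 3 / 2 \<le> a" "a \<le> b" "norm (locus_point a) \<le> 1" "1 \<le> norm (locus_point b)"
  obtains y where "a \<le> y" "y \<le> b" "norm (locus_point y) = 1" "locus_value y = 1"
proof -
  have "\<exists>y\<ge>a. y \<le> b \<and> norm (locus_point y) = 1"
    using assms by (intro IVT' continuous_on_norm continuous_on_subset[OF continuous_on_locus_point]) auto
  then show ?thesis using that locus_value_eq_1 assms(1) by (meson order_trans)
qed

text \<open>Every crossing of the unit circle has value 1 and the values increase strictly, so there
  is a single crossing height c. The norm is below 1 at the bottom and above 1 from height 1 on, and
  the intermediate value theorem fixes its side of 1 below and above c.\<close>

lemma norm_locus_point_vs_value:
  assumes "sqrt 3 / 2 \<le> y"
  shows "1 \<le> norm (locus_point y) \<longleftrightarrow> 1 \<le> locus_value y"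
    and "norm (locus_point y) = 1 \<longleftrightarrow> locus_value y = 1"
proof -
  have s: "sqrt 3 / 2 \<le> (1::real)" using real_sqrt_le_mono[of 3 4] by simp
  obtain c where c: "sqrt 3 / 2 \<le> c" "norm (locus_point c) = 1" "locus_value c = 1"
    by (rule norm_locus_point_IVT[of "sqrt 3 / 2" 1]) (use norm_locus_point_low norm_locus_point_high[of 1] s in auto)
  have c_unique: "z = c" if "sqrt 3 / 2 \<le> z" "locus_value z = 1" for z
    using locus_value_strict_mono[of z c] locus_value_strict_mono[of c z] c that
    by (cases z c rule: linorder_cases) auto
  have 1: "norm (locus_point y) < 1" if "y < c"
  proof (rule ccontr)
    assume n: "\<not> ?thesis"
    obtain z where "sqrt 3 / 2 \<le> z" "z \<le> y" "locus_value z = 1"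
      by (rule norm_locus_point_IVT[of "sqrt 3 / 2" y]) (use norm_locus_point_low assms n that in auto)
    then show False using c_unique[of z] that by auto
  qed
  have 2: "norm (locus_point y) > 1" if "c < y"
  proof (rule ccontr)
    assume n: "\<not> ?thesis"
    obtain z where "y \<le> z" "locus_value z = 1"
      by (rule norm_locus_point_IVT[of y "max y 1"]) (use norm_locus_point_high[of "max y 1"] assms n that in auto)
    then show False using c_unique[of z] that assms by auto
  qed
  show "1 \<le> norm (locus_point y) \<longleftrightarrow> 1 \<le> locus_value y" "norm (locus_point y) = 1 \<longleftrightarrow> locus_value y = 1"
    using 1 2 c locus_value_strict_mono[of y c] locus_value_strict_mono[of c y] assms
    by (cases y c rule: linorder_cases; auto)+
qed

lemma locus_value_surj:
  assumes "C \<ge> 1"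
  obtains y where "sqrt 3 / 2 \<le> y" "locus_value y = C"
proof -
  define b where "b = max 200 C"
  have s: "sqrt 3 / 2 \<le> (1::real)" using real_sqrt_le_mono[of 3 4] by simp
  then have b: "sqrt 3 / 2 \<le> b" "b \<ge> 200" "b \<ge> C" by (auto simp: b_def)
  have "b \<le> norm (h_fun (locus_point b))"
    using norm_h_fun_ge[of "locus_point b"] b real_locus[OF b(1)] by (simp add: locus_point_def)
  then have "b \<le> \<bar>locus_value b\<bar>" by (simp add: h_fun_locus_point[OF b(1)])
  then have hi: "C \<le> locus_value b" using b locus_value_gt[OF b(1)] by linarith
  have "locus_value (sqrt 3 / 2) \<le> C"
    using norm_locus_point_vs_value(1)[of "sqrt 3 / 2"] norm_locus_point_low assms by auto
  then have "\<exists>y\<ge>sqrt 3 / 2. y \<le> b \<and> locus_value y = C"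
    using hi b by (intro IVT' continuous_on_subset[OF continuous_on_locus_value]) auto
  then show ?thesis using that by blast
qed

definition F_left :: "complex set" where
  "F_left = {\<tau>. Im \<tau> > 0 \<and> 0 \<le> Re \<tau> \<and> Re \<tau> \<le> 1 / 2 \<and> norm \<tau> \<ge> 1}"

lemma F_left_high:
  assumes "\<tau> \<in> F_left"
  shows "Im \<tau> \<ge> sqrt 3 / 2"
proof -
  have t: "Im \<tau> > 0" "0 \<le> Re \<tau>" "Re \<tau> \<le> 1 / 2" "norm \<tau> \<ge> 1" using assms by (auto simp: F_left_def)
  have "1 \<le> norm \<tau> ^ 2" using t by (simp add: one_le_power)
  moreover have "Re \<tau> ^ 2 \<le> (1 / 2) ^ 2" using t by (intro power_mono) auto
  ultimately have "(sqrt 3 / 2) ^ 2 \<le> Im \<tau> ^ 2"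
    by (simp add: cmod_power2 power_divide)
  then show ?thesis by (rule power2_le_imp_le) (use t in simp)
qed

lemma F_left_zero_iff:
  "\<tau> \<in> F_left \<and> zero_form C 1 \<tau> = 0 \<longleftrightarrow>
     (\<exists>y\<ge>sqrt 3 / 2. \<tau> = locus_point y \<and> locus_value y = C \<and> 1 \<le> C)" (is "?l \<longleftrightarrow> ?r")
proof
  assume l: ?l
  define y where "y = Im \<tau>"
  have y: "sqrt 3 / 2 \<le> y" using l F_left_high by (simp add: y_def)
  have h: "h_fun \<tau> = of_real C"
    using l zero_form_iff_h_fun[OF high_E6_deriv_nonzero(2)] y by (simp add: y_def)
  then have "Re \<tau> = real_locus y"
    using l y by (intro real_locus_iff) (auto simp: F_left_def y_def)
  then have t: "\<tau> = locus_point y" by (simp add: locus_point_def y_def complex_eq_iff)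
  then have "locus_value y = C" using h h_fun_locus_point[OF y] by simp
  moreover have "1 \<le> norm (locus_point y)" using l t by (simp add: F_left_def)
  ultimately show ?r using t y norm_locus_point_vs_value(1)[OF y] by auto
next
  assume ?r
  then obtain y where y: "sqrt 3 / 2 \<le> y" "\<tau> = locus_point y" "locus_value y = C" "1 \<le> C" by auto
  have "y > 0" using y(1) sqrt3_pos by linarith
  then show ?l
    using y zero_form_iff_locus_value[OF y(1)] norm_locus_point_vs_value(1)[OF y(1)] real_locus[OF y(1)]
    by (auto simp: F_left_def) (auto simp: locus_point_def)
qed

lemma F_left_zero:
  assumes "\<tau> \<in> F_left" "zero_form C 1 \<tau> = 0"
  shows "C \<ge> 1" "0 < Re \<tau>" "Re \<tau> < 1 / 2" "norm \<tau> = 1 \<longleftrightarrow> C = 1"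
proof -
  obtain y where y: "sqrt 3 / 2 \<le> y" "\<tau> = locus_point y" "locus_value y = C" "1 \<le> C"
    using F_left_zero_iff[of \<tau> C] assms by blast
  show "C \<ge> 1" by (rule y)
  show "0 < Re \<tau>" "Re \<tau> < 1 / 2" using real_locus[OF y(1)] by (auto simp: y(2) locus_point_def)
  show "norm \<tau> = 1 \<longleftrightarrow> C = 1" using norm_locus_point_vs_value(2)[OF y(1)] y by simp
qed

lemma F_left_zero_ex1:
  assumes "C \<ge> 1"
  shows "\<exists>!\<tau>. \<tau> \<in> F_left \<and> zero_form C 1 \<tau> = 0"
proof -
  obtain y where y: "sqrt 3 / 2 \<le> y" "locus_value y = C" using locus_value_surj[OF assms] .
  show ?thesis
    unfolding F_left_zero_iff
  proof (rule ex1I[of _ "locus_point y"])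
    fix \<tau> assume "\<exists>z\<ge>sqrt 3 / 2. \<tau> = locus_point z \<and> locus_value z = C \<and> 1 \<le> C"
    then obtain z where z: "sqrt 3 / 2 \<le> z" "\<tau> = locus_point z" "locus_value z = C" by auto
    have "z = y"
      using locus_value_strict_mono[of y z] locus_value_strict_mono[of z y] y z
      by (cases y z rule: linorder_cases) auto
    then show "\<tau> = locus_point y" using z by simp
  qed (use y assms in auto)
qed

section \<open>Symmetries of the domains and transfer of the zeros\<close>

lemma norm_minus_ge_iff:
  "norm (\<tau> - 1) \<ge> 1 \<longleftrightarrow> 2 * Re \<tau> \<le> norm \<tau> ^ 2"
  "norm (\<tau> - 1 / 2) \<ge> 1 / 2 \<longleftrightarrow> Re \<tau> \<le> norm \<tau> ^ 2"
  "norm (\<tau> - 1) \<ge> norm \<tau> \<longleftrightarrow> Re \<tau> \<le> 1 / 2"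
proof -
  have 1: "norm (\<tau> - 1) ^ 2 = norm \<tau> ^ 2 - 2 * Re \<tau> + 1"
    and 2: "norm (\<tau> - 1 / 2) ^ 2 = norm \<tau> ^ 2 - Re \<tau> + (1 / 2) ^ 2"
    unfolding cmod_power2 by (simp_all add: power2_eq_square algebra_simps)
  have "norm (\<tau> - 1) \<ge> 1 \<longleftrightarrow> norm (\<tau> - 1) ^ 2 \<ge> 1"
    using abs_le_square_iff[of 1 "norm (\<tau> - 1)"] by simp
  then show "norm (\<tau> - 1) \<ge> 1 \<longleftrightarrow> 2 * Re \<tau> \<le> norm \<tau> ^ 2"
    unfolding 1 by simp
  have "norm (\<tau> - 1 / 2) \<ge> 1 / 2 \<longleftrightarrow> norm (\<tau> - 1 / 2) ^ 2 \<ge> (1 / 2) ^ 2"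
    using abs_le_square_iff[of "1 / 2" "norm (\<tau> - 1 / 2)"] by simp
  then show "norm (\<tau> - 1 / 2) \<ge> 1 / 2 \<longleftrightarrow> Re \<tau> \<le> norm \<tau> ^ 2"
    unfolding 2 by simp
  have "norm (\<tau> - 1) \<ge> norm \<tau> \<longleftrightarrow> norm (\<tau> - 1) ^ 2 \<ge> norm \<tau> ^ 2"
    using abs_le_square_iff[of "norm \<tau>" "norm (\<tau> - 1)"] by simp
  then show "norm (\<tau> - 1) \<ge> norm \<tau> \<longleftrightarrow> Re \<tau> \<le> 1 / 2"
    unfolding 1 by (simp add: mult.commute)
qed

lemma F0_iff: "\<tau> \<in> F0 \<longleftrightarrow> Im \<tau> > 0 \<and> 0 \<le> Re \<tau> \<and> Re \<tau> \<le> 1 \<and> Re \<tau> \<le> norm \<tau> ^ 2"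
  unfolding F0_def mem_Collect_eq norm_minus_ge_iff upper_half_plane_def by blast

lemma F_left_iff: "\<tau> \<in> F_left \<longleftrightarrow> \<tau> \<in> F \<and> Re \<tau> \<le> 1 / 2"
proof -
  have "2 * Re \<tau> \<le> norm \<tau> ^ 2" if "Re \<tau> \<le> 1 / 2" "norm \<tau> \<ge> 1"
    using that one_le_power[of "norm \<tau>" 2] by linarith
  then show ?thesis
    by (auto simp: F_left_def F_def upper_half_plane_def norm_minus_ge_iff)
qed

lemma F_reflect: "1 - cnj \<tau> \<in> F \<longleftrightarrow> \<tau> \<in> F"
  and F0_reflect: "1 - cnj \<tau> \<in> F0 \<longleftrightarrow> \<tau> \<in> F0"
proof -
  have "norm (1 - cnj \<tau>) = norm (\<tau> - 1)" "norm (- cnj \<tau>) = norm \<tau>" "norm (1 / 2 - cnj \<tau>) = norm (\<tau> - 1 / 2)"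
    by (simp_all add: cmod_def power2_commute)
  moreover have "1 - cnj \<tau> - 1 = - cnj \<tau>" "1 - cnj \<tau> - 1 / 2 = 1 / 2 - cnj \<tau>" by simp_all
  ultimately show "1 - cnj \<tau> \<in> F \<longleftrightarrow> \<tau> \<in> F" "1 - cnj \<tau> \<in> F0 \<longleftrightarrow> \<tau> \<in> F0"
    unfolding F_def F0_def upper_half_plane_def mem_Collect_eq by auto
qed

lemma f_zero_reflect:
  assumes "Im \<tau> > 0"
  shows "f C (1 - cnj \<tau>) = 0 \<longleftrightarrow> f (1 - C) \<tau> = 0"
  using assms zero_form_reflection[OF assms, of C 1] by (simp add: f_eq_0_iff)

lemma F_Im: "\<tau> \<in> F \<Longrightarrow> Im \<tau> > 0" and F0_Im: "\<tau> \<in> F0 \<Longrightarrow> Im \<tau> > 0"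
  by (auto simp: F_def F0_def upper_half_plane_def)

text \<open>The right half of \<open>F\<close> is the reflected left half, with 1 - C in place of C.
  For 0 < C < 1 neither alternative is possible.\<close>

lemma F_zero_cases:
  assumes "\<tau> \<in> F" "f C \<tau> = 0"
  shows "C \<ge> 1 \<and> \<tau> \<in> F_left \<or> C \<le> 0 \<and> 1 - cnj \<tau> \<in> F_left"
proof (cases "Re \<tau> \<le> 1 / 2")
  case True
  then show ?thesis using assms F_left_zero(1)[of \<tau> C] F_Im f_eq_0_iff by (auto simp: F_left_iff)
next
  case False
  have "f (1 - C) (1 - cnj \<tau>) = 0"
    using f_zero_reflect[of \<tau> "1 - C"] assms F_Im by simp
  moreover have "1 - cnj \<tau> \<in> F_left" using False assms by (simp add: F_left_iff F_reflect)
  ultimately show ?thesis using F_left_zero(1)[of "1 - cnj \<tau>" "1 - C"] F_Im[OF assms(1)] f_eq_0_iff[of "1 - cnj \<tau>"] by simp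
qed

text \<open>The conditions correspond: |\<tau> - 1/2| >= 1/2 gives Re (1/\<tau>) <= 1, Re \<tau> <=
  1/2 gives |1 - 1/\<tau>| >= 1, and |\<tau>| < 1 puts the image at distance more than 1 from
  1.\<close>

lemma F0_rotate:
  assumes "\<tau> \<in> F0" "Re \<tau> \<le> 1 / 2" "norm \<tau> < 1"
  shows "1 - 1 / \<tau> \<in> F"
proof -
  have im: "Im \<tau> > 0" using assms F0_Im by simp
  have pos: "norm \<tau> > 0" using im by auto
  have re: "0 \<le> Re \<tau>" "Re \<tau> \<le> norm \<tau> ^ 2" using assms by (auto simp: F0_iff)
  have e: "1 - 1 / \<tau> = (\<tau> - 1) / \<tau>" using pos by (simp add: field_simps)
  have "Re (1 / \<tau>) = Re \<tau> / norm \<tau> ^ 2" "Im (1 / \<tau>) = - Im \<tau> / norm \<tau> ^ 2"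
    by (simp_all add: Re_divide Im_divide cmod_power2)
  moreover have "norm (1 - 1 / \<tau>) \<ge> 1"
    unfolding e norm_divide using pos norm_minus_ge_iff(3)[of \<tau>] assms by simp
  moreover have "norm (1 - 1 / \<tau> - 1) \<ge> 1"
    using pos assms by (simp add: norm_divide)
  ultimately show ?thesis
    using im pos re by (simp add: F_def upper_half_plane_def)
qed

text \<open>Below the circle the rotation would produce a zero in \<open>F\<close> for the parameter
  (C - 1) / C, which lies strictly between 0 and 1. Uniqueness in the left half of \<open>F0\<close>
  thus reduces to \<open>F\<close>.\<close>

lemma F0_left_zero:
  assumes "C > 1" "\<tau> \<in> F0" "Re \<tau> \<le> 1 / 2" "f C \<tau> = 0"
  shows "\<tau> \<in> F_left"
proof (rule ccontr)
  have im: "Im \<tau> > 0" using assms F0_Im by simp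
  assume "\<tau> \<notin> F_left"
  then have "norm \<tau> < 1" using assms im by (auto simp: F_left_def F0_def)
  then have w: "1 - 1 / \<tau> \<in> F" using assms by (intro F0_rotate) auto
  have "zero_form (C * ((C - 1) / C)) (C * 1) (1 - 1 / \<tau>) = 0"
    using zero_form_rotation[OF im, of "C - 1" C] assms im by (simp add: f_eq_0_iff)
  then have "zero_form ((C - 1) / C) 1 (1 - 1 / \<tau>) = 0"
    unfolding zero_form_scale using assms by simp
  then have "f ((C - 1) / C) (1 - 1 / \<tau>) = 0" using f_eq_0_iff F_Im[OF w] by simp
  from F_zero_cases[OF w this] show False using assms(1) by (auto simp: field_simps)
qed

lemma interior_F_imp_interior_F0:
  assumes "\<tau> \<in> interior F"
  shows "\<tau> \<in> interior F0"
proof -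
  have "F \<subseteq> F0"
  proof
    fix \<tau> assume t: "\<tau> \<in> F"
    then have "1 \<le> norm \<tau> ^ 2" by (simp add: F_def one_le_power)
    then have "Re \<tau> \<le> norm \<tau> ^ 2" using t unfolding F_def by (simp; linarith)
    then show "\<tau> \<in> F0" using t by (simp add: F_def F0_iff upper_half_plane_def)
  qed
  then show ?thesis using assms interior_mono by blast
qed

lemma interior_F_I:
  assumes "Im \<tau> > 0" "0 < Re \<tau>" "Re \<tau> < 1" "norm \<tau> > 1" "norm (\<tau> - 1) > 1"
  shows "\<tau> \<in> interior F"
proof (rule interiorI)
  let ?S = "{\<tau>. Im \<tau> > 0} \<inter> {\<tau>. 0 < Re \<tau>} \<inter> {\<tau>. Re \<tau> < 1} \<inter> {\<tau>. 1 < norm \<tau>} \<inter> {\<tau>. 1 < norm (\<tau> - 1)}"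
  show "open ?S" by (intro open_Int open_Collect_less continuous_intros)
  show "\<tau> \<in> ?S" using assms by simp
  show "?S \<subseteq> F" by (auto simp: F_def upper_half_plane_def)
qed

text \<open>The last claim reaches beyond \<open>F\<close>: uniqueness in the left half of
  \<open>F0\<close> is what determines the \<open>THE\<close> in \<open>tau_less\<close> and, after
  reflection, that in \<open>tau_greater\<close>.\<close>

lemma zeros_C_gt_1:
  assumes C: "C > 1"
  shows "{\<tau> \<in> F. f C \<tau> = 0} = {tau_less C}" "tau_less C \<in> interior F" "tau_less C \<in> F0_less"
    "\<And>\<tau>. \<tau> \<in> F0 \<Longrightarrow> Re \<tau> \<le> 1 / 2 \<Longrightarrow> f C \<tau> = 0 \<Longrightarrow> \<tau> = tau_less C"
proof -
  obtain s where s: "s \<in> F_left" "zero_form C 1 s = 0"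
    and uniq: "\<And>\<tau>. \<tau> \<in> F_left \<Longrightarrow> zero_form C 1 \<tau> = 0 \<Longrightarrow> \<tau> = s"
    using F_left_zero_ex1[of C] C by auto
  have im: "Im \<tau> > 0" if "\<tau> \<in> F_left" for \<tau> using that by (simp add: F_left_def)
  have fs: "f C s = 0" using s im f_eq_0_iff by simp
  have s': "0 < Re s" "Re s < 1 / 2" "norm s > 1"
    using F_left_zero[OF s] C s(1) by (auto simp: F_left_def less_le)
  have "1 < norm (s - 1)"
    using norm_minus_ge_iff(3)[of s] s' by linarith
  then have int: "s \<in> interior F" using s' im[OF s(1)] by (intro interior_F_I) auto
  then have less: "s \<in> F0_less" using s' by (simp add: F0_less_def interior_F_imp_interior_F0)
  have u: "\<tau> = s" if "\<tau> \<in> F0" "Re \<tau> \<le> 1 / 2" "f C \<tau> = 0" for \<tau>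
    using F0_left_zero[OF C that] that(3) im f_eq_0_iff uniq by simp
  have ts: "tau_less C = s"
    unfolding tau_less_def
    by (rule the_equality) (use less fs u interior_subset[of F0] in \<open>auto simp: F0_less_def\<close>)
  show "tau_less C \<in> interior F" "tau_less C \<in> F0_less" using int less by (simp_all add: ts)
  show "\<tau> = tau_less C" if "\<tau> \<in> F0" "Re \<tau> \<le> 1 / 2" "f C \<tau> = 0" for \<tau>
    using u[OF that] by (simp add: ts)
  have "\<tau> = s" if "\<tau> \<in> F" "f C \<tau> = 0" for \<tau>
    using F_zero_cases[OF that] C that f_eq_0_iff im uniq by auto
  moreover have "s \<in> F" using s(1) by (simp add: F_left_iff)
  ultimately show "{\<tau> \<in> F. f C \<tau> = 0} = {tau_less C}" unfolding ts using fs by blast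
qed

lemma interior_reflect:
  assumes "\<tau> \<in> interior S" "\<And>z. z \<in> S \<Longrightarrow> 1 - cnj z \<in> S"
  shows "1 - cnj \<tau> \<in> interior S"
proof (rule interiorI)
  let ?T = "(\<lambda>z. 1 - cnj z) -` interior S"
  show "open ?T" by (intro open_vimage continuous_intros) auto
  show "1 - cnj \<tau> \<in> ?T" using assms by simp
  show "?T \<subseteq> S"
  proof
    fix z assume "z \<in> ?T"
    then have "1 - cnj z \<in> S" using interior_subset by blast
    from assms(2)[OF this] show "z \<in> S" by simp
  qed
qed

lemma zeros_reflect:
  assumes "{\<tau> \<in> F. f (1 - C) \<tau> = 0} = {s}"
  shows "{\<tau> \<in> F. f C \<tau> = 0} = {1 - cnj s}"
proof -
  have "f C \<tau> = 0 \<longleftrightarrow> f (1 - C) (1 - cnj \<tau>) = 0" if "\<tau> \<in> F" for \<tau>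
    using f_zero_reflect[of \<tau> "1 - C"] F_Im[OF that] by simp
  then have "\<tau> \<in> {\<tau> \<in> F. f C \<tau> = 0} \<longleftrightarrow> 1 - cnj \<tau> \<in> {\<tau> \<in> F. f (1 - C) \<tau> = 0}" for \<tau>
    by (auto simp: F_reflect)
  moreover have "1 - cnj \<tau> = s \<longleftrightarrow> \<tau> = 1 - cnj s" for \<tau>
    by (auto simp: complex_eq_iff)
  ultimately show ?thesis unfolding assms by auto
qed

lemma zeros_C_less_0:
  assumes C: "C < 0"
  shows "{\<tau> \<in> F. f C \<tau> = 0} = {tau_greater C}" "tau_greater C \<in> interior F" "tau_greater C \<in> F0_greater"
proof -
  have C': "1 - C > 1" using C by simp
  define s where "s = tau_less (1 - C)"
  note less = zeros_C_gt_1[OF C', folded s_def]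
  have sF: "s \<in> F" "f (1 - C) s = 0" using less(1) by auto
  have int: "1 - cnj s \<in> interior F" by (rule interior_reflect[OF less(2)]) (simp add: F_reflect)
  then have gr: "1 - cnj s \<in> F0_greater"
    using less(3) by (simp add: F0_greater_def F0_less_def interior_F_imp_interior_F0)
  have fs: "f C (1 - cnj s) = 0" using sF f_zero_reflect[of s C] F_Im by simp
  have "tau_greater C = 1 - cnj s"
    unfolding tau_greater_def
  proof (rule the_equality)
    fix \<tau> assume t: "\<tau> \<in> F0_greater \<and> f C \<tau> = 0"
    then have t0: "\<tau> \<in> F0" using interior_subset[of F0] by (auto simp: F0_greater_def)
    have "1 - cnj \<tau> = s"
      using t t0 f_zero_reflect[of \<tau> "1 - C"] F0_Im[OF t0]
      by (intro less(4)) (auto simp: F0_reflect F0_greater_def)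
    then show "\<tau> = 1 - cnj s" by auto
  qed (use gr fs in auto)
  then show "{\<tau> \<in> F. f C \<tau> = 0} = {tau_greater C}" "tau_greater C \<in> interior F" "tau_greater C \<in> F0_greater"
    using int gr zeros_reflect[OF less(1)] by simp_all
qed

text \<open>The rotation links the pairs (1, 1) and (1, 0): 1 - 1/t is a zero of \<open>f 1\<close>
  when t is a zero of \<open>deriv g3\<close>, and conversely. Existence and uniqueness of
  \<open>tau_inf\<close> are therefore read off from the zero w on the unit circle.\<close>

lemma zeros_C_0_1:
  obtains w where "{\<tau> \<in> F. f 1 \<tau> = 0} = {w}" "norm w = 1" "w \<noteq> 0" "w \<noteq> 1" "tau_inf = 1 / (1 - w)"
proof -
  obtain w where w: "w \<in> F_left" "zero_form 1 1 w = 0"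
    and uniq: "\<And>\<tau>. \<tau> \<in> F_left \<Longrightarrow> zero_form 1 1 \<tau> = 0 \<Longrightarrow> \<tau> = w"
    using F_left_zero_ex1[of 1] by auto
  have wF: "w \<in> F" using w(1) by (simp add: F_left_iff)
  have wi: "Im w > 0" using w(1) by (simp add: F_left_def)
  have wn: "norm w = 1" "0 < Re w" "Re w < 1 / 2" using F_left_zero[OF w] by auto
  have w0: "w \<noteq> 0" "w \<noteq> 1" using wi by auto
  have fw: "f 1 w = 0" using w wi f_eq_0_iff by simp
  have u: "\<tau> = w" if "\<tau> \<in> F" "f 1 \<tau> = 0" for \<tau>
    using F_zero_cases[OF that] that f_eq_0_iff[OF F_Im[OF that(1)]] uniq by auto
  have zeros: "{\<tau> \<in> F. f 1 \<tau> = 0} = {w}" using wF fw u by blast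
  define t where "t = 1 / (1 - w)"
  have sq: "Re w ^ 2 + Im w ^ 2 = 1" using wn(1) cmod_power2[of w] by simp
  have n2: "(1 - Re w) ^ 2 + Im w ^ 2 = 2 * (1 - Re w)" using sq by (simp add: power2_eq_square algebra_simps)
  \<comment> \<open>The map w -> 1 / (1 - w) takes the unit circle to the line Re = 1/2, so
    \<open>tau_inf\<close> lies on the axis of the reflection.\<close>
  have tr: "Re t = 1 / 2" using wn n2 by (simp add: t_def Re_divide field_simps)
  have ti: "Im t = Im w / (2 * (1 - Re w))" using n2 by (simp add: t_def Im_divide)
  have tp: "Im t > 0" unfolding ti using wi wn by simp
  have "1 - Re w \<le> Im w"
  proof (rule power2_le_imp_le)
    have "Im w ^ 2 - (1 - Re w) ^ 2 = 2 * (Re w * (1 - Re w))"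
      using sq by (simp add: power2_eq_square algebra_simps)
    moreover have "Re w * (1 - Re w) \<ge> 0" using wn by (intro mult_nonneg_nonneg) auto
    ultimately show "(1 - Re w) ^ 2 \<le> Im w ^ 2" by linarith
  qed (use wi in simp)
  then have "Im t \<ge> 1 / 2" unfolding ti using wn by (simp add: field_simps)
  moreover have "norm (t - 1 / 2) \<ge> \<bar>Im t\<bar>" using abs_Im_le_cmod[of "t - 1 / 2"] by simp
  ultimately have tF0: "t \<in> F0" using tr tp by (simp add: F0_def upper_half_plane_def)
  have t0: "t \<noteq> 0" using tp by auto
  have "1 - 1 / t = w" using w0 by (simp add: t_def)
  then have "t ^ 7 * zero_form 1 0 t = 0" using zero_form_rotation[OF tp, of 1 1] w(2) by simp
  then have dt: "deriv g3 t = 0" using t0 by (simp add: zero_form_def)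
  have left: "\<tau> = t" if \<tau>: "\<tau> \<in> F0" "Re \<tau> \<le> 1 / 2" "deriv g3 \<tau> = 0" for \<tau>
  proof -
    have im: "Im \<tau> > 0" using \<tau> F0_Im by simp
    \<comment> \<open>The derivative of \<open>g3\<close> has no zero at height sqrt 3 / 2 or above,
      so \<tau> lies below the unit circle and can be rotated into \<open>F\<close>.\<close>
    have "\<tau> \<notin> F_left" using high_E6_deriv_nonzero(2)[OF F_left_high] \<tau> by auto
    then have "norm \<tau> < 1" using \<tau> im by (auto simp: F_left_def F0_def)
    then have wF: "1 - 1 / \<tau> \<in> F" using \<tau> by (intro F0_rotate) auto
    have "zero_form 1 1 (1 - 1 / \<tau>) = 0"
      using zero_form_rotation[OF im, of 1 1] \<tau>(3) by (simp add: zero_form_def)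
    then have "1 - 1 / \<tau> = w" using f_eq_0_iff F_Im[OF wF] u[OF wF] by simp
    then have "1 / \<tau> = 1 - w" by (simp add: algebra_simps)
    then show "\<tau> = t" unfolding t_def by (metis div_by_1 divide_divide_eq_right mult_1)
  qed
  have "tau_inf = t"
    unfolding tau_inf_def
  proof (rule the_equality)
    fix \<tau> assume \<tau>: "\<tau> \<in> F0 \<and> deriv g3 \<tau> = 0"
    have im: "Im \<tau> > 0" using \<tau> F0_Im by simp
    show "\<tau> = t"
    proof (cases "Re \<tau> \<le> 1 / 2")
      case False
      have "zero_form 1 0 (1 - cnj \<tau>) = 0"
        using zero_form_reflection[OF im, of 1 0] \<tau> by (simp add: zero_form_def)
      then have "1 - cnj \<tau> = t" using \<tau> False by (intro left) (auto simp: F0_reflect zero_form_def)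
      then have "Re \<tau> = 1 / 2" using tr by (auto simp: complex_eq_iff)
      with False show ?thesis by simp
    qed (use left \<tau> in simp)
  qed (use tF0 dt in simp)
  then show ?thesis using zeros wn(1) w0 by (intro that[of w]) (auto simp: t_def)
qed

theorem theorem5p2:
  "(\<forall>C::real. 0 < C \<and> C < 1 \<longrightarrow> \<not> (\<exists>\<tau>\<in>F. f C \<tau> = 0)) \<and>
   (\<forall>C::real. C > 1 \<longrightarrow>
      {\<tau> \<in> F. f C \<tau> = 0} = {tau_less C} \<and> tau_less C \<in> interior F \<inter> F0_less) \<and>
   (\<forall>C::real. C < 0 \<longrightarrow>
      {\<tau> \<in> F. f C \<tau> = 0} = {tau_greater C} \<and> tau_greater C \<in> interior F \<inter> F0_greater) \<and>
   (let \<tau>\<^sub>0 = 1 / (1 - tau_inf) in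
      {\<tau> \<in> F. f 0 \<tau> = 0} = {\<tau>\<^sub>0} \<and> cmod (\<tau>\<^sub>0 - 1) = 1) \<and>
   (let \<tau>\<^sub>1 = (tau_inf - 1) / tau_inf in
      {\<tau> \<in> F. f 1 \<tau> = 0} = {\<tau>\<^sub>1} \<and> cmod \<tau>\<^sub>1 = 1)"
proof -
  have no_zero: "\<not> (\<exists>\<tau>\<in>F. f C \<tau> = 0)" if "0 < C" "C < 1" for C
    using F_zero_cases[of _ C] that by auto
  obtain w where w: "{\<tau> \<in> F. f 1 \<tau> = 0} = {w}" "norm w = 1" "w \<noteq> 0" "w \<noteq> 1" "tau_inf = 1 / (1 - w)"
    using zeros_C_0_1 .
  have 1: "(tau_inf - 1) / tau_inf = w" unfolding w(5) using w(3,4) by (simp add: field_simps)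
  \<comment> \<open>On the unit circle the reflected zero 1 - \<open>cnj\<close> w equals 1 - 1/w,
    and this is 1 / (1 - \<open>tau_inf\<close>).\<close>
  have "w * cnj w = 1" using complex_norm_square[of w] w(2) by simp
  then have "cnj w = 1 / w" using w(3) by (simp add: field_simps)
  moreover have "1 / (1 - tau_inf) = 1 - 1 / w"
  proof -
    have "1 - tau_inf = - w / (1 - w)" unfolding w(5) using w(3,4) by (simp add: field_simps)
    then have "1 / (1 - tau_inf) = (1 - w) / - w" by simp
    also have "\<dots> = 1 - 1 / w" using w(3) by (simp add: field_simps)
    finally show ?thesis .
  qed
  ultimately have 0: "1 / (1 - tau_inf) = 1 - cnj w" by simp
  have zero: "{\<tau> \<in> F. f 0 \<tau> = 0} = {1 - cnj w}" by (rule zeros_reflect) (simp add: w(1))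
  have norm: "cmod (1 - cnj w - 1) = 1" using w(2) by simp
  show ?thesis
    unfolding Let_def 0 1
    by (intro conjI allI impI no_zero zeros_C_gt_1(1) zeros_C_less_0(1) zero norm w(1,2) IntI
        zeros_C_gt_1(2,3) zeros_C_less_0(2,3)) auto
qed

end
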